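(* Let $B\in\mathbb{R}\setminus\{0\}$ and $\gamma>0$. Suppose $u_0(\cdot,\cdot,i)\in C_0^\infty(\mathbb{R}\times\mathbb{T})$ for $i=1,2$. For $N\in\mathbb{N}$ let $u_N(y,k,i,t)$ be the solution of the spatially scaled linear Boltzmann equation $$\begin{cases}\partial_tu(y,k,i,t)+\dfrac1{N^{3/5}}\dfrac1{2\pi}\omega'(k)\,\partial_yu(y,k,i,t)=\gamma\,\mathcal{L}u(y,k,i,t),\\ u(y,k,i,0)=u_0(y,k,i),\end{cases}\qquad y\in\mathbb{R},\ k\in\mathbb{T},\ i=1,2,\ t\ge0.$$ Define the initial local density of energy at $y\in\mathbb{R}$ by $\bar u_0(y)=\sum_{i=1,2}\int_{\mathbb{T}}dk\,u_0(y,k,i)$. Then, for all $y\in\mathbb{R}$ and $t\ge0$, $$\lim_{N\to\infty}\sum_{i=1,2}\int_{\mathbb{T}}dk\,\Big|u_N(y,k,i,Nt)-\tfrac12\bar u(y,t)\Big|^2=0,$$ where $\bar u$ is the solution of $$\begin{cases}\partial_t\bar u(y,t)=-D(-\Delta_y)^{5/6}\bar u(y,t),\\ \bar u(y,0)=\bar u_0(y),\end{cases}$$ and $D=D(B,\gamma,\alpha)$ is a positive constant such that $$D=C\,|B|^{-1/3}\gamma^{-2/3}\,\widehat\alpha''(0)$$ with a universal constant $C$. In particular, for all $y\in\mathbb{R}$ and $t\ge0$, $$\lim_{N\to\infty}\Big|\sum_{i=1,2}\int_{\mathbb{T}}dk\,u_N(y,k,i,Nt)-\bar u(y,t)\Bi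g|^2=0.$$
   Context: $\mathbb{T}\cong[-\frac12,\frac12)$ is the one-dimensional torus. $C_0^\infty$ denotes smooth compactly supported functions. The function $\alpha:\mathbb{Z}\to\mathbb{R}$ is given by $\alpha(0)=2$, $\alpha(1)=\alpha(-1)=-1$, $\alpha(x)=0$ for $|x|\ge2$, and its Fourier transform is $\widehat\alpha(k)=\sum_{x\in\mathbb{Z}}e^{-2\pi\sqrt{-1}kx}\alpha(x)=2-2\cos2\pi k$. Set $$\omega_1(k)=\sqrt{\widehat\alpha(k)+\tfrac{B^2}{4}}+\tfrac B2,\quad \omega_2(k)=\sqrt{\widehat\alpha(k)+\tfrac{B^2}{4}}-\tfrac B2,\quad \theta_i(k)=\sqrt{\frac{\omega_i(k)}{\omega_1(k)+\omega_2(k)}},\ i=1,2;$$ $\omega_1'=\omega_2'$ and $\omega'$ denotes this common derivative in $k$. Set $R(k,k')=16\sin^2(\pi k)\sin^2(\pi k')$ and $$\mathcal{L}u(y,k,i,t)=\sum_{j=1,2}\int_{\mathbb{T}}dk'\,\theta_i(k)^2R(k,k')\theta_j(k')^2\big(u(y,k',j,t)-u(y,k,i,t)\big).$$ The solution $u_N$ is understood as the bounded solution that is continuously differentiable in $(y,t)$ and satisfies the equation pointwise. $(-\Delta_y)^{5/6}$ is the fractional Laplacian on $\mathbb{R}$, i.e. the Fourier multiplier $|\xi|^{5/3}$ (with $-\Delta_y$ having multiplier $\xi^2$), and $\bar u(\cdot,t)$ is the solution obtained by applying the semigroup $e^{-tD(-\Delta_y)^{5/6}}$ to $\bar u_0$.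 "Universal" means that $C$ does not depend on $B$, $\gamma$, $\alpha$.
   Formalization: The first limit is stated for t > 0 instead of t ≥ 0: at t = 0 it is false, since u_N(y,k,i,0) = u_0(y,k,i) need not equal ū_0(y)/2 (e.g. u_0(y,k,1) = φ(y), u_0(y,k,2) = 0). The second limit is kept for all t ≥ 0. *)

theory Defs
  imports "HOL-Analysis.Analysis"
begin

primrec times_differentiable ::
    "nat \<Rightarrow> ('a::real_normed_vector \<Rightarrow> 'b::real_normed_vector) \<Rightarrow> bool" where
  "times_differentiable 0 f \<longleftrightarrow> continuous_on UNIV f"
| "times_differentiable (Suc n) f \<longleftrightarrow>
     (\<forall>x. f differentiable (at x)) \<and>
     (\<forall>v. times_differentiable n (\<lambda>x. frechet_derivative f (at x) v))"

definition smooth :: "('a::real_normed_vector \<Rightarrow> 'b::real_normed_vector) \<Rightarrow> bool" where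
  "smooth f \<longleftrightarrow> (\<forall>n. times_differentiable n f)"

text \<open>
  The torus is represented by its fundamental domain. A function that has to be regular
  on the torus is a 1-periodic function on the line with that regularity.
\<close>

definition torus :: "real set" where
  "torus = {-1/2 ..< 1/2}"

text \<open>
  Smooth, compactly supported functions on the product of the line and the torus: since the
  torus is compact, only the support in the first variable has to be bounded.
\<close>

definition test_function :: "(real \<Rightarrow> real \<Rightarrow> complex) \<Rightarrow> bool" where
  "test_function f \<longleftrightarrow>
     smooth (\<lambda>(y, k). f y k) \<and>
     (\<forall>y k. f y (k + 1) = f y k) \<and>
     bounded {y. \<exists>k. f y k \<noteq> 0}"

definition alpha :: "int \<Rightarrow> real" where
  "alpha x = (if x = 0 then 2 else if \<bar>x\<bar> = 1 then -1 else 0)"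

definition alpha_hat :: "real \<Rightarrow> real" where
  "alpha_hat k = Re (\<Sum>\<^sub>\<infinity>x\<in>UNIV. exp (- 2 * pi * \<i> * k * of_int x) * alpha x)"

text \<open>The series is real, so taking the real part above loses nothing.\<close>

lemma alpha_series:
  "(\<Sum>\<^sub>\<infinity>x\<in>UNIV. exp (- 2 * pi * \<i> * k * of_int x) * alpha x)
     = complex_of_real (2 - 2 * cos (2 * pi * k))"
proof -
  have "(\<Sum>\<^sub>\<infinity>x\<in>UNIV. exp (- 2 * pi * \<i> * k * of_int x) * alpha x)
      = (\<Sum>\<^sub>\<infinity>x\<in>{-1, 0, 1}. exp (- 2 * pi * \<i> * k * of_int x) * alpha x)"
    by (rule infsum_cong_neutral) (auto simp: alpha_def)
  also have "\<dots> = 2 - (exp (\<i> * (2 * pi * k)) + exp (- (\<i> * (2 * pi * k))))"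
    by (simp add: alpha_def mult_ac)
  also have "\<dots> = 2 - 2 * cos (complex_of_real (2 * pi * k))"
    by (simp add: cos_exp_eq field_simps)
  finally show ?thesis
    by (simp only: cos_of_real) simp
qed

lemma alpha_hat_eq: "alpha_hat k = 2 - 2 * cos (2 * pi * k)"
  unfolding alpha_hat_def alpha_series by simp

definition omega :: "real \<Rightarrow> nat \<Rightarrow> real \<Rightarrow> real" where
  "omega B i k = sqrt (alpha_hat k + B\<^sup>2 / 4) + (if i = 1 then B / 2 else - (B / 2))"

definition theta :: "real \<Rightarrow> nat \<Rightarrow> real \<Rightarrow> real" where
  "theta B i k = sqrt (omega B i k / (omega B 1 k + omega B 2 k))"

text \<open>The two dispersion relations differ by a constant, so they have the same derivative.\<close>

definition omega_deriv :: "real \<Rightarrow> real \<Rightarrow> real" where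
  "omega_deriv B k = deriv (omega B 1) k"

lemma omega_deriv_eq: "omega_deriv B k = deriv (omega B 2) k"
proof -
  have "(omega B 1 has_field_derivative d) (at k) \<longleftrightarrow>
        (omega B 2 has_field_derivative d) (at k)" for d
  proof
    assume "(omega B 1 has_field_derivative d) (at k)"
    then have "((\<lambda>k. omega B 1 k - B) has_field_derivative d) (at k)"
      by (auto intro!: derivative_eq_intros)
    then show "(omega B 2 has_field_derivative d) (at k)"
      by (simp add: omega_def[abs_def])
  next
    assume "(omega B 2 has_field_derivative d) (at k)"
    then have "((\<lambda>k. omega B 2 k + B) has_field_derivative d) (at k)"
      by (auto intro!: derivative_eq_intros)
    then show "(omega B 1 has_field_derivative d) (at k)"
      by (simp add: omega_def[abs_def] add.commute)
  qed
  then show ?thesis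
    by (simp add: omega_deriv_def deriv_def)
qed

definition scattering_kernel :: "real \<Rightarrow> real \<Rightarrow> real" where
  "scattering_kernel k k' = 16 * (sin (pi * k))\<^sup>2 * (sin (pi * k'))\<^sup>2"

definition collision :: "real \<Rightarrow> (real \<Rightarrow> nat \<Rightarrow> complex) \<Rightarrow> real \<Rightarrow> nat \<Rightarrow> complex" where
  "collision B f k i =
     (\<Sum>j\<in>{1, 2}. LINT k':torus|lborel.
        of_real ((theta B i k)\<^sup>2 * scattering_kernel k k' * (theta B j k')\<^sup>2) * (f k' j - f k i))"

text \<open>
  Bounded solutions of the linear Boltzmann equation, with the transport term multiplied by
  \<open>\<epsilon>\<close>, that are continuously differentiable in \<open>(y, t)\<close> up to the boundary \<open>t = 0\<close>.
  Measurability in \<open>k\<close> is required because the Bochner integral of a non-measurable function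
  is zero by convention; for bounded functions it makes the collision integral genuine.
\<close>

definition boltzmann_solution ::
    "real \<Rightarrow> real \<Rightarrow> real \<Rightarrow> (real \<Rightarrow> real \<Rightarrow> nat \<Rightarrow> complex) \<Rightarrow>
     (real \<Rightarrow> real \<Rightarrow> nat \<Rightarrow> real \<Rightarrow> complex) \<Rightarrow> bool" where
  "boltzmann_solution B \<gamma> \<epsilon> u0 u \<longleftrightarrow>
     (\<exists>M. \<forall>y. \<forall>k\<in>torus. \<forall>i\<in>{1, 2}. \<forall>t\<ge>0. norm (u y k i t) \<le> M) \<and>
     (\<forall>y. \<forall>i\<in>{1, 2}. \<forall>t\<ge>0. set_borel_measurable lborel torus (\<lambda>k. u y k i t)) \<and>
     (\<forall>k\<in>torus. \<forall>i\<in>{1, 2}. \<exists>uy ut.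
        continuous_on (UNIV \<times> {0..}) (\<lambda>(y, t). uy y t) \<and>
        continuous_on (UNIV \<times> {0..}) (\<lambda>(y, t). ut y t) \<and>
        (\<forall>y. \<forall>t\<ge>0.
           ((\<lambda>y'. u y' k i t) has_vector_derivative uy y t) (at y) \<and>
           ((\<lambda>t'. u y k i t') has_vector_derivative ut y t) (at t within {0..}) \<and>
           ut y t + of_real (\<epsilon> * (1 / (2 * pi)) * omega_deriv B k) * uy y t
             = of_real \<gamma> * collision B (\<lambda>k' j. u y k' j t) k i)) \<and>
     (\<forall>y. \<forall>k\<in>torus. \<forall>i\<in>{1, 2}. u y k i 0 = u0 y k i)"

definition local_density :: "(real \<Rightarrow> real \<Rightarrow> nat \<Rightarrow> complex) \<Rightarrow> real \<Rightarrow> complex" where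
  "local_density v y = (\<Sum>i\<in>{1, 2}. LINT k:torus|lborel. v y k i)"

text \<open>
  The Fourier transform is normalised so that the negative Laplacian has multiplier \<open>\<xi>\<^sup>2\<close>.
\<close>

definition fourier :: "(real \<Rightarrow> complex) \<Rightarrow> real \<Rightarrow> complex" where
  "fourier f \<xi> = (LINT y|lborel. exp (- \<i> * of_real (\<xi> * y)) * f y)"

definition fourier_multiplier :: "(real \<Rightarrow> complex) \<Rightarrow> (real \<Rightarrow> complex) \<Rightarrow> real \<Rightarrow> complex" where
  "fourier_multiplier m f y =
     of_real (1 / (2 * pi)) * (LINT \<xi>|lborel. exp (\<i> * of_real (\<xi> * y)) * (m \<xi> * fourier f \<xi>))"

text \<open>
  The semigroup generated by \<open>- D (- \<Delta>)\<^sup>s\<close>, where the fractional Laplacian has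
  multiplier \<open>\<bar>\<xi>\<bar> powr (2 * s)\<close>.
\<close>

definition fractional_heat :: "real \<Rightarrow> real \<Rightarrow> real \<Rightarrow> (real \<Rightarrow> complex) \<Rightarrow> real \<Rightarrow> complex" where
  "fractional_heat D s t =
     fourier_multiplier (\<lambda>\<xi>. of_real (exp (- t * D * \<bar>\<xi>\<bar> powr (2 * s))))"

end

theory Submission
  imports Defs "HOL-Probability.Probability"
begin

text \<open>
  The scattering kernel factorises, so the collision operator is \<open>lam * (w - u)\<close> with \<open>w\<close> the
  \<open>lam\<close>-average of \<open>u\<close>. For a fixed frequency \<open>\<xi>\<close> in \<open>y\<close> this leaves a family of damped linear
  equations coupled through one average. Pairing with the corrector
  \<open>lam / (lam + \<i> * c)\<close>, where \<open>c\<close> is \<open>\<xi>\<close> times the scaled velocity, yields an almost closed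
  scalar equation for the total mass; its decay rate
  \<open>(\<integral> lam * c\<^sup>2 / (lam\<^sup>2 + c\<^sup>2)) / 2\<close>, multiplied by \<open>N\<close>, tends to \<open>D * \<bar>\<xi>\<bar> powr (5/3)\<close>.
  The errors are controlled by the energy dissipation, which forces the modes to agree with
  their average on the long time scale. Fourier inversion and a decay bound
  \<open>A / (1 + \<xi>\<^sup>2)\<close>, propagated from the initial data by a maximum principle, give the result in
  physical space.
\<close>

text \<open>The obstacle is the missing spectral gap: in both bands the rates vanish at wave number
  zero. Modes with \<open>lam\<close> below a cut-off \<eta> are controlled by the smallness of
  their measure, the others by dissipation. The dissipation budget is fixed, since the energy starts
  below \<open>2 * A\<^sup>2\<close>, while the horizon is \<open>N * \<tau>\<close>; this leaves
  room to let \<eta> tend to 0 with \<open>N\<close>. The corrector is needed because the total mass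
  itself does not close: its derivative contains the current, the integral of \<open>c * f\<close>,
  which is not a function of the average. The scaling comes from the slow band, where
  \<open>lam\<close> is of order \<open>k^4\<close> and \<open>c\<close> of order
  \<open>N powr (-3/5) * \<xi> * k\<close>. They balance at \<open>k\<close> of order
  \<open>N powr (-1/5)\<close>; there the integrand of the rate is of order \<open>k^4\<close> on a
  window of width \<open>k\<close>, so the rate is of order \<open>k^5\<close>, that is
  \<open>1 / N\<close>. As the balance reads \<open>k^3\<close> proportional to \<xi>, the same
  count yields \<open>\<bar>\<xi>\<bar> powr (5/3)\<close>. In the other band \<open>lam\<close> is
  of order \<open>k^2\<close> and the contribution is only of order
  \<open>N powr (-6/5)\<close>.\<close>

section \<open>Differential inequalities, a contraction principle, measurability\<close>

lemma has_vector_derivative_norm_bound: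
  fixes f :: "real \<Rightarrow> 'b::real_normed_vector"
  assumes "convex S" "\<And>s. s \<in> S \<Longrightarrow> (f has_vector_derivative f' s) (at s within S)"
    "\<And>s. s \<in> S \<Longrightarrow> norm (f' s) \<le> B" "s \<in> S" "t \<in> S"
  shows "norm (f s - f t) \<le> B * \<bar>s - t\<bar>"
proof -
  have "norm (f s - f t) \<le> B * norm (s - t)"
  proof (rule differentiable_bound[OF assms(1), where f' = "\<lambda>s h. h *\<^sub>R f' s"])
    show "(f has_derivative (\<lambda>h. h *\<^sub>R f' x)) (at x within S)" if "x \<in> S" for x
      using assms(2)[OF that] by (simp add: has_vector_derivative_def)
    show "onorm (\<lambda>h. h *\<^sub>R f' x) \<le> B" if "x \<in> S" for x
    proof (rule onorm_le)
      fix h :: real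
      show "norm (h *\<^sub>R f' x) \<le> B * norm h"
        using mult_left_mono[OF assms(3)[OF that], of "\<bar>h\<bar>"] by (simp add: mult.commute)
    qed
  qed (use assms in auto)
  then show ?thesis by simp
qed

text \<open>The mean value inequality on the convex set \<open>S\<close> bounds the normalised
  remainders by \<open>2 * g\<close>, so dominated convergence along sequences applies. Derivatives
  are taken within \<open>S\<close> because they are one-sided at the ends of the time intervals
  used below.\<close>

lemma has_vector_derivative_integral:
  fixes f :: "real \<Rightarrow> 'x \<Rightarrow> 'b::{banach, second_countable_topology}"
  assumes S: "convex S" "t \<in> S"
    and f_int: "\<And>s. s \<in> S \<Longrightarrow> integrable M (f s)"
    and f'_meas: "f' t \<in> borel_measurable M"
    and der: "\<And>x s. x \<in> space M \<Longrightarrow> s \<in> S \<Longrightarrow>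
      ((\<lambda>s. f s x) has_vector_derivative f' s x) (at s within S)"
    and bnd: "\<And>x s. x \<in> space M \<Longrightarrow> s \<in> S \<Longrightarrow> norm (f' s x) \<le> g x"
    and g: "integrable M g"
  shows "((\<lambda>s. \<integral>x. f s x \<partial>M) has_vector_derivative (\<integral>x. f' t x \<partial>M)) (at t within S)"
proof -
  have f'_int: "integrable M (f' t)"
    using Bochner_Integration.integrable_bound[OF g f'_meas]
    by (smt (verit) AE_I2 S(2) bnd norm_ge_zero real_norm_def)
  define q where "q = (\<lambda>s x. (1 / \<bar>s - t\<bar>) *\<^sub>R (f s x - (f t x + (s - t) *\<^sub>R f' t x)))"
  have q_int: "(\<integral>x. q s x \<partial>M) =
      (1 / \<bar>s - t\<bar>) *\<^sub>R ((\<integral>x. f s x \<partial>M) - ((\<integral>x. f t x \<partial>M) + (s - t) *\<^sub>R (\<integral>x. f' t x \<partial>M)))"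
    if "s \<in> S" for s
    unfolding q_def using f_int[OF that] f_int[OF S(2)] f'_int by simp
  have "((\<lambda>s. (1 / \<bar>s - t\<bar>) *\<^sub>R ((\<integral>x. f s x \<partial>M) - ((\<integral>x. f t x \<partial>M) + (s - t) *\<^sub>R (\<integral>x. f' t x \<partial>M))))
      \<longlongrightarrow> 0) (at t within S)"
    unfolding tendsto_at_iff_sequentially comp_def
  proof (intro allI impI)
    fix X :: "nat \<Rightarrow> real"
    assume X: "\<forall>i. X i \<in> S - {t}" "X \<longlonglongrightarrow> t"
    have "(\<lambda>n. \<integral>x. q (X n) x \<partial>M) \<longlonglongrightarrow> (\<integral>x. 0 \<partial>M)"
    proof (rule integral_dominated_convergence[where w = "\<lambda>x. 2 * g x"])
      show "q (X i) \<in> borel_measurable M" for i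
        unfolding q_def using f_int[of "X i"] f_int[OF S(2)] f'_meas X(1)
        by (auto intro!: borel_measurable_scaleR borel_measurable_diff borel_measurable_add
            borel_measurable_const)
      show "AE x in M. (\<lambda>i. q (X i) x) \<longlonglongrightarrow> 0"
      proof (rule AE_I2)
        fix x assume "x \<in> space M"
        from der[OF this S(2)] show "(\<lambda>i. q (X i) x) \<longlonglongrightarrow> 0"
          using X unfolding has_vector_derivative_def has_derivative_within
            tendsto_at_iff_sequentially comp_def q_def by simp
      qed
      show "AE x in M. norm (q (X i) x) \<le> 2 * g x" for i
      proof (rule AE_I2)
        fix x assume x: "x \<in> space M"
        have Xi: "X i \<in> S" "X i \<noteq> t" using X(1) by auto
        have "norm (f (X i) x - f t x) \<le> g x * \<bar>X i - t\<bar>"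
          by (rule has_vector_derivative_norm_bound[OF S(1), where f' = "\<lambda>s. f' s x"])
            (use der bnd x Xi S in auto)
        moreover have "norm ((X i - t) *\<^sub>R f' t x) \<le> g x * \<bar>X i - t\<bar>"
          using bnd[OF x S(2)] by (simp add: mult.commute mult_right_mono)
        ultimately have "norm (f (X i) x - (f t x + (X i - t) *\<^sub>R f' t x)) \<le> 2 * g x * \<bar>X i - t\<bar>"
          by (smt (verit, ccfv_threshold) diff_diff_eq norm_triangle_ineq4 distrib_right mult_2)
        then show "norm (q (X i) x) \<le> 2 * g x"
          using Xi unfolding q_def norm_scaleR by (simp add: field_simps del: scaleR_diff_right scaleR_add_right)
      qed
    qed (use g in auto)
    then show "(\<lambda>n. (1 / \<bar>X n - t\<bar>) *\<^sub>R ((\<integral>x. f (X n) x \<partial>M) -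
        ((\<integral>x. f t x \<partial>M) + (X n - t) *\<^sub>R (\<integral>x. f' t x \<partial>M)))) \<longlonglongrightarrow> 0"
      using X(1) q_int by simp
  qed
  then show ?thesis
    unfolding has_vector_derivative_def has_derivative_within
    by (auto intro: bounded_linear_scaleR_left)
qed

text \<open>The integrating factor with exponent \<open>l + \<i> * b\<close> absorbs damping and
  phase, so \<open>b\<close> disappears from the norms. The bound is a convex combination of the
  initial bound and the forcing bound, which is what turns it into a contraction later.\<close>

lemma damped_ode_bound:
  fixes g :: "real \<Rightarrow> complex"
  assumes t: "0 \<le> t" and l: "0 \<le> l"
    and der: "\<And>s. s \<in> {0..t} \<Longrightarrow>
      (g has_vector_derivative (- (of_real l + \<i> * of_real b) * g s + of_real l * W s)) (at s within {0..t})"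
    and W: "\<And>s. s \<in> {0..t} \<Longrightarrow> norm (W s) \<le> S" and g0: "norm (g 0) \<le> A"
  shows "norm (g t) \<le> A * exp (- l * t) + (1 - exp (- l * t)) * S"
proof (cases "t = 0")
  case True
  then show ?thesis using g0 by simp
next
  case False
  define z where "z = of_real l + \<i> * of_real b"
  define h where "h = (\<lambda>s. exp (of_real s * z) * g s)"
  have hder: "(h has_vector_derivative (exp (of_real s * z) * (of_real l * W s))) (at s within {0..t})"
    if "s \<in> {0..t}" for s
  proof -
    have "((\<lambda>s. exp (of_real s * z)) has_vector_derivative (exp (of_real s * z) * z)) (at s within {0..t})"
      by (rule has_vector_derivative_real_field) (auto intro!: derivative_eq_intros)
    from has_vector_derivative_mult[OF this der[OF that]] show ?thesis
      unfolding h_def z_def[symmetric] by (simp add: algebra_simps)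
  qed
  have "norm (h t - h 0) \<le> S * exp (l * t) - S * exp (l * 0)"
  proof (rule differentiable_bound_general[where \<phi> = "\<lambda>s. S * exp (l * s)"
        and f' = "\<lambda>s. exp (of_real s * z) * (of_real l * W s)" and \<phi>' = "\<lambda>s. S * (exp (l * s) * l)"])
    show "continuous_on {0..t} h"
      using hder by (rule continuous_on_vector_derivative)
    show "(h has_vector_derivative exp (of_real s * z) * (of_real l * W s)) (at s)"
      if "0 < s" "s < t" for s
      using hder[of s] that at_within_interior[of s "{0..t}"] by simp
    show "norm (exp (of_real s * z) * (of_real l * W s)) \<le> S * (exp (l * s) * l)"
      if "0 < s" "s < t" for s
    proof -
      have "norm (exp (of_real s * z) * (of_real l * W s)) = exp (l * s) * l * norm (W s)"
        using l by (simp add: norm_mult z_def mult.commute)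
      also have "\<dots> \<le> exp (l * s) * l * S"
        using W[of s] that l by (intro mult_left_mono) auto
      finally show ?thesis by (simp add: mult_ac)
    qed
    show "((\<lambda>s. S * exp (l * s)) has_vector_derivative S * (exp (l * s) * l)) (at s)" for s
      unfolding has_real_derivative_iff_has_vector_derivative[symmetric]
      by (auto intro!: derivative_eq_intros)
  qed (use t False in \<open>auto intro!: continuous_intros\<close>)
  then have "norm (h t) \<le> A + S * (exp (l * t) - 1)"
    using g0 norm_triangle_sub[of "h t" "h 0"] by (simp add: h_def algebra_simps)
  moreover have "norm (h t) = exp (l * t) * norm (g t)"
    by (simp add: h_def norm_mult z_def mult.commute)
  ultimately have "exp (l * t) * norm (g t) \<le> A + S * (exp (l * t) - 1)" by simp
  then have "exp (- l * t) * (exp (l * t) * norm (g t)) \<le> exp (- l * t) * (A + S * (exp (l * t) - 1))"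
    by (rule mult_left_mono) simp
  then show ?thesis
    by (simp add: algebra_simps flip: exp_add mult.assoc)
qed

text \<open>Maximum principle in abstract form: a bound \<open>S\<close> above \<open>A\<close>
  always improves to one whose excess over \<open>A\<close> is smaller by the factor
  \<open>q\<close>. Some finite bound \<open>M\<close> starts the iteration, whose limit is
  \<open>A\<close>.\<close>

lemma contraction_bound:
  fixes Z :: "'p \<Rightarrow> real"
  assumes bdd: "\<And>p. p \<in> Q \<Longrightarrow> Z p \<le> M" and q: "0 \<le> q" "q < 1"
    and step: "\<And>S p. A \<le> S \<Longrightarrow> (\<And>p. p \<in> Q \<Longrightarrow> Z p \<le> S) \<Longrightarrow> p \<in> Q \<Longrightarrow> Z p \<le> A + q * (S - A)"
    and p: "p \<in> Q"
  shows "Z p \<le> A"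
proof -
  \<comment> \<open>Only bounds that are at least \<open>A\<close> can be improved, so the iteration
    must start there or above.\<close>
  define M' where "M' = max M A"
  have iter: "\<forall>p\<in>Q. Z p \<le> A + q ^ n * (M' - A)" for n
  proof (induction n)
    case 0
    then show ?case using bdd by (force simp: M'_def)
  next
    case (Suc n)
    show ?case
    proof
      fix p assume p: "p \<in> Q"
      have "A \<le> A + q ^ n * (M' - A)" using q by (simp add: M'_def)
      from step[OF this _ p] Suc show "Z p \<le> A + q ^ Suc n * (M' - A)"
        by (simp add: mult.assoc)
    qed
  qed
  have "(\<lambda>n. A + q ^ n * (M' - A)) \<longlonglongrightarrow> A + 0 * (M' - A)"
    using q by (intro tendsto_intros LIMSEQ_realpow_zero)
  then show ?thesis
    using LIMSEQ_le_const[of _ _ "Z p"] iter p by auto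
qed

text \<open>Rounding \<open>y\<close> down to a grid leaves countably many measurable sections, and
  continuity in \<open>y\<close> recovers \<open>f\<close> as the grid is refined. This supplies the
  joint measurability that Fubini requires.\<close>

lemma caratheodory_measurable:
  fixes f :: "real \<Rightarrow> 'x \<Rightarrow> 'b::{metric_space}"
  assumes cont: "\<And>x. x \<in> space M \<Longrightarrow> continuous_on UNIV (\<lambda>y. f y x)"
    and meas: "\<And>y. f y \<in> borel_measurable M"
  shows "(\<lambda>(y, x). f y x) \<in> borel_measurable (lborel \<Otimes>\<^sub>M M)"
proof (rule borel_measurable_LIMSEQ_metric)
  fix n :: nat
  have "(\<lambda>p. (\<lambda>k p. f (of_int k / real (Suc n)) (snd p)) \<lfloor>fst p * real (Suc n)\<rfloor> p)
      \<in> borel_measurable (lborel \<Otimes>\<^sub>M M)"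
    by (rule measurable_compose_countable'[where I = UNIV])
      (auto intro!: measurable_compose[OF measurable_snd meas])
  then show "(\<lambda>p. f (of_int \<lfloor>fst p * real (Suc n)\<rfloor> / real (Suc n)) (snd p))
      \<in> borel_measurable (lborel \<Otimes>\<^sub>M M)"
    by simp
next
  fix p :: "real \<times> 'x" assume p: "p \<in> space (lborel \<Otimes>\<^sub>M M)"
  obtain y x where yx: "p = (y, x)" by (cases p)
  have x: "x \<in> space M" using p yx by (auto simp: space_pair_measure)
  have "(\<lambda>n. of_int \<lfloor>y * real (Suc n)\<rfloor> / real (Suc n)) \<longlonglongrightarrow> y"
  proof (rule real_tendsto_sandwich)
    show "\<forall>\<^sub>F n in sequentially. y - 1 / real (Suc n) \<le> of_int \<lfloor>y * real (Suc n)\<rfloor> / real (Suc n)"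
    proof (intro always_eventually allI)
      fix n
      have "y * real (Suc n) - 1 \<le> of_int \<lfloor>y * real (Suc n)\<rfloor>" by linarith
      then have "(y * real (Suc n) - 1) / real (Suc n) \<le> of_int \<lfloor>y * real (Suc n)\<rfloor> / real (Suc n)"
        by (rule divide_right_mono) simp
      then show "y - 1 / real (Suc n) \<le> of_int \<lfloor>y * real (Suc n)\<rfloor> / real (Suc n)"
        by (simp add: diff_divide_distrib del: of_nat_Suc)
    qed
    show "\<forall>\<^sub>F n in sequentially. of_int \<lfloor>y * real (Suc n)\<rfloor> / real (Suc n) \<le> y"
    proof (intro always_eventually allI)
      fix n
      have "of_int \<lfloor>y * real (Suc n)\<rfloor> \<le> y * real (Suc n)" by linarith
      then show "of_int \<lfloor>y * real (Suc n)\<rfloor> / real (Suc n) \<le> y"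
        by (simp add: field_simps)
    qed
    have "(\<lambda>n. y - 1 / real (Suc n)) \<longlonglongrightarrow> y - 0"
      using LIMSEQ_inverse_real_of_nat by (intro tendsto_intros) (simp add: inverse_eq_divide)
    then show "(\<lambda>n. y - 1 / real (Suc n)) \<longlonglongrightarrow> y" by simp
  qed auto
  then show "(\<lambda>n. f (of_int \<lfloor>fst p * real (Suc n)\<rfloor> / real (Suc n)) (snd p)) \<longlonglongrightarrow> (case p of (y, x) \<Rightarrow> f y x)"
    unfolding yx using continuous_on_tendsto_compose[OF cont[OF x]] by simp
qed

lemma inverse_quadratic_integrable: "integrable lborel (\<lambda>q::real. c / (1 + q\<^sup>2))"
  using integrable_mult_right[of c lborel "\<lambda>q::real. inverse (1 + q\<^sup>2)"] integrable_inverse_1_plus_square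
  by (simp add: set_integrable_def divide_inverse)

section \<open>Relaxation at a fixed frequency\<close>

text \<open>The space will be two copies of the torus, hence the mass 2, and \<open>kap\<close>
  makes \<open>kap * lam\<close> a probability density. No positive lower bound of
  \<open>lam\<close> can be assumed, as the actual rates vanish at wave number zero.\<close>

locale relaxation_kernel = finite_measure mu for mu :: "'x measure" +
  fixes lam :: "'x \<Rightarrow> real" and kap Lam :: real
  assumes mass: "measure mu (space mu) = 2"
    and lam_meas [measurable]: "lam \<in> borel_measurable mu"
    and lam_nonneg: "x \<in> space mu \<Longrightarrow> 0 \<le> lam x"
    and lam_le: "x \<in> space mu \<Longrightarrow> lam x \<le> Lam"
    and kap_lam: "kap * (\<integral>x. lam x \<partial>mu) = 1"
begin

lemma bounded_integrable:
  fixes g :: "'x \<Rightarrow> 'b::{banach, second_countable_topology}"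
  assumes "g \<in> borel_measurable mu" "\<And>x. x \<in> space mu \<Longrightarrow> norm (g x) \<le> B"
  shows "integrable mu g"
  by (rule integrable_const_bound[where B = B]) (use assms in auto)

lemma lam_integrable: "integrable mu lam"
  by (rule bounded_integrable[where B = Lam]) (use lam_nonneg lam_le in \<open>auto simp: abs_le_iff intro: order_trans[of _ 0]\<close>)

lemma norm_integral_le:
  fixes g :: "'x \<Rightarrow> 'b::{banach, second_countable_topology}"
  assumes "integrable mu g" "integrable mu h" "\<And>x. x \<in> space mu \<Longrightarrow> norm (g x) \<le> h x"
  shows "norm (\<integral>x. g x \<partial>mu) \<le> (\<integral>x. h x \<partial>mu)"
  using integral_norm_bound[of mu g] integral_mono[OF integrable_norm[OF assms(1)] assms(2,3)]
  by linarith

lemma kap_pos: "kap > 0"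
proof -
  have "(\<integral>x. lam x \<partial>mu) \<ge> 0" by (rule integral_nonneg_AE) (auto intro: lam_nonneg)
  then show ?thesis using kap_lam by (metis mult_nonpos_nonneg not_le not_one_le_zero)
qed

lemma integral_lam: "(\<integral>x. lam x \<partial>mu) = 1 / kap"
  using kap_lam kap_pos by (simp add: field_simps)

lemma Lam_nonneg: "0 \<le> Lam"
proof -
  have "space mu \<noteq> {}" using mass by (metis measure_empty zero_neq_numeral)
  then show ?thesis using lam_nonneg lam_le by fastforce
qed

lemma average_bound:
  assumes "g \<in> borel_measurable mu" "\<And>x. x \<in> space mu \<Longrightarrow> norm (g x) \<le> S"
  shows "norm (of_real kap * (\<integral>x. of_real (lam x) * (g x :: complex) \<partial>mu)) \<le> S"
proof -
  have "norm (\<integral>x. of_real (lam x) * g x \<partial>mu) \<le> (\<integral>x. lam x * S \<partial>mu)"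
    by (rule norm_integral_le)
      (use assms lam_integrable Lam_nonneg in \<open>auto simp: norm_mult lam_nonneg
        intro!: bounded_integrable[where B = "Lam * S"] mult_mono lam_le
          borel_measurable_times mult_left_mono\<close>)
  also have "\<dots> = S / kap" using lam_integrable integral_lam by simp
  finally show ?thesis
    using kap_pos by (simp add: norm_mult field_simps)
qed

text \<open>A smooth substitute for the measure of the set where \<open>lam\<close> is at most
  \<eta>: the integrand is at least 1/2 there.\<close>

definition slow :: "real \<Rightarrow> real" where
  "slow \<eta> = (\<integral>x. \<eta> / (lam x + \<eta>) \<partial>mu)"

lemma slow_bounds: assumes "x \<in> space mu" "0 < \<eta>" shows "0 \<le> \<eta> / (lam x + \<eta>)" "\<eta> / (lam x + \<eta>) \<le> 1"
  using assms lam_nonneg[of x] by (auto simp: field_simps)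

lemma slow_integrable: "0 < \<eta> \<Longrightarrow> integrable mu (\<lambda>x. \<eta> / (lam x + \<eta>))"
  by (rule bounded_integrable[where B = 1]) (use slow_bounds in \<open>auto simp del: abs_divide\<close>)

lemma slow_nonneg: "0 < \<eta> \<Longrightarrow> 0 \<le> slow \<eta>"
  unfolding slow_def by (rule integral_nonneg_AE) (auto intro: slow_bounds)

end

text \<open>One frequency in \<open>y\<close>: \<open>c\<close> is the frequency times the velocity.
  The condition \<open>c_odd\<close> excludes an effective drift, so the decay rate is real. The
  bound \<open>M\<close> merely starts the maximum principle; the estimates that follow are in terms
  of \<open>A\<close>.\<close>

locale fourier_mode = relaxation_kernel mu lam kap Lam
  for mu :: "'x measure" and lam kap Lam +
  fixes c :: "'x \<Rightarrow> real" and f :: "'x \<Rightarrow> real \<Rightarrow> complex" and F :: "real \<Rightarrow> complex"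
    and Cb T M A :: real
  assumes c_meas [measurable]: "c \<in> borel_measurable mu"
    and c_le: "x \<in> space mu \<Longrightarrow> \<bar>c x\<bar> \<le> Cb"
    and c_odd: "(\<integral>x. (lam x)\<^sup>2 * c x / ((lam x)\<^sup>2 + (c x)\<^sup>2) \<partial>mu) = 0"
    and T_nonneg: "0 \<le> T"
    and f_meas: "t \<in> {0..T} \<Longrightarrow> (\<lambda>x. f x t) \<in> borel_measurable mu"
    and f_bdd: "x \<in> space mu \<Longrightarrow> t \<in> {0..T} \<Longrightarrow> norm (f x t) \<le> M"
    and f_init: "x \<in> space mu \<Longrightarrow> norm (f x 0) \<le> A"
    and F_eq: "t \<in> {0..T} \<Longrightarrow> F t = of_real kap * (\<integral>x. of_real (lam x) * f x t \<partial>mu)"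
    and f_der: "x \<in> space mu \<Longrightarrow> t \<in> {0..T} \<Longrightarrow>
      (f x has_vector_derivative
        (- (of_real (lam x) + \<i> * of_real (c x)) * f x t + of_real (lam x) * F t)) (at t within {0..T})"
begin

lemma F_bound:
  assumes "t \<in> {0..T}" "\<And>x. x \<in> space mu \<Longrightarrow> norm (f x t) \<le> S"
  shows "norm (F t) \<le> S"
  unfolding F_eq[OF assms(1)] by (rule average_bound[OF f_meas[OF assms(1)] assms(2)])

lemma A_nonneg: "0 \<le> A"
proof -
  have "space mu \<noteq> {}" using mass by (metis measure_empty zero_neq_numeral)
  then show ?thesis using f_init by (metis all_not_in_conv norm_ge_zero order_trans)
qed

text \<open>Each mode is a mixture of its initial value and of \<open>F\<close>, and
  \<open>F\<close>, being an average, inherits every bound of \<open>f\<close>. On a finite horizon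
  the weight of \<open>F\<close> is at most \<open>q < 1\<close>, so any bound contracts to
  \<open>A\<close>, which is independent of \<open>T\<close>.\<close>

lemma sup_bound:
  assumes "x \<in> space mu" "t \<in> {0..T}" shows "norm (f x t) \<le> A"
proof -
  define q where "q = 1 - exp (- Lam * T)"
  have "norm (f (fst (x, t)) (snd (x, t))) \<le> A"
  proof (rule contraction_bound[where Q = "space mu \<times> {0..T}" and q = q and M = M
        and Z = "\<lambda>p. norm (f (fst p) (snd p))"])
    show "0 \<le> q" "q < 1" using Lam_nonneg T_nonneg by (auto simp: q_def)
    fix S p assume S: "A \<le> S" "\<And>p. p \<in> space mu \<times> {0..T} \<Longrightarrow> norm (f (fst p) (snd p)) \<le> S"
      and p: "p \<in> space mu \<times> {0..T}"
    define x t where "x = fst p" and "t = snd p"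
    have x: "x \<in> space mu" and t: "t \<in> {0..T}" using p by (auto simp: x_def t_def)
    have "norm (f x t) \<le> A * exp (- lam x * t) + (1 - exp (- lam x * t)) * S"
    proof (rule damped_ode_bound[where W = F and b = "c x"])
      show "norm (F s) \<le> S" if "s \<in> {0..t}" for s
        by (rule F_bound) (use that t S(2) in force)+
      show "(f x has_vector_derivative - (of_real (lam x) + \<i> * of_real (c x)) * f x s + of_real (lam x) * F s)
          (at s within {0..t})" if "s \<in> {0..t}" for s
        by (rule has_vector_derivative_within_subset[OF f_der]) (use that x t in auto)
    qed (use x t lam_nonneg f_init in auto)
    also have "\<dots> = A + (1 - exp (- lam x * t)) * (S - A)" by (simp add: algebra_simps)
    also have "\<dots> \<le> A + q * (S - A)"
    proof -
      have "lam x * t \<le> Lam * T" using lam_le[OF x] lam_nonneg[OF x] t by (intro mult_mono) auto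
      then show ?thesis using S(1) by (intro add_left_mono mult_right_mono) (auto simp: q_def)
    qed
    finally show "norm (f (fst p) (snd p)) \<le> A + q * (S - A)" by (simp add: x_def t_def)
  qed (use assms f_bdd in auto)
  then show ?thesis by simp
qed

lemma F_le: "t \<in> {0..T} \<Longrightarrow> norm (F t) \<le> A"
  by (rule F_bound) (auto intro: sup_bound)

lemma f_integrable: "t \<in> {0..T} \<Longrightarrow> integrable mu (\<lambda>x. f x t)"
  by (rule bounded_integrable[where B = A]) (auto intro: f_meas sup_bound)

definition rhs :: "'x \<Rightarrow> real \<Rightarrow> complex" where
  "rhs x t = - (of_real (lam x) + \<i> * of_real (c x)) * f x t + of_real (lam x) * F t"

lemma rhs_meas: "t \<in> {0..T} \<Longrightarrow> (\<lambda>x. rhs x t) \<in> borel_measurable mu"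
  unfolding rhs_def using f_meas by measurable

lemma rhs_le:
  assumes "x \<in> space mu" "t \<in> {0..T}" shows "norm (rhs x t) \<le> (2 * Lam + Cb) * A"
proof -
  have "norm (rhs x t) \<le> norm (of_real (lam x) + \<i> * of_real (c x)) * norm (f x t) + lam x * norm (F t)"
    unfolding rhs_def using lam_nonneg[OF assms(1)]
    by (metis (no_types, lifting) abs_of_nonneg norm_minus_cancel norm_mult norm_of_real norm_triangle_ineq mult_minus_left)
  also have "\<dots> \<le> (Lam + Cb) * A + Lam * A"
  proof (intro add_mono mult_mono)
    show "norm (complex_of_real (lam x) + \<i> * of_real (c x)) \<le> Lam + Cb"
      using norm_triangle_ineq[of "complex_of_real (lam x)" "\<i> * of_real (c x)"]
        lam_le[OF assms(1)] lam_nonneg[OF assms(1)] c_le[OF assms(1)] by (simp add: norm_mult)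
    show "0 \<le> Lam + Cb" using Lam_nonneg c_le[OF assms(1)] by linarith
  qed (use assms sup_bound F_le lam_le lam_nonneg Lam_nonneg in auto)
  finally show ?thesis by (simp add: algebra_simps)
qed

lemma f_rhs: "x \<in> space mu \<Longrightarrow> t \<in> {0..T} \<Longrightarrow> (f x has_vector_derivative rhs x t) (at t within {0..T})"
  unfolding rhs_def by (rule f_der)

section \<open>Energy, dissipation and the spread around the average\<close>

definition energy :: "real \<Rightarrow> real" where "energy t = (\<integral>x. (norm (f x t))\<^sup>2 \<partial>mu)"
definition total :: "real \<Rightarrow> complex" where "total t = (\<integral>x. f x t \<partial>mu)"
definition dissipation :: "real \<Rightarrow> real" where
  "dissipation t = (\<integral>x. lam x * (norm (f x t - F t))\<^sup>2 \<partial>mu)"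

lemma norm2_diff: "(norm (z - w))\<^sup>2 = (norm z)\<^sup>2 - 2 * (z \<bullet> w) + (norm w)\<^sup>2" for z w :: complex
  by (simp add: power2_norm_eq_inner inner_diff_left inner_diff_right inner_commute)

lemma square_integrable: "t \<in> {0..T} \<Longrightarrow> integrable mu (\<lambda>x. (norm (f x t))\<^sup>2)"
  by (rule bounded_integrable[where B = "A\<^sup>2"]) (use f_meas sup_bound in \<open>auto intro: power_mono\<close>)

lemma lam_f_integrable: "t \<in> {0..T} \<Longrightarrow> integrable mu (\<lambda>x. of_real (lam x) * f x t)"
  by (rule bounded_integrable[where B = "Lam * A"])
    (use f_meas sup_bound lam_nonneg lam_le Lam_nonneg in \<open>auto simp: norm_mult intro!: mult_mono borel_measurable_times\<close>)

lemma lam_square_integrable: "t \<in> {0..T} \<Longrightarrow> integrable mu (\<lambda>x. lam x * (norm (f x t))\<^sup>2)"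
  by (rule bounded_integrable[where B = "Lam * A\<^sup>2"])
    (use f_meas sup_bound lam_nonneg lam_le Lam_nonneg in
      \<open>auto simp: norm_mult intro!: mult_mono borel_measurable_times power_mono\<close>)

lemma lam_inner_integral:
  assumes t: "t \<in> {0..T}"
  shows "integrable mu (\<lambda>x. lam x * (f x t \<bullet> F t))"
    "(\<integral>x. lam x * (f x t \<bullet> F t) \<partial>mu) = (norm (F t))\<^sup>2 / kap"
proof -
  have eq: "lam x * (f x t \<bullet> F t) = (of_real (lam x) * f x t) \<bullet> F t" for x
    by (simp flip: scaleR_conv_of_real)
  show "integrable mu (\<lambda>x. lam x * (f x t \<bullet> F t))"
    unfolding eq using lam_f_integrable[OF t] by simp
  have "(\<integral>x. lam x * (f x t \<bullet> F t) \<partial>mu) = (\<integral>x. of_real (lam x) * f x t \<partial>mu) \<bullet> F t"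
    unfolding eq using lam_f_integrable[OF t] by simp
  also have "(\<integral>x. of_real (lam x) * f x t \<partial>mu) = (1 / kap) *\<^sub>R F t"
    using kap_pos by (simp add: F_eq[OF t] scaleR_conv_of_real)
  finally show "(\<integral>x. lam x * (f x t \<bullet> F t) \<partial>mu) = (norm (F t))\<^sup>2 / kap"
    by (simp add: power2_norm_eq_inner)
qed

text \<open>As \<open>F\<close> is the mean of \<open>f\<close> under the weight
  \<open>kap * lam\<close>, this is the identity between a variance and second moment minus squared
  mean.\<close>

lemma dissipation_eq:
  assumes t: "t \<in> {0..T}"
  shows "dissipation t = (\<integral>x. lam x * (norm (f x t))\<^sup>2 \<partial>mu) - (norm (F t))\<^sup>2 / kap"
proof -
  have "dissipation t = (\<integral>x. (lam x * (norm (f x t))\<^sup>2 - 2 * (lam x * (f x t \<bullet> F t))) + lam x * (norm (F t))\<^sup>2 \<partial>mu)"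
    unfolding dissipation_def norm2_diff by (simp add: algebra_simps)
  also have "\<dots> = ((\<integral>x. lam x * (norm (f x t))\<^sup>2 \<partial>mu) - 2 * ((norm (F t))\<^sup>2 / kap)) + 1 / kap * (norm (F t))\<^sup>2"
    using lam_square_integrable[OF t] lam_inner_integral[OF t] lam_integrable integral_lam
    by simp
  finally show ?thesis by simp
qed

text \<open>Transport multiplies \<open>f\<close> by an imaginary number, hence is orthogonal to
  \<open>f\<close> in the real inner product; only scattering changes the energy.\<close>

lemma energy_der:
  assumes t: "t \<in> {0..T}"
  shows "(energy has_vector_derivative - 2 * dissipation t) (at t within {0..T})"
proof -
  have "((\<lambda>t. \<integral>x. (norm (f x t))\<^sup>2 \<partial>mu) has_vector_derivative
      (\<integral>x. 2 * (f x t \<bullet> rhs x t) \<partial>mu)) (at t within {0..T})"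
  proof (rule has_vector_derivative_integral[where g = "\<lambda>x. 2 * (A * ((2 * Lam + Cb) * A))"])
    show "(\<lambda>x. 2 * (f x t \<bullet> rhs x t)) \<in> borel_measurable mu"
      using f_meas[OF t] rhs_meas[OF t] by measurable
    show "((\<lambda>s. (norm (f x s))\<^sup>2) has_vector_derivative 2 * (f x s \<bullet> rhs x s)) (at s within {0..T})"
      if "x \<in> space mu" "s \<in> {0..T}" for x s
      using bounded_bilinear.has_vector_derivative[OF bounded_bilinear_inner f_rhs[OF that] f_rhs[OF that]]
      by (simp add: power2_norm_eq_inner inner_commute)
    show "norm (2 * (f x s \<bullet> rhs x s)) \<le> 2 * (A * ((2 * Lam + Cb) * A))"
      if "x \<in> space mu" "s \<in> {0..T}" for x s
      using order_trans[OF Cauchy_Schwarz_ineq2 mult_mono[OF sup_bound[OF that] rhs_le[OF that]]] A_nonneg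
      by simp
  qed (use t square_integrable in auto)
  moreover have "(\<integral>x. 2 * (f x t \<bullet> rhs x t) \<partial>mu) = - 2 * dissipation t"
  proof -
    have skew: "(\<i> * (of_real a * z)) \<bullet> z = 0" for a and z :: complex
      by (simp add: inner_complex_def)
    have "f x t \<bullet> rhs x t = lam x * (f x t \<bullet> F t) - lam x * (norm (f x t))\<^sup>2" for x
    proof -
      have "f x t \<bullet> rhs x t = (lam x *\<^sub>R F t - lam x *\<^sub>R f x t - \<i> * (of_real (c x) * f x t)) \<bullet> f x t"
        unfolding rhs_def inner_commute[of "f x t"] by (simp add: scaleR_conv_of_real algebra_simps)
      then show ?thesis
        by (simp add: inner_diff_left skew power2_norm_eq_inner inner_commute[of "f x t" "F t"])
    qed
    then show ?thesis
      using lam_square_integrable[OF t] lam_inner_integral[OF t] by (simp add: dissipation_eq[OF t])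
  qed
  ultimately show ?thesis by (simp add: energy_def[abs_def])
qed

lemma dissipation_nonneg: "0 \<le> dissipation t"
  unfolding dissipation_def by (rule Bochner_Integration.integral_nonneg) (auto intro!: mult_nonneg_nonneg lam_nonneg)

lemma energy_real_der:
  "t \<in> {0..T} \<Longrightarrow> (energy has_real_derivative - 2 * dissipation t) (at t within {0..T})"
  using energy_der has_real_derivative_iff_has_vector_derivative by blast

lemma energy_antimono:
  assumes "0 \<le> s" "s \<le> t" "t \<le> T" shows "energy t \<le> energy s"
proof (rule DERIV_nonpos_imp_decreasing_open[where f = energy])
  show "\<exists>y. (energy has_real_derivative y) (at x) \<and> y \<le> 0" if "s < x" "x < t" for x
    using energy_real_der[of x] that assms at_within_interior[of x "{0..T}"] dissipation_nonneg[of x]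
    by (intro exI[of _ "- 2 * dissipation x"]) auto
  show "continuous_on {s..t} energy"
    by (rule continuous_on_subset[OF continuous_on_vector_derivative[OF energy_der]])
      (use assms in auto)
qed (use assms in auto)

lemma energy_bounds: assumes "t \<in> {0..T}" shows "0 \<le> energy t" "energy t \<le> 2 * A\<^sup>2"
proof -
  show "0 \<le> energy t" by (simp add: energy_def)
  have "energy t \<le> (\<integral>x. A\<^sup>2 \<partial>mu)" unfolding energy_def
    by (rule integral_mono) (use assms square_integrable sup_bound in \<open>auto intro: power_mono\<close>)
  then show "energy t \<le> 2 * A\<^sup>2" using mass by simp
qed

text \<open>Dissipation hardly sees modes with small \<open>lam\<close>. The weight 1 is split into
  \<open>\<eta> / (lam x + \<eta>)\<close> and \<open>lam x / (lam x + \<eta>)\<close>: the first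
  part is bounded by the maximum principle, the second by the dissipation.\<close>

lemma spread:
  assumes t: "t \<in> {0..T}" and \<eta>: "0 < \<eta>"
  shows "integrable mu (\<lambda>x. (norm (f x t - F t))\<^sup>2)"
    "(\<integral>x. (norm (f x t - F t))\<^sup>2 \<partial>mu) \<le> 4 * A\<^sup>2 * slow \<eta> + dissipation t / \<eta>"
proof -
  have bnd: "(norm (f x t - F t))\<^sup>2 \<le> 4 * A\<^sup>2" if "x \<in> space mu" for x
  proof -
    have "norm (f x t - F t) \<le> 2 * A"
      using norm_triangle_ineq4[of "f x t" "F t"] sup_bound[OF that t] F_le[OF t] by linarith
    from power_mono[OF this, of 2] show ?thesis by simp
  qed
  show int: "integrable mu (\<lambda>x. (norm (f x t - F t))\<^sup>2)"
    by (rule bounded_integrable[where B = "4 * A\<^sup>2"])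
      (use bnd f_meas[OF t] in \<open>auto intro!: borel_measurable_power borel_measurable_norm borel_measurable_diff\<close>)
  have int2: "integrable mu (\<lambda>x. lam x * (norm (f x t - F t))\<^sup>2)"
    by (rule bounded_integrable[where B = "Lam * (4 * A\<^sup>2)"])
      (use bnd f_meas[OF t] lam_nonneg lam_le Lam_nonneg in \<open>auto simp: abs_mult
        intro!: borel_measurable_times borel_measurable_power borel_measurable_norm borel_measurable_diff mult_mono\<close>)
  have "(\<integral>x. (norm (f x t - F t))\<^sup>2 \<partial>mu)
      \<le> (\<integral>x. 4 * A\<^sup>2 * (\<eta> / (lam x + \<eta>)) + lam x * (norm (f x t - F t))\<^sup>2 / \<eta> \<partial>mu)"
  proof (rule integral_mono[OF int])
    fix x assume x: "x \<in> space mu"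
    let ?D = "(norm (f x t - F t))\<^sup>2"
    have p: "0 < lam x + \<eta>" using lam_nonneg[OF x] \<eta> by simp
    have "\<eta> / (lam x + \<eta>) + lam x / (lam x + \<eta>) = 1"
      using p by (simp add: add.commute flip: add_divide_distrib)
    then have "?D = ?D * (\<eta> / (lam x + \<eta>) + lam x / (lam x + \<eta>))" by simp
    also have "\<dots> = ?D * (\<eta> / (lam x + \<eta>)) + lam x * ?D / (lam x + \<eta>)"
      by (simp add: algebra_simps)
    also have "\<dots> \<le> 4 * A\<^sup>2 * (\<eta> / (lam x + \<eta>)) + lam x * ?D / \<eta>"
      using bnd[OF x] p \<eta> lam_nonneg[OF x]
      by (intro add_mono mult_right_mono divide_left_mono) auto
    finally show "?D \<le> 4 * A\<^sup>2 * (\<eta> / (lam x + \<eta>)) + lam x * ?D / \<eta>" .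
  qed (use int2 slow_integrable[OF \<eta>] in \<open>auto simp del: times_divide_eq_right\<close>)
  also have "\<dots> = 4 * A\<^sup>2 * slow \<eta> + dissipation t / \<eta>"
    using int2 slow_integrable[OF \<eta>] by (simp add: slow_def dissipation_def del: times_divide_eq_right)
  finally show "(\<integral>x. (norm (f x t - F t))\<^sup>2 \<partial>mu) \<le> 4 * A\<^sup>2 * slow \<eta> + dissipation t / \<eta>" .
qed

text \<open>
  The corrector is an approximate null vector of the (complex symmetric) generator: it is
  mapped to \<open>- 2 * rate * kap * lam\<close>, which is small in the scaling limit. Where \<open>lam\<close> and
  \<open>c\<close> both vanish it is \<open>0 / 0 = 0\<close>, and \<open>(lam + \<i> c) * corrector = lam\<close> still holds.
\<close>

definition corrector :: "'x \<Rightarrow> complex" where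
  "corrector x = of_real (lam x) / (of_real (lam x) + \<i> * of_real (c x))"

text \<open>The divisor 2 is the total mass: the projection on the corrector has derivative
  \<open>- 2 * rate * F\<close>, while near equilibrium it is close to \<open>2 * F\<close>.\<close>

definition rate :: real where
  "rate = (\<integral>x. lam x * (c x)\<^sup>2 / ((lam x)\<^sup>2 + (c x)\<^sup>2) \<partial>mu) / 2"

definition defect :: real where
  "defect = (\<integral>x. norm (1 - corrector x) \<partial>mu)"

lemma corrector_meas [measurable]: "corrector \<in> borel_measurable mu"
  unfolding corrector_def[abs_def] by measurable

lemma corrector_le: assumes "x \<in> space mu" shows "norm (corrector x) \<le> 1"
proof -
  have "lam x \<le> norm (complex_of_real (lam x) + \<i> * of_real (c x))"
    using complex_Re_le_cmod[of "complex_of_real (lam x) + \<i> * of_real (c x)"] by simp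
  then show ?thesis using lam_nonneg[OF assms]
    by (simp add: corrector_def norm_divide divide_le_eq_1)
qed

lemma corrector_eq: "(of_real (lam x) + \<i> * of_real (c x)) * corrector x = of_real (lam x)"
  by (auto simp: corrector_def complex_eq_iff)

lemma corrector_integrable: "integrable mu corrector"
  by (rule bounded_integrable[where B = 1]) (auto intro: corrector_le)

lemma lam_corrector_integrable: "integrable mu (\<lambda>x. of_real (lam x) * corrector x)"
  by (rule bounded_integrable[where B = "Lam * 1"])
    (use corrector_le lam_nonneg lam_le Lam_nonneg in \<open>auto simp: norm_mult simp del: mult_1_right intro!: mult_mono\<close>)

text \<open>Rationalising \<open>lam - lam * corrector\<close> gives the integrand of
  \<open>rate\<close> as real part and the integrand of \<open>c_odd\<close> as imaginary part, and
  the latter integrates to 0.\<close>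

lemma rate_eq: "(\<integral>x. of_real (lam x) * corrector x \<partial>mu) = of_real (1 / kap - 2 * rate)"
proof -
  have pt: "complex_of_real (lam x) - of_real (lam x) * corrector x =
      of_real (lam x * (c x)\<^sup>2 / ((lam x)\<^sup>2 + (c x)\<^sup>2)) + \<i> * of_real ((lam x)\<^sup>2 * c x / ((lam x)\<^sup>2 + (c x)\<^sup>2))"
    for x
  proof (cases "(lam x)\<^sup>2 + (c x)\<^sup>2 = 0")
    case True
    then show ?thesis by (simp add: corrector_def)
  next
    case False
    have "corrector x = of_real (lam x) * (of_real (lam x) - \<i> * of_real (c x)) / of_real ((lam x)\<^sup>2 + (c x)\<^sup>2)"
    proof -
      have "(of_real (lam x) - \<i> * of_real (c x)) * (of_real (lam x) + \<i> * of_real (c x))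
          = complex_of_real ((lam x)\<^sup>2 + (c x)\<^sup>2)"
        by (simp add: algebra_simps power2_eq_square)
      moreover have "complex_of_real (lam x) + \<i> * of_real (c x) \<noteq> 0"
        using False by (auto simp: complex_eq_iff)
      moreover have "complex_of_real ((lam x)\<^sup>2 + (c x)\<^sup>2) \<noteq> 0"
        using False by (simp only: of_real_eq_0_iff) simp
      ultimately show ?thesis unfolding corrector_def
        by (simp add: frac_eq_eq del: of_real_add)
    qed
    then have "Re (corrector x) = (lam x)\<^sup>2 / ((lam x)\<^sup>2 + (c x)\<^sup>2)"
      "Im (corrector x) = - (lam x * c x) / ((lam x)\<^sup>2 + (c x)\<^sup>2)"
      unfolding Re_divide_of_real Im_divide_of_real by (simp_all add: power2_eq_square)
    then have "Re (complex_of_real (lam x) - of_real (lam x) * corrector x)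
        = lam x * (1 - (lam x)\<^sup>2 / ((lam x)\<^sup>2 + (c x)\<^sup>2))"
      "Im (complex_of_real (lam x) - of_real (lam x) * corrector x)
        = (lam x)\<^sup>2 * c x / ((lam x)\<^sup>2 + (c x)\<^sup>2)"
      by (simp_all add: power2_eq_square algebra_simps)
    moreover have "1 - (lam x)\<^sup>2 / ((lam x)\<^sup>2 + (c x)\<^sup>2) = (c x)\<^sup>2 / ((lam x)\<^sup>2 + (c x)\<^sup>2)"
      using False by (simp add: field_simps)
    ultimately show ?thesis
      by (intro complex_eqI) (simp_all del: of_real_divide of_real_mult)
  qed
  have i1: "integrable mu (\<lambda>x. lam x * (c x)\<^sup>2 / ((lam x)\<^sup>2 + (c x)\<^sup>2))"
    and i2: "integrable mu (\<lambda>x. (lam x)\<^sup>2 * c x / ((lam x)\<^sup>2 + (c x)\<^sup>2))"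
  proof -
    have "integrable mu (\<lambda>x. Re (complex_of_real (lam x) - of_real (lam x) * corrector x))"
      "integrable mu (\<lambda>x. Im (complex_of_real (lam x) - of_real (lam x) * corrector x))"
      using lam_integrable lam_corrector_integrable
      by (intro integrable_Re integrable_Im Bochner_Integration.integrable_diff; simp)+
    then show "integrable mu (\<lambda>x. lam x * (c x)\<^sup>2 / ((lam x)\<^sup>2 + (c x)\<^sup>2))"
      "integrable mu (\<lambda>x. (lam x)\<^sup>2 * c x / ((lam x)\<^sup>2 + (c x)\<^sup>2))"
      unfolding pt by (simp_all del: of_real_divide of_real_mult)
  qed
  have "(\<integral>x. complex_of_real (lam x) - of_real (lam x) * corrector x \<partial>mu) = of_real (2 * rate)"
    unfolding pt using i1 i2 c_odd by (simp add: rate_def del: of_real_divide of_real_mult)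
  moreover have "(\<integral>x. complex_of_real (lam x) - of_real (lam x) * corrector x \<partial>mu)
      = of_real (1 / kap) - (\<integral>x. of_real (lam x) * corrector x \<partial>mu)"
    using lam_integrable lam_corrector_integrable integral_lam by simp
  ultimately show ?thesis by (simp add: algebra_simps)
qed

lemma rate_nonneg: "0 \<le> rate"
  unfolding rate_def by (intro divide_nonneg_nonneg integral_nonneg_AE) (auto intro!: divide_nonneg_nonneg mult_nonneg_nonneg lam_nonneg)

section \<open>Almost closed equation for the total mass\<close>

definition projection :: "real \<Rightarrow> complex" where
  "projection t = (\<integral>x. corrector x * f x t \<partial>mu)"

lemma corrector_f_integrable: "t \<in> {0..T} \<Longrightarrow> integrable mu (\<lambda>x. corrector x * f x t)"
  by (rule bounded_integrable[where B = "1 * A"])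
    (use sup_bound f_meas in \<open>auto simp only: norm_mult intro!: mult_mono corrector_le borel_measurable_times corrector_meas\<close>, auto)

text \<open>Multiplication by the corrector turns the loss \<open>(lam + \<i> * c) * f\<close> into
  \<open>lam * f\<close>, whose integral is \<open>F / kap\<close>. This cancels the gain term up to
  the small multiple \<open>- 2 * rate\<close> of \<open>F\<close>.\<close>

lemma projection_der:
  assumes t: "t \<in> {0..T}"
  shows "(projection has_vector_derivative of_real (- 2 * rate) * F t) (at t within {0..T})"
proof -
  have "((\<lambda>t. \<integral>x. corrector x * f x t \<partial>mu) has_vector_derivative
      (\<integral>x. corrector x * rhs x t \<partial>mu)) (at t within {0..T})"
  proof (rule has_vector_derivative_integral[where g = "\<lambda>x. 1 * ((2 * Lam + Cb) * A)"])
    show "(\<lambda>x. corrector x * rhs x t) \<in> borel_measurable mu"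
      using rhs_meas[OF t] by measurable
    show "norm (corrector x * rhs x s) \<le> 1 * ((2 * Lam + Cb) * A)"
      if "x \<in> space mu" "s \<in> {0..T}" for x s
      unfolding norm_mult using corrector_le[OF that(1)] rhs_le[OF that] by (intro mult_mono) auto
    show "((\<lambda>s. corrector x * f x s) has_vector_derivative corrector x * rhs x s) (at s within {0..T})"
      if "x \<in> space mu" "s \<in> {0..T}" for x s
      by (rule has_vector_derivative_mult_right[OF f_rhs[OF that]])
  qed (use t corrector_f_integrable in auto)
  moreover have "(\<integral>x. corrector x * rhs x t \<partial>mu) = of_real (- 2 * rate) * F t"
  proof -
    have "corrector x * rhs x t = (of_real (lam x) * corrector x) * F t - of_real (lam x) * f x t" for x
    proof -
      have "corrector x * rhs x t = (of_real (lam x) * corrector x) * F t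
          - ((of_real (lam x) + \<i> * of_real (c x)) * corrector x) * f x t"
        by (simp add: rhs_def algebra_simps)
      then show ?thesis unfolding corrector_eq .
    qed
    then have "(\<integral>x. corrector x * rhs x t \<partial>mu) = of_real (1 / kap - 2 * rate) * F t - (\<integral>x. of_real (lam x) * f x t \<partial>mu)"
      using lam_corrector_integrable lam_f_integrable[OF t] by (simp add: rate_eq del: of_real_diff)
    also have "(\<integral>x. of_real (lam x) * f x t \<partial>mu) = of_real (1 / kap) * F t"
      using kap_pos by (simp add: F_eq[OF t])
    finally show ?thesis by (simp add: algebra_simps)
  qed
  ultimately show ?thesis by (simp add: projection_def[abs_def])
qed

lemma projection_total:
  assumes t: "t \<in> {0..T}" shows "norm (total t - projection t) \<le> A * defect"
proof -
  have "total t - projection t = (\<integral>x. (1 - corrector x) * f x t \<partial>mu)"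
    using f_integrable[OF t] corrector_f_integrable[OF t]
    by (simp add: total_def projection_def algebra_simps)
  also have "norm \<dots> \<le> (\<integral>x. norm (1 - corrector x) * A \<partial>mu)"
  proof (rule norm_integral_le)
    show "integrable mu (\<lambda>x. (1 - corrector x) * f x t)"
      using f_integrable[OF t] corrector_f_integrable[OF t] by (simp add: algebra_simps)
    show "integrable mu (\<lambda>x. norm (1 - corrector x) * A)"
      using corrector_integrable by (auto intro!: integrable_mult_left integrable_norm)
  qed (use sup_bound t in \<open>auto simp: norm_mult intro: mult_left_mono\<close>)
  finally show ?thesis by (simp add: defect_def mult.commute)
qed

lemma defect_nonneg: "0 \<le> defect" by (simp add: defect_def)

text \<open>The spread is quadratic, whereas the distance of \<open>total\<close> from
  \<open>2 * F\<close> is linear. Young's inequality with the free parameter \<theta> mediates; it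
  keeps the dissipation to the first power, which matters because only the time integral of the
  dissipation is controlled.\<close>

lemma projection_F:
  assumes t: "t \<in> {0..T}" and \<eta>: "0 < \<eta>" and \<theta>: "0 < \<theta>"
  shows "norm (projection t - 2 * F t) \<le> A * defect + \<theta> + 2 * A\<^sup>2 * slow \<eta> / \<theta> + dissipation t / (2 * \<eta> * \<theta>)"
proof -
  note sp = spread[OF t \<eta>]
  have "total t - 2 * F t = (\<integral>x. f x t - F t \<partial>mu)"
    using f_integrable[OF t] mass by (simp add: total_def scaleR_conv_of_real)
  also have "norm \<dots> \<le> (\<integral>x. \<theta> / 2 + (norm (f x t - F t))\<^sup>2 / (2 * \<theta>) \<partial>mu)"
  proof (rule norm_integral_le)
    fix x
    have "0 \<le> (\<theta> - norm (f x t - F t))\<^sup>2" by simp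
    then show "norm (f x t - F t) \<le> \<theta> / 2 + (norm (f x t - F t))\<^sup>2 / (2 * \<theta>)"
      using \<theta> by (simp add: field_simps power2_eq_square)
  qed (use f_integrable[OF t] sp in auto)
  also have "\<dots> = \<theta> + (\<integral>x. (norm (f x t - F t))\<^sup>2 \<partial>mu) / (2 * \<theta>)"
    using sp mass by simp
  also have "\<dots> \<le> \<theta> + (4 * A\<^sup>2 * slow \<eta> + dissipation t / \<eta>) / (2 * \<theta>)"
    using sp(2) \<theta> by (intro add_left_mono divide_right_mono) auto
  also have "\<dots> = \<theta> + 2 * A\<^sup>2 * slow \<eta> / \<theta> + dissipation t / (2 * \<eta> * \<theta>)"
    using \<theta> \<eta> by (simp add: field_simps)
  finally show ?thesis
    using projection_total[OF t] norm_triangle_ineq[of "projection t - total t" "total t - 2 * F t"]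
    by (simp add: norm_minus_commute)
qed

text \<open>The bound of \<open>projection_F\<close> integrated over the horizon, with the
  dissipation integrating to at most \<open>A\<^sup>2\<close>, times \<open>rate\<close> and the
  largest value of the integrating factor. The leading term exchanges \<open>total\<close> for
  \<open>projection\<close> at the final and at the initial time.\<close>

definition slaving_error :: "real \<Rightarrow> real \<Rightarrow> real" where
  "slaving_error \<eta> \<theta> = 2 * A * defect +
    rate * exp (rate * T) * ((A * defect + \<theta> + 2 * A\<^sup>2 * slow \<eta> / \<theta>) * T + A\<^sup>2 / (2 * \<eta> * \<theta>))"

lemma total_decay:
  assumes t: "t \<in> {0..T}" and \<eta>: "0 < \<eta>" and \<theta>: "0 < \<theta>"
  shows "norm (total t - of_real (exp (- rate * t)) * total 0) \<le> slaving_error \<eta> \<theta>"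
proof -
  define K where "K = A * defect + \<theta> + 2 * A\<^sup>2 * slow \<eta> / \<theta>"
  have K: "0 \<le> K" using A_nonneg defect_nonneg \<theta> slow_nonneg[OF \<eta>] by (simp add: K_def)
  \<comment> \<open>If \<open>projection\<close> were equal to \<open>2 * F\<close>, it would decay
    exactly like \<open>exp (- rate * s)\<close> and \<open>h\<close> would be constant; its
    derivative measures the deviation.\<close>
  define h where "h = (\<lambda>s. of_real (exp (rate * s)) * projection s)"
  define h' where "h' = (\<lambda>s. of_real (rate * exp (rate * s)) * (projection s - 2 * F s))"
  \<comment> \<open>The energy has derivative \<open>- 2 * dissipation\<close>, so this is an
    explicit primitive of the bound for the derivative of \<open>h\<close>, and the dissipation is
    integrated through the energy.\<close>
  define \<Phi> where "\<Phi> = (\<lambda>s. rate * exp (rate * T) * (K * s - energy s / (4 * \<eta> * \<theta>)))"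
  define \<Phi>' where "\<Phi>' = (\<lambda>s. rate * exp (rate * T) * (K + dissipation s / (2 * \<eta> * \<theta>)))"
  have hder: "(h has_vector_derivative h' s) (at s within {0..T})" if "s \<in> {0..T}" for s
  proof -
    have "((\<lambda>s. exp (of_real s * complex_of_real rate)) has_vector_derivative
        (exp (of_real s * complex_of_real rate) * of_real rate)) (at s within {0..T})"
      by (rule has_vector_derivative_real_field) (auto intro!: derivative_eq_intros)
    from has_vector_derivative_mult[OF this projection_der[OF that]] show ?thesis
      unfolding h_def h'_def by (simp add: algebra_simps flip: exp_of_real)
  qed
  have \<Phi>der: "(\<Phi> has_vector_derivative \<Phi>' s) (at s within {0..T})" if "s \<in> {0..T}" for s
    unfolding \<Phi>_def \<Phi>'_def has_real_derivative_iff_has_vector_derivative[symmetric]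
    using \<eta> \<theta> by (auto intro!: derivative_eq_intros energy_real_der that simp: field_simps)
  have bound: "norm (h t - h 0) \<le> \<Phi> t - \<Phi> 0"
  proof (cases "t = 0")
    case False
    show ?thesis
    proof (rule differentiable_bound_general[where f' = h' and \<phi>' = \<Phi>'])
      show "continuous_on {0..t} h"
        by (rule continuous_on_subset[OF continuous_on_vector_derivative[OF hder]]) (use t in auto)
      show "continuous_on {0..t} \<Phi>"
        by (rule continuous_on_subset[OF continuous_on_vector_derivative[OF \<Phi>der]]) (use t in auto)
      show "(h has_vector_derivative h' s) (at s)" if "0 < s" "s < t" for s
        using hder[of s] that t at_within_interior[of s "{0..T}"] by auto
      show "(\<Phi> has_vector_derivative \<Phi>' s) (at s)" if "0 < s" "s < t" for s
        using \<Phi>der[of s] that t at_within_interior[of s "{0..T}"] by auto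
      show "norm (h' s) \<le> \<Phi>' s" if s: "0 < s" "s < t" for s
      proof -
        have "norm (h' s) = rate * exp (rate * s) * norm (projection s - 2 * F s)"
          using rate_nonneg by (simp add: h'_def norm_mult)
        also have "\<dots> \<le> rate * exp (rate * T) * (K + dissipation s / (2 * \<eta> * \<theta>))"
          using s t rate_nonneg projection_F[OF _ \<eta> \<theta>, of s] unfolding K_def
          by (intro mult_mono) (auto intro!: mult_left_mono)
        finally show ?thesis by (simp add: \<Phi>'_def)
      qed
    qed (use t False in auto)
  qed simp
  have "\<Phi> t - \<Phi> 0 = rate * exp (rate * T) * (K * t + (energy 0 - energy t) / (4 * \<eta> * \<theta>))"
    using \<eta> \<theta> by (simp add: \<Phi>_def field_simps)
  also have "\<dots> \<le> rate * exp (rate * T) * (K * T + (2 * A\<^sup>2) / (4 * \<eta> * \<theta>))"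
    using energy_bounds[OF t] energy_bounds[of 0] T_nonneg t rate_nonneg K \<eta> \<theta>
    by (intro mult_left_mono add_mono divide_right_mono) auto
  also have "(2 * A\<^sup>2) / (4 * \<eta> * \<theta>) = A\<^sup>2 / (2 * \<eta> * \<theta>)" by simp
  finally have "norm (h t - h 0) \<le> rate * exp (rate * T) * (K * T + A\<^sup>2 / (2 * \<eta> * \<theta>))"
    using bound by linarith
  moreover have "norm (projection t - of_real (exp (- rate * t)) * projection 0) \<le> norm (h t - h 0)"
  proof -
    have "projection t - of_real (exp (- rate * t)) * projection 0 = of_real (exp (- rate * t)) * (h t - h 0)"
      by (simp add: h_def algebra_simps flip: of_real_mult exp_add mult.assoc)
    then have "norm (projection t - of_real (exp (- rate * t)) * projection 0) = exp (- rate * t) * norm (h t - h 0)"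
      by (simp add: norm_mult)
    also have "\<dots> \<le> 1 * norm (h t - h 0)"
      using rate_nonneg t by (intro mult_right_mono) auto
    finally show ?thesis by simp
  qed
  moreover have "norm (of_real (exp (- rate * t)) * (total 0 - projection 0)) \<le> 1 * (A * defect)"
    unfolding norm_mult using rate_nonneg t T_nonneg by (intro mult_mono projection_total) auto
  moreover have eq: "total t - of_real (exp (- rate * t)) * total 0 = (total t - projection t)
      + (projection t - of_real (exp (- rate * t)) * projection 0)
      - of_real (exp (- rate * t)) * (total 0 - projection 0)"
    by (simp add: algebra_simps)
  ultimately show ?thesis
    using projection_total[OF t] norm_triangle_ineq4[of "(total t - projection t)
        + (projection t - of_real (exp (- rate * t)) * projection 0)"
        "of_real (exp (- rate * t)) * (total 0 - projection 0)"]
      norm_triangle_ineq[of "total t - projection t" "projection t - of_real (exp (- rate * t)) * projection 0"]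
    by (subst eq) (unfold slaving_error_def K_def, linarith)
qed

lemma total_le: assumes t: "t \<in> {0..T}" shows "norm (total t) \<le> 2 * A"
proof -
  have "norm (total t) \<le> (\<integral>x. A \<partial>mu)" unfolding total_def
    by (rule norm_integral_le) (use t f_integrable sup_bound in auto)
  then show ?thesis using mass by simp
qed

lemma variance_eq:
  assumes t: "t \<in> {0..T}"
  shows "(\<integral>x. (norm (f x t - z))\<^sup>2 \<partial>mu) = energy t - 2 * (total t \<bullet> z) + 2 * (norm z)\<^sup>2"
  unfolding norm2_diff energy_def total_def using square_integrable[OF t] f_integrable[OF t] mass by simp

text \<open>The left side is the variance: on a space of mass 2 the mean is
  \<open>total t / 2\<close>, and the mean minimises the quadratic deviation.\<close>

lemma variance_min:
  assumes t: "t \<in> {0..T}"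
  shows "energy t - (norm (total t))\<^sup>2 / 2 \<le> (\<integral>x. (norm (f x t - z))\<^sup>2 \<partial>mu)"
proof -
  have "0 \<le> (norm (total t - 2 * z))\<^sup>2" by simp
  then have "0 \<le> (norm (total t))\<^sup>2 - 4 * (total t \<bullet> z) + 4 * (norm z)\<^sup>2"
    using inner_scaleR_right[of "total t" 2 z]
    unfolding norm2_diff by (simp add: norm_mult power_mult_distrib scaleR_conv_of_real)
  then show ?thesis unfolding variance_eq[OF t] by simp
qed

text \<open>
  Energy dissipation only controls time averages of the variance; monotonicity of the energy
  upgrades this to every positive time.
\<close>

lemma variance_bound:
  assumes t: "t \<in> {0..T}" and h: "0 < h" "h \<le> t" and \<eta>: "0 < \<eta>" and \<theta>: "0 < \<theta>"
  shows "energy t - (norm (total t))\<^sup>2 / 2 \<le>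
    4 * A\<^sup>2 * rate * h + 4 * A * slaving_error \<eta> \<theta> + 4 * A\<^sup>2 * slow \<eta> + A\<^sup>2 / (\<eta> * h)"
proof -
  define \<delta> where "\<delta> = slaving_error \<eta> \<theta>"
  define R where "R = 4 * A\<^sup>2 * rate * h + 4 * A * \<delta>"
  define V where "V = energy t - (norm (total t))\<^sup>2 / 2"
  have \<delta>: "0 \<le> \<delta>" using total_decay[OF t \<eta> \<theta>] unfolding \<delta>_def by (meson norm_ge_zero order_trans)
  \<comment> \<open>The energy decreases, but the variance also contains the squared total mass with
    a minus sign. Nearly exponential decay shows that this term drops by little within the window of
    length \<open>h\<close>.\<close>
  have R: "((norm (total s))\<^sup>2 - (norm (total t))\<^sup>2) / 2 \<le> R" if s: "t - h \<le> s" "s \<le> t" for s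
  proof -
    have sT: "s \<in> {0..T}" using s t h by auto
    have "norm (total s) \<le> exp (- rate * s) * norm (total 0) + \<delta>"
      using total_decay[OF sT \<eta> \<theta>] norm_triangle_ineq2[of "total s" "of_real (exp (- rate * s)) * total 0"]
      unfolding \<delta>_def by (simp add: norm_mult)
    moreover have "exp (- rate * t) * norm (total 0) - \<delta> \<le> norm (total t)"
      using total_decay[OF t \<eta> \<theta>] norm_triangle_ineq3[of "total t" "of_real (exp (- rate * t)) * total 0"]
      unfolding \<delta>_def by (simp add: norm_mult)
    moreover have "(exp (- rate * s) - exp (- rate * t)) * norm (total 0) \<le> (rate * h) * (2 * A)"
    proof (intro mult_mono total_le)
      have "exp (- rate * s) - exp (- rate * t) = exp (- rate * s) * (1 - exp (- rate * (t - s)))"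
        by (simp add: algebra_simps flip: exp_add)
      also have "\<dots> \<le> 1 * (rate * (t - s))"
        using s sT rate_nonneg exp_ge_add_one_self[of "- rate * (t - s)"]
        by (intro mult_mono) auto
      also have "\<dots> \<le> rate * h" using s rate_nonneg by (auto intro: mult_left_mono)
      finally show "exp (- rate * s) - exp (- rate * t) \<le> rate * h" .
    qed (use T_nonneg rate_nonneg h in auto)
    ultimately have d: "norm (total s) - norm (total t) \<le> 2 * A * rate * h + 2 * \<delta>"
      by (simp add: algebra_simps)
    have "(norm (total s))\<^sup>2 - (norm (total t))\<^sup>2 = (norm (total s) - norm (total t)) * (norm (total s) + norm (total t))"
      by (simp add: algebra_simps power2_eq_square)
    also have "\<dots> \<le> (2 * A * rate * h + 2 * \<delta>) * (norm (total s) + norm (total t))"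
      using d by (rule mult_right_mono) simp
    also have "\<dots> \<le> (2 * A * rate * h + 2 * \<delta>) * (4 * A)"
      using total_le[OF sT] total_le[OF t] A_nonneg rate_nonneg h \<delta> by (intro mult_left_mono) auto
    finally show ?thesis by (simp add: R_def algebra_simps power2_eq_square)
  qed
  have Vs: "V \<le> R + 4 * A\<^sup>2 * slow \<eta> + dissipation s / \<eta>" if s: "t - h \<le> s" "s \<le> t" for s
  proof -
    have sT: "s \<in> {0..T}" using s t h by auto
    have "V \<le> (energy s - (norm (total s))\<^sup>2 / 2) + R"
      using R[OF s] energy_antimono[of s t] s sT t by (simp add: V_def field_simps)
    also have "energy s - (norm (total s))\<^sup>2 / 2 \<le> 4 * A\<^sup>2 * slow \<eta> + dissipation s / \<eta>"
      using variance_min[OF sT, of "F s"] spread[OF sT \<eta>] by linarith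
    finally show ?thesis by simp
  qed
  define P where "P = V - R - 4 * A\<^sup>2 * slow \<eta>"
  \<comment> \<open>The energy loses at most \<open>2 * A\<^sup>2\<close> in the window, so at some
    intermediate time \<open>z\<close> the dissipation is at most \<open>A\<^sup>2 / h\<close>; the
    variance at \<open>t\<close> is then compared with the one at \<open>z\<close>.\<close>
  have "\<exists>z\<in>{t - h<..<t}. energy t - energy (t - h) = (- 2 * dissipation z) * (t - (t - h))"
  proof (rule mvt_simple)
    show "t - h < t" using h by simp
    fix x assume x: "t - h \<le> x" "x \<le> t"
    have "(energy has_real_derivative - 2 * dissipation x) (at x within {t - h..t})"
      by (rule DERIV_subset[OF energy_real_der]) (use x t h in auto)
    then show "(energy has_derivative (*) (- 2 * dissipation x)) (at x within {t - h..t})"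
      by (simp add: has_field_derivative_def)
  qed
  then obtain z where z: "t - h < z" "z < t" "energy t - energy (t - h) = h * (- 2 * dissipation z)"
    by (auto simp: mult.commute)
  have "2 * h * dissipation z \<le> 2 * A\<^sup>2"
    using z(3) energy_bounds[OF t] energy_bounds[of "t - h"] t h by auto
  then have "dissipation z \<le> A\<^sup>2 / h" using h by (simp add: field_simps)
  then have "dissipation z / \<eta> \<le> A\<^sup>2 / h / \<eta>" using \<eta> by (intro divide_right_mono) auto
  then show ?thesis
    using Vs[of z] z h \<eta> unfolding V_def R_def \<delta>_def by (simp add: mult.commute)
qed

end

section \<open>The scaling limit at a fixed frequency\<close>

context relaxation_kernel
begin

lemma integral_square_le:
  fixes g :: "'x \<Rightarrow> real"
  assumes "integrable mu g" "integrable mu (\<lambda>x. (g x)\<^sup>2)"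
  shows "(\<integral>x. g x \<partial>mu)\<^sup>2 \<le> 2 * (\<integral>x. (g x)\<^sup>2 \<partial>mu)"
proof -
  define a where "a = (\<integral>x. g x \<partial>mu) / 2"
  have "0 \<le> (\<integral>x. (g x - a)\<^sup>2 \<partial>mu)" by simp
  also have "\<dots> = (\<integral>x. (g x)\<^sup>2 - 2 * a * g x + a\<^sup>2 \<partial>mu)"
    by (simp add: power2_diff algebra_simps)
  also have "\<dots> = (\<integral>x. (g x)\<^sup>2 \<partial>mu) - 2 * a * (2 * a) + a\<^sup>2 * 2"
    using assms mass by (simp add: a_def)
  finally show ?thesis by (simp add: a_def power2_eq_square)
qed

lemma slow_tendsto_0:
  assumes "AE x in mu. 0 < lam x" "\<And>n. 0 < \<eta> n" "\<eta> \<longlonglongrightarrow> 0"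
  shows "(\<lambda>n. slow (\<eta> n)) \<longlonglongrightarrow> 0"
proof -
  have "(\<lambda>n. \<integral>x. \<eta> n / (lam x + \<eta> n) \<partial>mu) \<longlonglongrightarrow> (\<integral>x. 0 \<partial>mu)"
  proof (rule integral_dominated_convergence[where w = "\<lambda>x. 1"])
    show "AE x in mu. (\<lambda>n. \<eta> n / (lam x + \<eta> n)) \<longlonglongrightarrow> 0"
      using assms(1)
    proof eventually_elim
      case (elim x)
      have "(\<lambda>n. \<eta> n / (lam x + \<eta> n)) \<longlonglongrightarrow> 0 / (lam x + 0)"
        using elim by (intro tendsto_intros assms(3)) auto
      then show ?case by simp
    qed
    show "AE x in mu. norm (\<eta> n / (lam x + \<eta> n)) \<le> 1" for n
      using slow_bounds assms(2) by (intro AE_I2) (simp del: abs_divide)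
  qed auto
  then show ?thesis by (simp add: slow_def)
qed

lemma defect_tendsto_0:
  fixes c :: "nat \<Rightarrow> 'x \<Rightarrow> real"
  assumes pos: "AE x in mu. 0 < lam x" and meas: "\<And>n. c n \<in> borel_measurable mu"
    and c: "\<And>x. x \<in> space mu \<Longrightarrow> (\<lambda>n. c n x) \<longlonglongrightarrow> 0"
  shows "(\<lambda>n. \<integral>x. norm (1 - of_real (lam x) / (of_real (lam x) + \<i> * of_real (c n x))) \<partial>mu) \<longlonglongrightarrow> 0"
proof -
  have "(\<lambda>n. \<integral>x. norm (1 - of_real (lam x) / (of_real (lam x) + \<i> * of_real (c n x))) \<partial>mu)
      \<longlonglongrightarrow> (\<integral>x. 0 \<partial>mu)"
  proof (rule integral_dominated_convergence[where w = "\<lambda>x. 2"])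
    show "AE x in mu. (\<lambda>n. norm (1 - of_real (lam x) / (of_real (lam x) + \<i> * of_real (c n x)))) \<longlonglongrightarrow> 0"
      using pos AE_space
    proof eventually_elim
      case (elim x)
      have "(\<lambda>n. norm (1 - of_real (lam x) / (of_real (lam x) + \<i> * of_real (c n x))))
          \<longlonglongrightarrow> norm (1 - complex_of_real (lam x) / (of_real (lam x) + \<i> * of_real 0))"
        using elim by (intro tendsto_intros c) auto
      then show ?case using elim by simp
    qed
    show "AE x in mu. norm (norm (1 - of_real (lam x) / (of_real (lam x) + \<i> * of_real (c n x)))) \<le> 2" for n
    proof (rule AE_I2)
      fix x assume x: "x \<in> space mu"
      have "lam x \<le> norm (complex_of_real (lam x) + \<i> * of_real (c n x))"
        using complex_Re_le_cmod[of "complex_of_real (lam x) + \<i> * of_real (c n x)"] by simp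
      then have "norm (of_real (lam x) / (complex_of_real (lam x) + \<i> * of_real (c n x))) \<le> 1"
        using lam_nonneg[OF x] by (simp add: norm_divide divide_le_eq_1)
      then show "norm (norm (1 - of_real (lam x) / (complex_of_real (lam x) + \<i> * of_real (c n x)))) \<le> 2"
        using norm_triangle_ineq4[of 1 "of_real (lam x) / (complex_of_real (lam x) + \<i> * of_real (c n x))"]
        by simp
    qed
    show "(\<lambda>x. norm (1 - of_real (lam x) / (complex_of_real (lam x) + \<i> * of_real (c n x)))) \<in> borel_measurable mu" for n
      using meas[of n] by measurable
  qed auto
  then show ?thesis by simp
qed

text \<open>Both conclusions come from the error bounds above with parameters that vary with
  \<open>n\<close>. The second one needs a positive time: the initial modes may differ arbitrarily
  from their average, and a window for the energy argument must fit before
  \<open>n * \<tau>\<close>.\<close>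

lemma fourier_mode_limit:
  fixes c :: "nat \<Rightarrow> 'x \<Rightarrow> real" and f :: "nat \<Rightarrow> 'x \<Rightarrow> real \<Rightarrow> complex"
  assumes pos: "AE x in mu. 0 < lam x" and \<tau>: "0 \<le> \<tau>"
    and c: "\<And>x. x \<in> space mu \<Longrightarrow> (\<lambda>n. c n x) \<longlonglongrightarrow> 0"
    and mode: "\<And>n. 1 \<le> n \<Longrightarrow> fourier_mode mu lam kap Lam (c n) (f n) (F n) (Cb n) (real n * \<tau>) (M n) A"
    and c_meas: "\<And>n. c n \<in> borel_measurable mu"
    and rate: "(\<lambda>n. real n * ((\<integral>x. lam x * (c n x)\<^sup>2 / ((lam x)\<^sup>2 + (c n x)\<^sup>2) \<partial>mu) / 2)) \<longlonglongrightarrow> a"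
    and init: "\<And>n. 1 \<le> n \<Longrightarrow> (\<integral>x. f n x 0 \<partial>mu) = m0"
  shows "(\<lambda>n. \<integral>x. f n x (real n * \<tau>) \<partial>mu) \<longlonglongrightarrow> of_real (exp (- a * \<tau>)) * m0" (is ?total)
    and "0 < \<tau> \<Longrightarrow> (\<lambda>n. \<integral>x. (norm (f n x (real n * \<tau>) - of_real (exp (- a * \<tau>)) * m0 / 2))\<^sup>2 \<partial>mu) \<longlonglongrightarrow> 0"
      (is "_ \<Longrightarrow> ?var")
proof -
  define r where "r n = real n * ((\<integral>x. lam x * (c n x)\<^sup>2 / ((lam x)\<^sup>2 + (c n x)\<^sup>2) \<partial>mu) / 2)" for n
  define d where "d n = (\<integral>x. norm (1 - of_real (lam x) / (of_real (lam x) + \<i> * of_real (c n x))) \<partial>mu)" for n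
  \<comment> \<open>The cut-off must vanish, yet \<open>n * \<eta> n * \<theta>\<close> must diverge
    to beat the dissipation term. With \<open>p n\<close> as a lower bound of \<theta>, the
    exponents give \<open>n * \<eta> n * p n = 1 / p n\<close>. Since \<open>0 powr a = 0\<close>,
    \<open>max n 1\<close> secures positivity at \<open>n = 0\<close>.\<close>
  define \<eta> where "\<eta> n = real (max n 1) powr (-1/2)" for n
  define p where "p n = real (max n 1) powr (-1/4)" for n
  \<comment> \<open>The Young parameter will be \<open>\<sigma> n + p n\<close>. The square root
    makes \<open>slow (\<eta> n) / \<theta>\<close> at most \<open>\<sigma> n\<close>, whatever the
    speed at which \<open>slow\<close> tends to 0.\<close>
  define \<sigma> where "\<sigma> n = sqrt (slow (\<eta> n))" for n
  define U where "U n = 2 * A * d n + r n * exp (r n * \<tau>) *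
    ((A * d n + (\<sigma> n + p n) + 2 * A\<^sup>2 * \<sigma> n) * \<tau> + A\<^sup>2 * p n / 2)" for n
  have \<eta>_pos: "0 < \<eta> n" and p_pos: "0 < p n" for n by (auto simp: \<eta>_def p_def)
  have \<eta>_p: "real n * \<eta> n * p n = 1 / p n" "real n * p n * \<eta> n = 1 / p n" if "1 \<le> n" for n
  proof -
    have "real n * \<eta> n * p n = real n powr 1 * real n powr (-1/2) * real n powr (-1/4)"
      using that by (simp add: \<eta>_def p_def max_def)
    also have "\<dots> = real n powr (1 / 4)" unfolding powr_add[symmetric] by simp
    also have "\<dots> = 1 / p n" using that by (simp add: p_def max_def powr_minus field_simps)
    finally show "real n * \<eta> n * p n = 1 / p n" .
    then show "real n * p n * \<eta> n = 1 / p n" by (simp add: mult_ac)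
  qed
  have p_lim: "p \<longlonglongrightarrow> 0"
  proof -
    have "(\<lambda>n. real n powr (-1/4)) \<longlonglongrightarrow> 0"
      by (rule tendsto_neg_powr) (auto simp: filterlim_real_sequentially)
    then show ?thesis
      by (rule Lim_transform_eventually) (auto simp: p_def eventually_sequentially max_def intro!: exI[of _ 1])
  qed
  have \<eta>_lim: "\<eta> \<longlonglongrightarrow> 0"
  proof -
    have "(\<lambda>n. real n powr (-1/2)) \<longlonglongrightarrow> 0"
      by (rule tendsto_neg_powr) (auto simp: filterlim_real_sequentially)
    then show ?thesis
      by (rule Lim_transform_eventually) (auto simp: \<eta>_def eventually_sequentially max_def intro!: exI[of _ 1])
  qed
  have slow_lim: "(\<lambda>n. slow (\<eta> n)) \<longlonglongrightarrow> 0"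
    by (rule slow_tendsto_0[OF pos \<eta>_pos \<eta>_lim])
  have \<sigma>_lim: "\<sigma> \<longlonglongrightarrow> 0"
    using tendsto_real_sqrt[OF slow_lim] by (simp add: \<sigma>_def[abs_def])
  have d_lim: "d \<longlonglongrightarrow> 0"
    unfolding d_def[abs_def] by (rule defect_tendsto_0[OF pos c_meas c])
  have r_lim: "r \<longlonglongrightarrow> a" using rate by (simp add: r_def[abs_def])
  have U_lim: "U \<longlonglongrightarrow> 0"
  proof -
    have "U \<longlonglongrightarrow> 2 * A * 0 + a * exp (a * \<tau>) * ((A * 0 + (0 + 0) + 2 * A\<^sup>2 * 0) * \<tau> + A\<^sup>2 * 0 / 2)"
      unfolding U_def[abs_def] by (intro tendsto_intros d_lim r_lim \<sigma>_lim p_lim) auto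
    then show ?thesis by simp
  qed
  \<comment> \<open>Every \<open>n\<close> needs its own interpretation of the locale, so the
    estimates are exported in terms of integrals, where limits in \<open>n\<close> can be
    taken.\<close>
  have main: "norm ((\<integral>x. f n x (real n * \<tau>) \<partial>mu) - of_real (exp (- r n * \<tau>)) * m0) \<le> U n
      \<and> (p n \<le> \<tau> \<longrightarrow> (\<integral>x. (norm (f n x (real n * \<tau>)))\<^sup>2 \<partial>mu) - (norm (\<integral>x. f n x (real n * \<tau>) \<partial>mu))\<^sup>2 / 2
        \<le> 4 * A\<^sup>2 * r n * p n + 4 * A * U n + 4 * A\<^sup>2 * slow (\<eta> n) + A\<^sup>2 * p n)
      \<and> (\<forall>z. (\<integral>x. (norm (f n x (real n * \<tau>) - z / 2))\<^sup>2 \<partial>mu) =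
        (\<integral>x. (norm (f n x (real n * \<tau>)))\<^sup>2 \<partial>mu) - (norm (\<integral>x. f n x (real n * \<tau>) \<partial>mu))\<^sup>2 / 2
        + (norm ((\<integral>x. f n x (real n * \<tau>) \<partial>mu) - z))\<^sup>2 / 2)
      \<and> 0 \<le> (\<integral>x. (norm (f n x (real n * \<tau>)))\<^sup>2 \<partial>mu) - (norm (\<integral>x. f n x (real n * \<tau>) \<partial>mu))\<^sup>2 / 2"
    if n: "1 \<le> n" for n
  proof -
    interpret fm: fourier_mode mu lam kap Lam "c n" "f n" "F n" "Cb n" "real n * \<tau>" "M n" A
      by (rule mode[OF n])
    have rn: "r n = real n * fm.rate" by (simp add: r_def fm.rate_def)
    have dn: "d n = fm.defect" by (simp add: d_def fm.defect_def fm.corrector_def)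
    have t: "real n * \<tau> \<in> {0..real n * \<tau>}" using \<tau> by auto
    define \<theta> where "\<theta> = \<sigma> n + p n"
    have \<sigma>n: "0 \<le> \<sigma> n" using slow_nonneg[OF \<eta>_pos] by (simp add: \<sigma>_def)
    have \<theta>: "0 < \<theta>" using \<sigma>n p_pos[of n] by (simp add: \<theta>_def)
    have slow_sq: "slow (\<eta> n) = \<sigma> n * \<sigma> n" using slow_nonneg[OF \<eta>_pos] by (simp add: \<sigma>_def)
    have err: "fm.slaving_error (\<eta> n) \<theta> \<le> U n"
    proof -
      have s1: "2 * A\<^sup>2 * slow (\<eta> n) / \<theta> \<le> 2 * A\<^sup>2 * \<sigma> n"
      proof -
        have "\<sigma> n * \<sigma> n / \<theta> \<le> \<sigma> n * \<theta> / \<theta>"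
          using \<sigma>n p_pos[of n] \<theta> by (intro divide_right_mono mult_left_mono) (auto simp: \<theta>_def)
        also have "\<dots> = \<sigma> n" using \<theta> by simp
        finally have "2 * A\<^sup>2 * (\<sigma> n * \<sigma> n / \<theta>) \<le> 2 * A\<^sup>2 * \<sigma> n" by (rule mult_left_mono) simp
        then show ?thesis by (simp add: slow_sq)
      qed
      have s2: "A\<^sup>2 / (2 * \<eta> n * \<theta>) \<le> real n * (A\<^sup>2 * p n / 2)"
      proof -
        have "A\<^sup>2 / (2 * \<eta> n * \<theta>) \<le> A\<^sup>2 / (2 * \<eta> n * p n)"
          using \<sigma>n p_pos[of n] \<eta>_pos[of n] \<theta> by (intro divide_left_mono mult_left_mono) (auto simp: \<theta>_def)
        also have "\<dots> = real n * (A\<^sup>2 * p n / 2)"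
          using \<eta>_p(1)[OF n] n p_pos[of n] \<eta>_pos[of n] by (simp add: field_simps)
        finally show ?thesis .
      qed
      have "fm.slaving_error (\<eta> n) \<theta> \<le> 2 * A * d n + fm.rate * exp (fm.rate * (real n * \<tau>)) *
          ((A * d n + \<theta> + 2 * A\<^sup>2 * \<sigma> n) * (real n * \<tau>) + real n * (A\<^sup>2 * p n / 2))"
        unfolding fm.slaving_error_def dn[symmetric]
        using s1 s2 fm.rate_nonneg fm.T_nonneg by (intro add_left_mono mult_left_mono add_mono mult_right_mono) auto
      also have "\<dots> = U n" unfolding U_def rn \<theta>_def by (simp add: algebra_simps)
      finally show ?thesis .
    qed
    have tot: "norm ((\<integral>x. f n x (real n * \<tau>) \<partial>mu) - of_real (exp (- r n * \<tau>)) * m0) \<le> U n"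
      using order_trans[OF fm.total_decay[OF t \<eta>_pos[of n] \<theta>] err] init[OF n]
      by (simp add: fm.total_def rn mult_ac)
    have var: "(\<integral>x. (norm (f n x (real n * \<tau>)))\<^sup>2 \<partial>mu) - (norm (\<integral>x. f n x (real n * \<tau>) \<partial>mu))\<^sup>2 / 2
        \<le> 4 * A\<^sup>2 * r n * p n + 4 * A * U n + 4 * A\<^sup>2 * slow (\<eta> n) + A\<^sup>2 * p n" if "p n \<le> \<tau>"
    proof -
      \<comment> \<open>The window \<open>n * p n\<close> is short compared with \<open>n\<close>,
        so the mass barely moves, but long enough for
        \<open>A\<^sup>2 / (\<eta> n * (n * p n)) = A\<^sup>2 * p n\<close> to vanish.\<close>
      have "fm.energy (real n * \<tau>) - (norm (fm.total (real n * \<tau>)))\<^sup>2 / 2 \<le> 4 * A\<^sup>2 * fm.rate * (real n * p n)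
          + 4 * A * fm.slaving_error (\<eta> n) \<theta> + 4 * A\<^sup>2 * slow (\<eta> n) + A\<^sup>2 / (\<eta> n * (real n * p n))"
        by (rule fm.variance_bound[OF t _ _ \<eta>_pos \<theta>]) (use that n p_pos[of n] in auto)
      also have "\<dots> \<le> 4 * A\<^sup>2 * fm.rate * (real n * p n) + 4 * A * U n + 4 * A\<^sup>2 * slow (\<eta> n) + A\<^sup>2 / (\<eta> n * (real n * p n))"
        using err fm.A_nonneg by (intro add_mono[OF add_mono[OF add_mono]] mult_left_mono order_refl) auto
      also have "A\<^sup>2 / (\<eta> n * (real n * p n)) = A\<^sup>2 * p n"
        using \<eta>_p(2)[OF n] by (simp add: mult.commute)
      finally show ?thesis by (simp add: fm.energy_def fm.total_def rn mult_ac)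
    qed
    have veq: "(\<integral>x. (norm (f n x (real n * \<tau>) - z / 2))\<^sup>2 \<partial>mu) =
        (\<integral>x. (norm (f n x (real n * \<tau>)))\<^sup>2 \<partial>mu) - (norm (\<integral>x. f n x (real n * \<tau>) \<partial>mu))\<^sup>2 / 2
        + (norm ((\<integral>x. f n x (real n * \<tau>) \<partial>mu) - z))\<^sup>2 / 2" for z
    proof -
      have "fm.total (real n * \<tau>) \<bullet> (z / 2) = (fm.total (real n * \<tau>) \<bullet> z) / 2"
        using inner_scaleR_right[of "fm.total (real n * \<tau>)" "1/2" z] by (simp add: scaleR_conv_of_real)
      then show ?thesis
        by (simp only: fm.variance_eq[OF t] flip: fm.energy_def fm.total_def)
          (simp add: fm.norm2_diff norm_divide power_divide field_simps)
    qed
    have "0 \<le> fm.energy (real n * \<tau>) - (norm (fm.total (real n * \<tau>)))\<^sup>2 / 2"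
    proof -
      have "0 \<le> (\<integral>x. (norm (f n x (real n * \<tau>) - fm.total (real n * \<tau>) / 2))\<^sup>2 \<partial>mu)" by simp
      then show ?thesis
        unfolding veq[of "fm.total (real n * \<tau>)"] by (simp add: fm.energy_def fm.total_def)
    qed
    then show ?thesis using tot var veq by (auto simp: fm.energy_def fm.total_def)
  qed
  have z_lim: "(\<lambda>n. of_real (exp (- r n * \<tau>)) * m0) \<longlonglongrightarrow> of_real (exp (- a * \<tau>)) * m0"
    by (intro tendsto_intros r_lim)
  have "(\<lambda>n. (\<integral>x. f n x (real n * \<tau>) \<partial>mu) - of_real (exp (- r n * \<tau>)) * m0) \<longlonglongrightarrow> 0"
    by (rule Lim_null_comparison[OF _ U_lim])
      (use main in \<open>auto simp: eventually_sequentially intro!: exI[of _ 1]\<close>)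
  from tendsto_add[OF this z_lim] show tot: ?total by simp
  show ?var if "0 < \<tau>"
  proof -
    define z where "z = of_real (exp (- a * \<tau>)) * m0"
    define Y where "Y n = 4 * A\<^sup>2 * r n * p n + 4 * A * U n + 4 * A\<^sup>2 * slow (\<eta> n) + A\<^sup>2 * p n
      + (norm ((\<integral>x. f n x (real n * \<tau>) \<partial>mu) - z))\<^sup>2 / 2" for n
    have le: "\<forall>\<^sub>F n in sequentially. (\<integral>x. (norm (f n x (real n * \<tau>) - of_real (exp (- a * \<tau>)) * m0 / 2))\<^sup>2 \<partial>mu) \<le> Y n"
    proof -
      have "\<forall>\<^sub>F n in sequentially. p n < \<tau>" using order_tendstoD(2)[OF p_lim that] .
      with eventually_ge_at_top[of 1] show ?thesis
      proof eventually_elim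
        case (elim n)
        then show ?case using main[of n] by (auto simp: Y_def z_def)
      qed
    qed
    have "Y \<longlonglongrightarrow> 4 * A\<^sup>2 * a * 0 + 4 * A * 0 + 4 * A\<^sup>2 * 0 + A\<^sup>2 * 0 + (norm (z - z))\<^sup>2 / 2"
      unfolding Y_def[abs_def] using tot unfolding z_def[symmetric]
      by (intro tendsto_intros r_lim p_lim U_lim slow_lim) auto
    then have "Y \<longlonglongrightarrow> 0" by simp
    from real_tendsto_sandwich[OF _ le tendsto_const this] show ?thesis by simp
  qed
qed

end

section \<open>Fourier inversion\<close>

text \<open>A Gaussian factor of parameter \<sigma> makes Fubini legitimate; its transform, read off
  from the characteristic function of the normal distribution, turns the right side into an average
  of \<open>g\<close> at scale \<sigma>. As \<sigma> tends to 0, one side converges because the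
  transform is integrable, the other because \<open>g\<close> is bounded and continuous.\<close>

lemma fourier_inversion:
  fixes g :: "real \<Rightarrow> complex"
  assumes cont: "continuous_on UNIV g" and bdd: "\<And>x. norm (g x) \<le> K"
    and int: "integrable lborel g" and fint: "integrable lborel (fourier g)"
  shows "(\<integral>\<xi>. exp (\<i> * of_real (\<xi> * y)) * fourier g \<xi> \<partial>lborel) = of_real (2 * pi) * g y"
proof -
  have g_meas [measurable]: "g \<in> borel_measurable borel"
    using cont by (rule borel_measurable_continuous_onI)
  have gauss: "(\<integral>\<xi>. exp (\<i> * of_real (\<xi> * z)) * of_real (exp (- (\<sigma> * \<xi>)\<^sup>2 / 2)) \<partial>lborel)
      = of_real (2 * pi / \<sigma> * std_normal_density (z / \<sigma>))" (is ?G1)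
    and gauss_int: "integrable lborel (\<lambda>\<xi>. exp (- (\<sigma> * \<xi>)\<^sup>2 / 2))" (is ?G2)
    if \<sigma>: "0 < \<sigma>" for \<sigma> z :: real
  proof -
    have e: "exp (- (\<sigma> * \<xi>)\<^sup>2 / 2) = sqrt (2 * pi) * std_normal_density (\<sigma> * \<xi>)" for \<xi>
      by (simp add: std_normal_density_def)
    show ?G2 unfolding e
      using lborel_integrable_real_affine[of std_normal_density \<sigma> 0] \<sigma> by simp
    have "char std_normal_distribution (z / \<sigma>) = (\<integral>x. std_normal_density x *\<^sub>R iexp (z / \<sigma> * x) \<partial>lborel)"
      unfolding char_def by (subst integral_density) (auto simp: normal_density_nonneg)
    also have "\<dots> = \<sigma> *\<^sub>R (\<integral>\<xi>. std_normal_density (\<sigma> * \<xi>) *\<^sub>R iexp (z * \<xi>) \<partial>lborel)"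
      by (subst lborel_integral_real_affine[of \<sigma> _ 0]) (use \<sigma> in auto)
    finally have "(\<integral>\<xi>. std_normal_density (\<sigma> * \<xi>) *\<^sub>R iexp (z * \<xi>) \<partial>lborel)
        = of_real (exp (- (z / \<sigma>)\<^sup>2 / 2) / \<sigma>)"
      using \<sigma> by (simp add: char_std_normal_distribution scaleR_conv_of_real field_simps)
    moreover have "(\<integral>\<xi>. exp (\<i> * of_real (\<xi> * z)) * of_real (exp (- (\<sigma> * \<xi>)\<^sup>2 / 2)) \<partial>lborel)
        = of_real (sqrt (2 * pi)) * (\<integral>\<xi>. std_normal_density (\<sigma> * \<xi>) *\<^sub>R iexp (z * \<xi>) \<partial>lborel)"
      unfolding e by (subst integral_mult_right_zero[symmetric]) (simp add: scaleR_conv_of_real mult_ac)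
    moreover have "2 * pi / \<sigma> * std_normal_density (z / \<sigma>) = sqrt (2 * pi) * (exp (- (z / \<sigma>)\<^sup>2 / 2) / \<sigma>)"
    proof -
      have "2 * pi = sqrt (2 * pi) * sqrt (2 * pi)" by simp
      then show ?thesis using \<sigma> unfolding std_normal_density_def by (simp add: field_simps)
    qed
    ultimately show ?G1 by (simp only: of_real_mult)
  qed
  have smooth_inv: "(\<integral>\<xi>. exp (\<i> * of_real (\<xi> * y)) * of_real (exp (- (\<sigma> * \<xi>)\<^sup>2 / 2)) * fourier g \<xi> \<partial>lborel)
      = of_real (2 * pi) * (\<integral>z. of_real (std_normal_density z) * g (y - \<sigma> * z) \<partial>lborel)"
    if \<sigma>: "0 < \<sigma>" for \<sigma> :: real
  proof -
    define H where "H = (\<lambda>\<xi> x. exp (\<i> * of_real (\<xi> * (y - x))) * of_real (exp (- (\<sigma> * \<xi>)\<^sup>2 / 2)) * g x)"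
    have "exp (\<i> * of_real (\<xi> * y)) * of_real (exp (- (\<sigma> * \<xi>)\<^sup>2 / 2)) * fourier g \<xi> = (\<integral>x. H \<xi> x \<partial>lborel)" for \<xi>
      unfolding fourier_def H_def
      by (subst integral_mult_right_zero[symmetric]) (simp add: algebra_simps exp_diff exp_minus field_simps)
    then have "(\<integral>\<xi>. exp (\<i> * of_real (\<xi> * y)) * of_real (exp (- (\<sigma> * \<xi>)\<^sup>2 / 2)) * fourier g \<xi> \<partial>lborel)
        = (\<integral>\<xi>. (\<integral>x. H \<xi> x \<partial>lborel) \<partial>lborel)" by simp
    also have "\<dots> = (\<integral>x. (\<integral>\<xi>. H \<xi> x \<partial>lborel) \<partial>lborel)"
    proof (rule lborel_pair.Fubini_integral)
      have "integrable (lborel \<Otimes>\<^sub>M lborel) (\<lambda>(\<xi>, x). complex_of_real (exp (- (\<sigma> * \<xi>)\<^sup>2 / 2)) * g x)"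
      proof (rule lborel_pair.Fubini_integrable)
        show "integrable lborel (\<lambda>\<xi>. \<integral>x. norm (case (\<xi>, x) of (\<xi>, x) \<Rightarrow> complex_of_real (exp (- (\<sigma> * \<xi>)\<^sup>2 / 2)) * g x) \<partial>lborel)"
          using gauss_int[OF \<sigma>] by (simp add: norm_mult)
        show "AE \<xi> in lborel. integrable lborel (\<lambda>x. case (\<xi>, x) of (\<xi>, x) \<Rightarrow> complex_of_real (exp (- (\<sigma> * \<xi>)\<^sup>2 / 2)) * g x)"
          using int by simp
      qed measurable
      then show "integrable (lborel \<Otimes>\<^sub>M lborel) (\<lambda>(x, \<xi>). H \<xi> x)"
      proof -
        assume "integrable (lborel \<Otimes>\<^sub>M lborel) (\<lambda>(\<xi>, x). complex_of_real (exp (- (\<sigma> * \<xi>)\<^sup>2 / 2)) * g x)"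
        then have "integrable (lborel \<Otimes>\<^sub>M lborel) (\<lambda>(\<xi>, x). H \<xi> x)"
          by (rule Bochner_Integration.integrable_bound) (auto simp: H_def norm_mult)
        then show ?thesis
          using lborel_pair.integrable_product_swap[of "\<lambda>(\<xi>, x). H \<xi> x"] by (simp add: case_prod_unfold)
      qed
    qed
    also have "\<dots> = (\<integral>x. of_real (2 * pi / \<sigma> * std_normal_density ((y - x) / \<sigma>)) * g x \<partial>lborel)"
      unfolding H_def by (subst integral_mult_left_zero) (simp only: gauss[OF \<sigma>])
    also have "\<dots> = \<sigma> *\<^sub>R (\<integral>z. of_real (2 * pi / \<sigma> * std_normal_density z) * g (y - \<sigma> * z) \<partial>lborel)"
      by (subst lborel_integral_real_affine[of "- \<sigma>" _ y]) (use \<sigma> in auto)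
    also have "\<dots> = of_real (2 * pi) * (\<integral>z. of_real (std_normal_density z) * g (y - \<sigma> * z) \<partial>lborel)"
      unfolding scaleR_conv_of_real by (subst (1 2) integral_mult_right_zero[symmetric]) (use \<sigma> in \<open>simp add: field_simps\<close>)
    finally show ?thesis .
  qed
  define s where "s n = 1 / real (Suc n)" for n
  have s: "s \<longlonglongrightarrow> 0" "0 < s n" for n
    using LIMSEQ_inverse_real_of_nat by (simp_all add: s_def[abs_def] inverse_eq_divide)
  have fm [measurable]: "fourier g \<in> borel_measurable lborel" using fint by auto
  have "(\<lambda>n. \<integral>\<xi>. exp (\<i> * of_real (\<xi> * y)) * of_real (exp (- (s n * \<xi>)\<^sup>2 / 2)) * fourier g \<xi> \<partial>lborel)
      \<longlonglongrightarrow> (\<integral>\<xi>. exp (\<i> * of_real (\<xi> * y)) * of_real (exp (- (0 * \<xi>)\<^sup>2 / 2)) * fourier g \<xi> \<partial>lborel)"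
  proof (rule integral_dominated_convergence[where w = "\<lambda>\<xi>. norm (fourier g \<xi>)"])
    show "AE \<xi> in lborel. (\<lambda>n. exp (\<i> * of_real (\<xi> * y)) * of_real (exp (- (s n * \<xi>)\<^sup>2 / 2)) * fourier g \<xi>)
      \<longlonglongrightarrow> exp (\<i> * of_real (\<xi> * y)) * of_real (exp (- (0 * \<xi>)\<^sup>2 / 2)) * fourier g \<xi>"
      by (intro AE_I2 tendsto_intros s) auto
  qed (use fint in \<open>auto simp: norm_mult intro!: mult_left_le_one_le\<close>)
  then have lim1: "(\<lambda>n. of_real (2 * pi) * (\<integral>z. of_real (std_normal_density z) * g (y - s n * z) \<partial>lborel))
      \<longlonglongrightarrow> (\<integral>\<xi>. exp (\<i> * of_real (\<xi> * y)) * of_real (exp (- (0 * \<xi>)\<^sup>2 / 2)) * fourier g \<xi> \<partial>lborel)"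
    unfolding smooth_inv[OF s(2)] .
  have lim2: "(\<lambda>n. of_real (2 * pi) * (\<integral>z. of_real (std_normal_density z) * g (y - s n * z) \<partial>lborel))
      \<longlonglongrightarrow> of_real (2 * pi) * (\<integral>z. of_real (std_normal_density z) * g (y - 0 * z) \<partial>lborel)"
  proof (intro tendsto_intros integral_dominated_convergence[where w = "\<lambda>z. std_normal_density z * K"])
    show "AE z in lborel. (\<lambda>n. of_real (std_normal_density z) * g (y - s n * z)) \<longlonglongrightarrow> of_real (std_normal_density z) * g (y - 0 * z)"
      by (intro AE_I2 tendsto_intros s continuous_on_tendsto_compose[OF cont]) auto
  qed (use bdd in \<open>auto simp: norm_mult normal_density_nonneg intro!: mult_left_mono\<close>)
  have "(\<integral>z. of_real (std_normal_density z) * g (y - 0 * z) \<partial>lborel) = g y"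
    by (simp add: integral_normal_density)
  then show ?thesis using LIMSEQ_unique[OF lim1 lim2] by simp
qed

section \<open>Transport equations with relaxation\<close>

text \<open>Regularity is classical in \<open>(y, t)\<close> for each point of the phase space, but
  merely measurable in \<open>x\<close> for each fixed \<open>(y, t)\<close>; joint measurability is
  derived from this. The number \<open>R\<close> bounds the support of the data.\<close>

locale transport_solution = relaxation_kernel mu lam kap Lam
  for mu :: "'x measure" and lam kap Lam +
  fixes vel :: "'x \<Rightarrow> real" and u :: "real \<Rightarrow> 'x \<Rightarrow> real \<Rightarrow> complex"
    and uy ut :: "'x \<Rightarrow> real \<Rightarrow> real \<Rightarrow> complex" and w :: "real \<Rightarrow> real \<Rightarrow> complex"
    and Vb R M :: real
  assumes vel_meas [measurable]: "vel \<in> borel_measurable mu"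
    and vel_le: "x \<in> space mu \<Longrightarrow> \<bar>vel x\<bar> \<le> Vb"
    and u_meas: "0 \<le> t \<Longrightarrow> (\<lambda>x. u y x t) \<in> borel_measurable mu"
    and u_bdd: "x \<in> space mu \<Longrightarrow> 0 \<le> t \<Longrightarrow> norm (u y x t) \<le> M"
    and uy_cont: "x \<in> space mu \<Longrightarrow> continuous_on (UNIV \<times> {0..}) (\<lambda>(y, t). uy x y t)"
    and ut_cont: "x \<in> space mu \<Longrightarrow> continuous_on (UNIV \<times> {0..}) (\<lambda>(y, t). ut x y t)"
    and u_y: "x \<in> space mu \<Longrightarrow> 0 \<le> t \<Longrightarrow> ((\<lambda>y. u y x t) has_vector_derivative uy x y t) (at y)"
    and u_t: "x \<in> space mu \<Longrightarrow> 0 \<le> t \<Longrightarrow> (u y x has_vector_derivative ut x y t) (at t within {0..})"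
    and equation: "x \<in> space mu \<Longrightarrow> 0 \<le> t \<Longrightarrow>
      ut x y t + of_real (vel x) * uy x y t = of_real (lam x) * (w y t - u y x t)"
    and w_eq: "0 \<le> t \<Longrightarrow> w y t = of_real kap * (\<integral>x. of_real (lam x) * u y x t \<partial>mu)"
    and init_supp: "x \<in> space mu \<Longrightarrow> R < \<bar>y\<bar> \<Longrightarrow> u y x 0 = 0"
    and R_nonneg: "0 \<le> R"
begin

lemma space_nonempty: "space mu \<noteq> {}"
  using mass by (metis measure_empty zero_neq_numeral)

lemma Vb_nonneg: "0 \<le> Vb"
  using space_nonempty vel_le by (metis abs_ge_zero ex_in_conv order_trans)

lemma M_nonneg: "0 \<le> M"
  using space_nonempty u_bdd by (metis all_not_in_conv norm_ge_zero order_refl order_trans)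

text \<open>One continuous partial derivative together with existence of the other gives a total
  derivative, here on the closed half plane and hence one-sided at \<open>t = 0\<close>.\<close>

lemma u_total_derivative:
  assumes x: "x \<in> space mu" and t: "0 \<le> t"
  shows "((\<lambda>(y, t). u y x t) has_derivative (\<lambda>(dy, dt). dy *\<^sub>R uy x y t + dt *\<^sub>R ut x y t))
    (at (y, t) within UNIV \<times> {0..})"
proof -
  have cont: "continuous_on (UNIV \<times> {0..}) (\<lambda>(y, t). blinfun_scaleR_left (ut x y t))"
  proof -
    have "continuous_on (UNIV \<times> {0..}) (\<lambda>p. blinfun_scaleR_left ((\<lambda>(y, t). ut x y t) p))"
      by (rule bounded_linear.continuous_on[OF bounded_linear_blinfun_scaleR_left ut_cont[OF x]])
    then show ?thesis by (simp add: case_prod_unfold)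
  qed
  have "((\<lambda>(y, t). u y x t) has_derivative
      (\<lambda>(dy, dt). dy *\<^sub>R uy x y t + blinfun_apply (blinfun_scaleR_left (ut x y t)) dt))
    (at (y, t) within UNIV \<times> {0..})"
  proof (rule has_derivative_partialsI[where f = "\<lambda>y t. u y x t"])
    show "((\<lambda>y. u y x t) has_derivative (\<lambda>dy. dy *\<^sub>R uy x y t)) (at y within UNIV)"
      using u_y[OF x t] by (simp add: has_vector_derivative_def)
    show "((\<lambda>t. u y x t) has_derivative blinfun_apply (blinfun_scaleR_left (ut x y t))) (at t within {0..})"
      if "t \<in> {0..}" for y t
      using u_t[OF x, of t y] that by (simp add: has_vector_derivative_def)
    show "continuous (at (y, t) within UNIV \<times> {0..}) (\<lambda>(y, t). blinfun_scaleR_left (ut x y t))"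
      using cont t by (auto simp: continuous_on_eq_continuous_within)
  qed (use t in auto)
  then show ?thesis by simp
qed

text \<open>On a characteristic line the transport term is part of the time derivative and only
  relaxation remains. The term \<open>\<i> * of_real 0\<close> brings the equation into the form of
  \<open>damped_ode_bound\<close> with \<open>b = 0\<close>.\<close>

lemma characteristic_derivative:
  assumes x: "x \<in> space mu" and s: "s \<in> {0..t}"
  shows "((\<lambda>s. u (y - vel x * (t - s)) x s) has_vector_derivative
      (- (of_real (lam x) + \<i> * of_real 0) * u (y - vel x * (t - s)) x s
        + of_real (lam x) * w (y - vel x * (t - s)) s)) (at s within {0..t})"
proof -
  define z where "z = y - vel x * (t - s)"
  define D where "D = (\<lambda>p (dy, dt). dy *\<^sub>R uy x (fst p) (snd p) + dt *\<^sub>R ut x (fst p) (snd p))"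
  have "((\<lambda>s. (\<lambda>(y, t). u y x t) (y - vel x * (t - s), s)) has_derivative
      (\<lambda>h. D (y - vel x * (t - s), s) (vel x * h, h))) (at s within {0..t})"
  proof (rule has_derivative_in_compose2[where t = "UNIV \<times> {0..}" and g' = D
        and f = "\<lambda>s. (y - vel x * (t - s), s)" and f' = "\<lambda>h. (vel x * h, h)"])
    show "((\<lambda>(y, t). u y x t) has_derivative D p) (at p within UNIV \<times> {0..})" if "p \<in> UNIV \<times> {0..}" for p
      using u_total_derivative[OF x, of "snd p" "fst p"] that by (auto simp: D_def)
    show "((\<lambda>s. (y - vel x * (t - s), s)) has_derivative (\<lambda>h. (vel x * h, h))) (at s within {0..t})"
      by (auto intro!: derivative_eq_intros)
  qed (use s in auto)
  then have "((\<lambda>s. (\<lambda>(y, t). u y x t) (y - vel x * (t - s), s)) has_derivative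
      (\<lambda>h. (\<lambda>(dy, dt). dy *\<^sub>R uy x z s + dt *\<^sub>R ut x z s) (vel x * h, h))) (at s within {0..t})"
    by (simp add: D_def z_def)
  then have "((\<lambda>s. u (y - vel x * (t - s)) x s) has_derivative
      (\<lambda>h. h *\<^sub>R (of_real (vel x) * uy x z s + ut x z s))) (at s within {0..t})"
    by (simp add: scaleR_conv_of_real algebra_simps)
  moreover have "of_real (vel x) * uy x z s + ut x z s = of_real (lam x) * (w z s - u z x s)"
    using equation[OF x, of s z] s by (simp add: add.commute)
  moreover have "- (of_real (lam x) + \<i> * of_real 0) * u z x s + of_real (lam x) * w z s
      = of_real (lam x) * (w z s - u z x s)"
    by (simp add: algebra_simps)
  ultimately show ?thesis
    unfolding has_vector_derivative_def z_def[symmetric] by (simp only:)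
qed

text \<open>The contraction argument is run outside the cone: backward characteristics that start
  there stay there, and \<open>w\<close> averages only over modes at the same \<open>y\<close>, so
  the outside is self-contained and its data vanish.\<close>

lemma finite_propagation:
  assumes x: "x \<in> space mu" and t: "0 \<le> t" and y: "R + Vb * t < \<bar>y\<bar>"
  shows "u y x t = 0"
proof -
  define Q where "Q = {(y, x', s). x' \<in> space mu \<and> 0 \<le> s \<and> s \<le> t \<and> R + Vb * s < \<bar>y\<bar>}"
  define Z where "Z = (\<lambda>(y, x, s). norm (u y x s))"
  define q where "q = 1 - exp (- Lam * t)"
  have "Z (y, x, t) \<le> 0"
  proof (rule contraction_bound[where Q = Q and q = q and M = M])
    show "0 \<le> q" "q < 1" using Lam_nonneg t by (auto simp: q_def)
    show "Z p \<le> M" if "p \<in> Q" for p using that u_bdd by (auto simp: Q_def Z_def)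
    show "(y, x, t) \<in> Q" using x y t by (simp add: Q_def)
    fix S p assume S: "0 \<le> S" "\<And>p. p \<in> Q \<Longrightarrow> Z p \<le> S" and p: "p \<in> Q"
    obtain y x r where pe: "p = (y, x, r)" by (cases p) auto
    have x: "x \<in> space mu" and r: "0 \<le> r" "r \<le> t" and y: "R + Vb * r < \<bar>y\<bar>"
      using p by (auto simp: Q_def pe)
    have far: "R + Vb * s < \<bar>y - vel x * (r - s)\<bar>" if "s \<in> {0..r}" for s
    proof -
      have "\<bar>vel x * (r - s)\<bar> \<le> Vb * (r - s)"
        unfolding abs_mult using that vel_le[OF x] by (intro mult_mono) auto
      then show ?thesis using y by (simp add: algebra_simps)
    qed
    have "norm (u (y - vel x * (r - r)) x r) \<le> 0 * exp (- lam x * r) + (1 - exp (- lam x * r)) * S"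
    proof (rule damped_ode_bound[where g = "\<lambda>s. u (y - vel x * (r - s)) x s"
          and W = "\<lambda>s. w (y - vel x * (r - s)) s" and b = 0])
      show "norm (w (y - vel x * (r - s)) s) \<le> S" if s: "s \<in> {0..r}" for s
      proof -
        have s0: "0 \<le> s" using s by simp
        have "norm (u (y - vel x * (r - s)) x' s) \<le> S" if "x' \<in> space mu" for x'
          using S(2)[of "(y - vel x * (r - s), x', s)"] far[OF s] that s r by (simp add: Q_def Z_def)
        then show ?thesis unfolding w_eq[OF s0] by (intro average_bound u_meas s0) auto
      qed
      show "norm (u (y - vel x * (r - 0)) x 0) \<le> 0"
        using init_supp[OF x] far[of 0] r by simp
    qed (use r x lam_nonneg characteristic_derivative in auto)
    also have "\<dots> = (1 - exp (- lam x * r)) * S" by simp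
    also have "\<dots> \<le> q * S"
    proof -
      have "lam x * r \<le> Lam * t" using lam_le[OF x] lam_nonneg[OF x] r by (intro mult_mono) auto
      then show ?thesis using S(1) by (intro mult_right_mono) (auto simp: q_def)
    qed
    finally show "Z p \<le> 0 + q * (S - 0)" by (simp add: Z_def pe)
  qed
  then show ?thesis by (simp add: Z_def)
qed

lemma w_supp:
  assumes "0 \<le> t" "R + Vb * t < \<bar>y\<bar>" shows "w y t = 0"
proof -
  have "(\<integral>x. of_real (lam x) * u y x t \<partial>mu) = (\<integral>x. 0 \<partial>mu)"
    by (rule Bochner_Integration.integral_cong) (use assms finite_propagation in auto)
  then show ?thesis using assms by (simp add: w_eq)
qed

lemma u_cont_y: "x \<in> space mu \<Longrightarrow> 0 \<le> t \<Longrightarrow> continuous_on S (\<lambda>y. u y x t)"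
  using u_y by (meson continuous_on_vector_derivative has_vector_derivative_at_within)

lemma section_cont:
  assumes "continuous_on (UNIV \<times> {0..}) (\<lambda>(y, t). h y t)" "0 \<le> t"
  shows "continuous_on S (\<lambda>y. h y t)"
proof -
  have "continuous_on S (\<lambda>y. (\<lambda>(y, t). h y t) (y, t))"
    by (rule continuous_on_compose2[OF assms(1)]) (use assms(2) in \<open>auto intro!: continuous_intros\<close>)
  then show ?thesis by simp
qed

lemma u_joint_meas: assumes "0 \<le> t" shows "(\<lambda>(y, x). u y x t) \<in> borel_measurable (lborel \<Otimes>\<^sub>M mu)"
  by (rule caratheodory_measurable) (use assms u_cont_y u_meas in auto)

lemma indicator_Icc_integrable [simp]: "integrable lborel (indicator {a..b} :: real \<Rightarrow> real)"
  by (rule integrable_real_indicator) (auto simp: emeasure_lborel_Icc_eq)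

lemma u_integrable:
  assumes x: "x \<in> space mu" and t: "0 \<le> t" shows "integrable lborel (\<lambda>y. u y x t)"
proof (rule Bochner_Integration.integrable_bound)
  show "integrable lborel (\<lambda>y. M * indicator {- (R + Vb * t)..R + Vb * t} y)"
    by (intro integrable_mult_right indicator_Icc_integrable)
  show "(\<lambda>y. u y x t) \<in> borel_measurable lborel"
    using u_cont_y[OF assms] by (simp add: borel_measurable_continuous_onI)
  show "AE y in lborel. norm (u y x t) \<le> norm (M * indicator {- (R + Vb * t)..R + Vb * t} y)"
    using u_bdd[OF assms] finite_propagation[OF assms] M_nonneg
    by (intro AE_I2) (auto simp: indicator_def not_le abs_le_iff)
qed

section \<open>Fourier modes of a transport solution\<close>

definition mode :: "real \<Rightarrow> 'x \<Rightarrow> real \<Rightarrow> complex" where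
  "mode \<xi> x t = fourier (\<lambda>y. u y x t) \<xi>"

lemma mode_joint_meas:
  assumes "0 \<le> t" shows "(\<lambda>(\<xi>, x). mode \<xi> x t) \<in> borel_measurable (lborel \<Otimes>\<^sub>M mu)"
proof -
  have [measurable]: "(\<lambda>(y, x). u y x t) \<in> borel_measurable (lborel \<Otimes>\<^sub>M mu)"
    by (rule u_joint_meas[OF assms])
  have [measurable]: "(\<lambda>p. u (snd p) (snd (fst p)) t) \<in> borel_measurable ((lborel \<Otimes>\<^sub>M mu) \<Otimes>\<^sub>M lborel)"
  proof -
    have "(\<lambda>p. (\<lambda>(y, x). u y x t) (snd p, snd (fst p))) \<in> borel_measurable ((lborel \<Otimes>\<^sub>M mu) \<Otimes>\<^sub>M lborel)"
      by measurable
    then show ?thesis by simp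
  qed
  have "(\<lambda>p. \<integral>y. exp (- \<i> * of_real (fst p * y)) * u y (snd p) t \<partial>lborel) \<in> borel_measurable (lborel \<Otimes>\<^sub>M mu)"
    by (rule lborel.borel_measurable_lebesgue_integral) (simp add: case_prod_unfold)
  then show ?thesis by (simp add: mode_def fourier_def case_prod_unfold)
qed

lemma mode_meas: assumes "0 \<le> t" shows "(\<lambda>x. mode \<xi> x t) \<in> borel_measurable mu"
proof -
  have "(\<lambda>x. (\<lambda>(\<xi>, x). mode \<xi> x t) (\<xi>, x)) \<in> borel_measurable mu"
    by (rule measurable_compose[OF _ mode_joint_meas[OF assms]]) simp
  then show ?thesis by simp
qed

lemma mode_bdd:
  assumes x: "x \<in> space mu" and t: "0 \<le> t" shows "norm (mode \<xi> x t) \<le> M * (2 * (R + Vb * t))"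
proof -
  have "norm (mode \<xi> x t) \<le> (\<integral>y. norm (exp (- \<i> * of_real (\<xi> * y)) * u y x t) \<partial>lborel)"
    unfolding mode_def fourier_def by (rule integral_norm_bound)
  also have "\<dots> = (\<integral>y. norm (u y x t) \<partial>lborel)" by (simp add: norm_mult)
  also have "\<dots> \<le> (\<integral>y. M * indicator {- (R + Vb * t)..R + Vb * t} y \<partial>lborel)"
    by (rule integral_mono)
      (use u_integrable[OF assms] u_bdd[OF assms] finite_propagation[OF assms] M_nonneg in
        \<open>auto simp: not_le abs_le_iff split: split_indicator\<close>)
  also have "\<dots> = M * (2 * (R + Vb * t))" using R_nonneg Vb_nonneg t by simp
  finally show ?thesis .
qed

definition mode_avg :: "real \<Rightarrow> real \<Rightarrow> complex" where
  "mode_avg \<xi> t = (\<integral>y. exp (- \<i> * of_real (\<xi> * y)) * w y t \<partial>lborel)"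

text \<open>Fubini, with finite propagation confining the integrand to a set of finite measure. The
  weight \<open>lam\<close> serves for the average, the weight 1 for the density.\<close>

lemma weighted_mode:
  assumes t: "0 \<le> t" and [measurable]: "g \<in> borel_measurable mu"
    and g_nonneg: "\<And>x. x \<in> space mu \<Longrightarrow> 0 \<le> g x" and g_le: "\<And>x. x \<in> space mu \<Longrightarrow> g x \<le> G"
  shows "(\<integral>x. of_real (g x) * mode \<xi> x t \<partial>mu) = fourier (\<lambda>y. \<integral>x. of_real (g x) * u y x t \<partial>mu) \<xi>"
proof -
  interpret P: pair_sigma_finite lborel mu ..
  have G_nonneg: "0 \<le> G" using space_nonempty g_nonneg g_le by (metis ex_in_conv order_trans)
  define r where "r = R + Vb * t"
  have r: "0 \<le> r" using R_nonneg Vb_nonneg t by (simp add: r_def)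
  define H where "H = (\<lambda>(y, x). of_real (g x) * (exp (- \<i> * of_real (\<xi> * y)) * u y x t))"
  have [measurable]: "(\<lambda>(y, x). u y x t) \<in> borel_measurable (lborel \<Otimes>\<^sub>M mu)"
    by (rule u_joint_meas[OF t])
  have H_meas: "H \<in> borel_measurable (lborel \<Otimes>\<^sub>M mu)"
  proof -
    have "(\<lambda>p. of_real (g (snd p)) * (exp (- \<i> * of_real (\<xi> * fst p)) * (\<lambda>(y, x). u y x t) p)) \<in> borel_measurable (lborel \<Otimes>\<^sub>M mu)"
      by measurable
    then show ?thesis by (simp add: H_def case_prod_unfold)
  qed
  have H_int: "integrable (lborel \<Otimes>\<^sub>M mu) H"
  proof (rule Bochner_Integration.integrable_bound[OF _ H_meas])
    show "integrable (lborel \<Otimes>\<^sub>M mu) (\<lambda>p. (G * M) * indicator ({- r..r} \<times> space mu) p)"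
    proof (intro integrable_mult_right integrable_real_indicator)
      have "emeasure (lborel \<Otimes>\<^sub>M mu) ({- r..r} \<times> space mu) = emeasure lborel {- r..r} * emeasure mu (space mu)"
        by (rule sigma_finite_measure.emeasure_pair_measure_Times[OF sigma_finite_measure_axioms]) auto
      also have "\<dots> < \<infinity>" by (simp add: ennreal_mult_less_top emeasure_eq_measure r)
      finally show "emeasure (lborel \<Otimes>\<^sub>M mu) ({- r..r} \<times> space mu) < \<infinity>" .
    qed auto
    show "AE p in lborel \<Otimes>\<^sub>M mu. norm (H p) \<le> norm (G * M * indicator ({- r..r} \<times> space mu) p)"
    proof (rule AE_I2)
      fix p :: "real \<times> 'x" assume p: "p \<in> space (lborel \<Otimes>\<^sub>M mu)"
      obtain y x where px: "p = (y, x)" by (cases p)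
      have x: "x \<in> space mu" using p px by (simp add: space_pair_measure)
      have "norm (H p) = g x * norm (u y x t)"
        using g_nonneg[OF x] by (simp add: H_def px norm_mult)
      also have "\<dots> \<le> G * M * indicator ({- r..r} \<times> space mu) p"
      proof (cases "\<bar>y\<bar> \<le> r")
        case True
        then have "indicator ({- r..r} \<times> space mu) p = (1 :: real)" using x by (auto simp: px abs_le_iff)
        then show ?thesis using u_bdd[OF x t, of y] g_le[OF x] g_nonneg[OF x] G_nonneg
          by (auto intro: mult_mono)
      next
        case False
        then show ?thesis using finite_propagation[OF x t, of y] G_nonneg M_nonneg by (simp add: r_def)
      qed
      finally show "norm (H p) \<le> norm (G * M * indicator ({- r..r} \<times> space mu) p)"
        using G_nonneg M_nonneg by simp
    qed
  qed
  have "(\<integral>x. of_real (g x) * mode \<xi> x t \<partial>mu) = (\<integral>x. (\<integral>y. H (y, x) \<partial>lborel) \<partial>mu)"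
    by (simp add: mode_def fourier_def H_def)
  also have "\<dots> = (\<integral>y. (\<integral>x. H (y, x) \<partial>mu) \<partial>lborel)"
    using P.Fubini_integral[of "\<lambda>y x. H (y, x)"] H_int by simp
  also have "\<dots> = (\<integral>y. exp (- \<i> * of_real (\<xi> * y)) * (\<integral>x. of_real (g x) * u y x t \<partial>mu) \<partial>lborel)"
    unfolding H_def by (subst integral_mult_right_zero[symmetric]) (simp add: mult_ac)
  finally show ?thesis by (simp add: fourier_def)
qed

lemma mode_avg_eq:
  assumes t: "0 \<le> t"
  shows "mode_avg \<xi> t = of_real kap * (\<integral>x. of_real (lam x) * mode \<xi> x t \<partial>mu)"
proof -
  have "of_real kap * (\<integral>x. of_real (lam x) * mode \<xi> x t \<partial>mu)
      = (\<integral>y. of_real kap * (exp (- \<i> * of_real (\<xi> * y)) * (\<integral>x. of_real (lam x) * u y x t \<partial>mu)) \<partial>lborel)"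
    using weighted_mode[OF t lam_meas lam_nonneg lam_le] by (simp add: fourier_def)
  then show ?thesis
    unfolding mode_avg_def w_eq[OF t] by (simp only: mult.left_commute)
qed

lemma density_mode: "0 \<le> t \<Longrightarrow> (\<integral>x. mode \<xi> x t \<partial>mu) = fourier (\<lambda>y. \<integral>x. u y x t \<partial>mu) \<xi>"
  using weighted_mode[of t "\<lambda>x. 1" 1] by simp

text \<open>Up to time \<open>T\<close> all supports lie in one interval. Hence \<open>ut\<close>
  can be dominated by its bound on a compact rectangle, and integration by parts in \<open>y\<close>
  leaves no boundary term.\<close>

lemma mode_der:
  assumes x: "x \<in> space mu" and t: "t \<in> {0..T}"
  shows "(mode \<xi> x has_vector_derivative
      (- (of_real (lam x) + \<i> * of_real (\<xi> * vel x)) * mode \<xi> x t + of_real (lam x) * mode_avg \<xi> t))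
    (at t within {0..T})"
proof -
  \<comment> \<open>The margin 1 makes \<open>u\<close> vanish at the end points \<open>r\<close>
    and \<open>- r\<close> themselves, as finite propagation speaks of the strict exterior.\<close>
  define r where "r = R + Vb * T + 1"
  have T: "0 \<le> T" and t0: "0 \<le> t" using t by auto
  have r: "0 \<le> r" "0 < r" using R_nonneg Vb_nonneg T by (simp_all add: r_def add_nonneg_pos)
  have supp: "u y x s = 0" if "s \<in> {0..T}" "r - 1 < \<bar>y\<bar>" for y s
  proof (rule finite_propagation[OF x])
    have "Vb * s \<le> Vb * T" using that Vb_nonneg by (intro mult_left_mono) auto
    then show "R + Vb * s < \<bar>y\<bar>" using that by (simp add: r_def)
  qed (use that in auto)
  define e where "e = (\<lambda>y. exp (- \<i> * complex_of_real (\<xi> * y)))"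
  have e_cont: "continuous_on S e" for S unfolding e_def by (intro continuous_intros)
  have e_norm: "norm (e y) = 1" for y by (simp add: e_def)
  have "compact ((\<lambda>(y, s). ut x y s) ` ({- r..r} \<times> {0..T}))"
    by (intro compact_continuous_image continuous_on_subset[OF ut_cont[OF x]] compact_Times) auto
  then obtain K where K: "\<And>y s. y \<in> {- r..r} \<Longrightarrow> s \<in> {0..T} \<Longrightarrow> norm (ut x y s) \<le> K"
    by (fastforce dest: compact_imp_bounded simp: bounded_iff)
  have K0: "0 \<le> K" using K[of 0 0] r T by (meson atLeastAtMost_iff neg_le_0_iff_le norm_ge_zero order_refl order_trans)
  let ?I = "indicator {- r..r} :: real \<Rightarrow> real"
  have "((\<lambda>s. \<integral>y. e y * u y x s \<partial>lborel) has_vector_derivative (\<integral>y. ?I y *\<^sub>R (e y * ut x y t) \<partial>lborel)) (at t within {0..T})"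
  proof (rule has_vector_derivative_integral[where g = "\<lambda>y. K * ?I y"])
    show "integrable lborel (\<lambda>y. e y * u y x s)" if "s \<in> {0..T}" for s
    proof (rule Bochner_Integration.integrable_bound[OF u_integrable[OF x, of s]])
      show "(\<lambda>y. e y * u y x s) \<in> borel_measurable lborel"
        using continuous_on_mult[OF e_cont u_cont_y[OF x, of s UNIV]] that
        by (simp add: borel_measurable_continuous_onI)
    qed (use that in \<open>auto simp: norm_mult e_norm\<close>)
    show "(\<lambda>y. ?I y *\<^sub>R (e y * ut x y t)) \<in> borel_measurable lborel"
    proof -
      have "continuous_on UNIV (\<lambda>y. e y * ut x y t)"
        by (rule continuous_on_mult[OF e_cont section_cont[OF ut_cont[OF x] t0]])
      then have [measurable]: "(\<lambda>y. e y * ut x y t) \<in> borel_measurable borel"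
        by (rule borel_measurable_continuous_onI)
      show ?thesis by measurable
    qed
    show "((\<lambda>s. e y * u y x s) has_vector_derivative ?I y *\<^sub>R (e y * ut x y s)) (at s within {0..T})"
      if s: "s \<in> {0..T}" for y s
    proof (cases "y \<in> {- r..r}")
      case True
      have "(u y x has_vector_derivative ut x y s) (at s within {0..T})"
        by (rule has_vector_derivative_within_subset[OF u_t[OF x]]) (use s in auto)
      then show ?thesis using True by (simp add: has_vector_derivative_mult_right)
    next
      case False
      have "((\<lambda>s. e y * u y x s) has_vector_derivative 0) (at s within {0..T})"
        by (rule has_vector_derivative_transform[where f = "\<lambda>s. 0"]) (use False s supp in auto)
      then show ?thesis using False by simp
    qed
    show "norm (?I y *\<^sub>R (e y * ut x y s)) \<le> K * ?I y" if "s \<in> {0..T}" for y s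
      using K[of y s] that by (auto simp: indicator_def norm_mult e_norm)
  qed (use t in auto)
  moreover have "(\<integral>y. ?I y *\<^sub>R (e y * ut x y t) \<partial>lborel)
      = - (of_real (lam x) + \<i> * of_real (\<xi> * vel x)) * mode \<xi> x t + of_real (lam x) * mode_avg \<xi> t"
  proof -
    have cu: "continuous_on {- r..r} (\<lambda>y. e y * u y x t)"
      and cy: "continuous_on {- r..r} (\<lambda>y. e y * uy x y t)"
      and ct: "continuous_on {- r..r} (\<lambda>y. e y * ut x y t)"
      by (intro continuous_on_mult e_cont u_cont_y section_cont[OF uy_cont] section_cont[OF ut_cont] x t0)+
    have iu: "integrable lborel (\<lambda>y. ?I y *\<^sub>R (e y * u y x t))"
      and iy: "integrable lborel (\<lambda>y. ?I y *\<^sub>R (e y * uy x y t))"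
      and it: "integrable lborel (\<lambda>y. ?I y *\<^sub>R (e y * ut x y t))"
      using borel_integrable_compact[OF compact_Icc cu] borel_integrable_compact[OF compact_Icc cy]
        borel_integrable_compact[OF compact_Icc ct]
      by (simp_all add: indicator_scaleR_eq_if)
    have Iu: "(\<integral>y. ?I y *\<^sub>R (e y * u y x t) \<partial>lborel) = mode \<xi> x t"
      unfolding mode_def fourier_def
      by (rule Bochner_Integration.integral_cong) (use supp[OF t] in \<open>auto simp: indicator_def e_def\<close>)
    have "(\<integral>y. ?I y *\<^sub>R (e y * uy x y t - \<i> * of_real \<xi> * (e y * u y x t)) \<partial>lborel)
        = e r * u r x t - e (- r) * u (- r) x t"
    proof (rule integral_FTC_Icc[where F = "\<lambda>y. e y * u y x t"])
      show "((\<lambda>y. e y * u y x t) has_vector_derivative e y * uy x y t - \<i> * of_real \<xi> * (e y * u y x t))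
          (at y within {- r..r})" for y
      proof -
        have "(e has_vector_derivative (- \<i> * of_real \<xi> * e y)) (at y within {- r..r})"
        proof -
          have "((\<lambda>y. exp (- \<i> * (complex_of_real \<xi> * of_real y))) has_vector_derivative
            (exp (- \<i> * (complex_of_real \<xi> * of_real y)) * (- \<i> * of_real \<xi>))) (at y within {- r..r})"
            by (rule has_vector_derivative_real_field) (auto intro!: derivative_eq_intros)
          then show ?thesis by (simp add: e_def mult_ac)
        qed
        from has_vector_derivative_mult[OF this has_vector_derivative_at_within[OF u_y[OF x t0]]]
        show ?thesis by (simp add: algebra_simps)
      qed
    qed (use r cu cy in \<open>auto intro!: continuous_on_diff continuous_on_mult continuous_on_const\<close>)
    also have "\<dots> = 0" using supp[OF t, of r] supp[OF t, of "- r"] r by simp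
    finally have Iy: "(\<integral>y. ?I y *\<^sub>R (e y * uy x y t) \<partial>lborel) = \<i> * of_real \<xi> * mode \<xi> x t"
    proof -
      assume a: "(\<integral>y. ?I y *\<^sub>R (e y * uy x y t - \<i> * of_real \<xi> * (e y * u y x t)) \<partial>lborel) = 0"
      have "(\<integral>y. ?I y *\<^sub>R (e y * uy x y t - \<i> * of_real \<xi> * (e y * u y x t)) \<partial>lborel)
          = (\<integral>y. ?I y *\<^sub>R (e y * uy x y t) - \<i> * of_real \<xi> * (?I y *\<^sub>R (e y * u y x t)) \<partial>lborel)"
        by (intro Bochner_Integration.integral_cong) (auto simp: algebra_simps)
      also have "\<dots> = (\<integral>y. ?I y *\<^sub>R (e y * uy x y t) \<partial>lborel) - \<i> * of_real \<xi> * mode \<xi> x t"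
        using iu iy
        by (simp only: Iu[symmetric] Bochner_Integration.integral_diff integrable_mult_right integral_mult_right_zero)
      finally show ?thesis using a by simp
    qed
    have Iw: "(\<integral>y. ?I y *\<^sub>R (of_real (lam x) * (e y * w y t)) \<partial>lborel) = of_real (lam x) * mode_avg \<xi> t"
    proof -
      have "?I y *\<^sub>R (of_real (lam x) * (e y * w y t)) = of_real (lam x) * (e y * w y t)" for y
      proof (cases "y \<in> {- r..r}")
        case False
        have "Vb * t \<le> Vb * T" using t Vb_nonneg by (intro mult_left_mono) auto
        then have "w y t = 0" using False t by (intro w_supp) (auto simp: r_def)
        then show ?thesis by simp
      qed simp
      then show ?thesis by (simp add: mode_avg_def e_def)
    qed
    have "?I y *\<^sub>R (of_real (lam x) * (e y * w y t)) = ?I y *\<^sub>R (e y * ut x y t)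
        + (of_real (vel x) * (?I y *\<^sub>R (e y * uy x y t)) + of_real (lam x) * (?I y *\<^sub>R (e y * u y x t)))" for y
    proof -
      have "of_real (lam x) * w y t = ut x y t + of_real (vel x) * uy x y t + of_real (lam x) * u y x t"
        using equation[OF x t0, of y] by (simp add: algebra_simps)
      then have "e y * (of_real (lam x) * w y t) = e y * (ut x y t + of_real (vel x) * uy x y t + of_real (lam x) * u y x t)"
        by simp
      then show ?thesis by (simp add: indicator_def algebra_simps)
    qed
    then have "of_real (lam x) * mode_avg \<xi> t = (\<integral>y. ?I y *\<^sub>R (e y * ut x y t)
        + (of_real (vel x) * (?I y *\<^sub>R (e y * uy x y t)) + of_real (lam x) * (?I y *\<^sub>R (e y * u y x t))) \<partial>lborel)"
      unfolding Iw[symmetric] by simp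
    also have "\<dots> = (\<integral>y. ?I y *\<^sub>R (e y * ut x y t) \<partial>lborel)
        + (of_real (vel x) * (\<i> * of_real \<xi> * mode \<xi> x t) + of_real (lam x) * mode \<xi> x t)"
      using iu iy it by (simp only: Iu Iy Bochner_Integration.integral_add
          integrable_mult_right Bochner_Integration.integrable_add integral_mult_right_zero)
    finally show ?thesis by (simp add: algebra_simps)
  qed
  ultimately show ?thesis by (simp add: mode_def[abs_def] fourier_def e_def)
qed

end

section \<open>Uniform decay in frequency and the limit in physical space\<close>

text \<open>The decay is assumed at time 0 only; its majorant is integrable in \<xi> and uniform in
  the phase variable. The factor \<open>s\<close> in \<open>vel_odd\<close> runs over all
  frequencies, so the effective drift vanishes at each of them.\<close>

locale decaying_transport_solution = transport_solution +
  fixes A0 :: real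
  assumes vel_odd: "(\<integral>x. (lam x)\<^sup>2 * (s * vel x) / ((lam x)\<^sup>2 + (s * vel x)\<^sup>2) \<partial>mu) = 0"
    and init_decay: "x \<in> space mu \<Longrightarrow> norm (mode \<xi> x 0) \<le> A0 / (1 + \<xi>\<^sup>2)"
begin

lemma mode_fourier_mode:
  assumes "0 \<le> T"
  shows "fourier_mode mu lam kap Lam (\<lambda>x. \<xi> * vel x) (mode \<xi>) (mode_avg \<xi>) (\<bar>\<xi>\<bar> * Vb) T
    (M * (2 * (R + Vb * T))) (A0 / (1 + \<xi>\<^sup>2))"
proof unfold_locales
  show "norm (mode \<xi> x t) \<le> M * (2 * (R + Vb * T))" if "x \<in> space mu" "t \<in> {0..T}" for x t
  proof -
    have "M * (2 * (R + Vb * t)) \<le> M * (2 * (R + Vb * T))"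
      using that M_nonneg Vb_nonneg by (intro mult_left_mono add_left_mono) auto
    then show ?thesis using mode_bdd[OF that(1), of t \<xi>] that by auto
  qed
qed (use assms vel_le vel_odd mode_meas init_decay mode_avg_eq mode_der in
    \<open>auto simp: abs_mult mult_left_mono\<close>)

text \<open>The horizon is chosen to be \<open>t\<close>; the constant of
  \<open>mode_fourier_mode\<close> that grows with the horizon does not survive the maximum
  principle.\<close>

lemma mode_decay:
  assumes "x \<in> space mu" "0 \<le> t" shows "norm (mode \<xi> x t) \<le> A0 / (1 + \<xi>\<^sup>2)"
  using fourier_mode.sup_bound[OF mode_fourier_mode[OF assms(2)] assms(1)] assms(2) by simp

lemma mode_integrable:
  assumes "x \<in> space mu" "0 \<le> t" shows "integrable lborel (\<lambda>\<xi>. mode \<xi> x t)"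
proof (rule Bochner_Integration.integrable_bound[OF inverse_quadratic_integrable])
  have "(\<lambda>\<xi>. (\<lambda>(\<xi>, x). mode \<xi> x t) (\<xi>, x)) \<in> borel_measurable lborel"
    by (rule measurable_compose[OF _ mode_joint_meas[OF assms(2)]]) (use assms in simp)
  then show "(\<lambda>\<xi>. mode \<xi> x t) \<in> borel_measurable lborel" by simp
  show "AE \<xi> in lborel. norm (mode \<xi> x t) \<le> norm (A0 / (1 + \<xi>\<^sup>2))"
    using mode_decay[OF assms] by (intro AE_I2) (metis abs_ge_self order_trans real_norm_def)
qed

lemma u_inversion:
  assumes "x \<in> space mu" "0 \<le> t"
  shows "u y x t = of_real (1 / (2 * pi)) * (\<integral>\<xi>. exp (\<i> * of_real (\<xi> * y)) * mode \<xi> x t \<partial>lborel)"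
proof -
  have "(\<integral>\<xi>. exp (\<i> * of_real (\<xi> * y)) * fourier (\<lambda>y. u y x t) \<xi> \<partial>lborel) = of_real (2 * pi) * u y x t"
    by (rule fourier_inversion[where K = M])
      (use assms u_cont_y u_bdd u_integrable mode_integrable in \<open>auto simp: mode_def\<close>)
  then show ?thesis by (simp add: mode_def)
qed

end

text \<open>Each frequency converges by \<open>fourier_mode_limit\<close>, and
  \<open>A0 / (1 + \<xi>\<^sup>2)\<close> is an integrable majorant independent of \<open>n\<close>
  and of the phase variable, so the limits pass through Fourier inversion.\<close>

lemma (in relaxation_kernel) transport_limit:
  fixes v :: "'x \<Rightarrow> real" and \<epsilon> :: "nat \<Rightarrow> real" and a :: "real \<Rightarrow> real"
    and u :: "nat \<Rightarrow> real \<Rightarrow> 'x \<Rightarrow> real \<Rightarrow> complex" and u0 :: "real \<Rightarrow> 'x \<Rightarrow> complex" and y :: real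
  assumes pos: "AE x in mu. 0 < lam x" and \<tau>: "0 \<le> \<tau>" and \<epsilon>: "\<epsilon> \<longlonglongrightarrow> 0"
    and v_meas [measurable]: "v \<in> borel_measurable mu"
    and sol: "\<And>n. 1 \<le> n \<Longrightarrow>
      decaying_transport_solution mu lam kap Lam (\<lambda>x. \<epsilon> n * v x) (u n) (uy n) (ut n) (w n) (Vb n) R (M n) A0"
    and init: "\<And>n y x. 1 \<le> n \<Longrightarrow> x \<in> space mu \<Longrightarrow> u n y x 0 = u0 y x"
    and rate: "\<And>\<xi>. (\<lambda>n. real n * ((\<integral>x. lam x * (\<xi> * (\<epsilon> n * v x))\<^sup>2
        / ((lam x)\<^sup>2 + (\<xi> * (\<epsilon> n * v x))\<^sup>2) \<partial>mu) / 2)) \<longlonglongrightarrow> a \<xi>"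
  defines "ub \<equiv> of_real (1 / (2 * pi)) * (\<integral>\<xi>. exp (\<i> * of_real (\<xi> * y)) *
      (of_real (exp (- a \<xi> * \<tau>)) * (\<integral>x. fourier (\<lambda>y. u0 y x) \<xi> \<partial>mu)) \<partial>lborel)"
  shows "(\<lambda>n. \<integral>x. u n y x (real n * \<tau>) \<partial>mu) \<longlonglongrightarrow> ub" (is ?density)
    and "0 < \<tau> \<Longrightarrow> (\<lambda>n. \<integral>x. (norm (u n y x (real n * \<tau>) - ub / 2))\<^sup>2 \<partial>mu) \<longlonglongrightarrow> 0" (is "_ \<Longrightarrow> ?square")
proof -
  interpret P: pair_sigma_finite lborel mu ..
  define A where "A = (\<lambda>\<xi>::real. A0 / (1 + \<xi>\<^sup>2))"
  define f where "f = (\<lambda>n \<xi> x. fourier (\<lambda>y. u n y x (real n * \<tau>)) \<xi>)"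
  define z where "z = (\<lambda>\<xi>. of_real (exp (- a \<xi> * \<tau>)) * (\<integral>x. fourier (\<lambda>y. u0 y x) \<xi> \<partial>mu))"
  define e where "e = (\<lambda>\<xi>. exp (\<i> * complex_of_real (\<xi> * y)))"
  have e_norm: "norm (e \<xi>) = 1" for \<xi> by (simp add: e_def)
  have e_meas [measurable]: "e \<in> borel_measurable borel" unfolding e_def by measurable
  have facts: "(\<lambda>(\<xi>, x). f n \<xi> x) \<in> borel_measurable (lborel \<Otimes>\<^sub>M mu)"
      "integrable lborel A"
      "\<And>x \<xi>. x \<in> space mu \<Longrightarrow> norm (f n \<xi> x) \<le> A \<xi>"
      "\<And>x. x \<in> space mu \<Longrightarrow> integrable lborel (\<lambda>\<xi>. f n \<xi> x)"
      "\<And>x. x \<in> space mu \<Longrightarrow> u n y x (real n * \<tau>) = of_real (1 / (2 * pi)) * (\<integral>\<xi>. e \<xi> * f n \<xi> x \<partial>lborel)"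
      "(\<lambda>x. u n y x (real n * \<tau>)) \<in> borel_measurable mu"
      "\<And>x. x \<in> space mu \<Longrightarrow> norm (u n y x (real n * \<tau>)) \<le> M n"
    if n: "1 \<le> n" for n
  proof -
    interpret S: decaying_transport_solution mu lam kap Lam "\<lambda>x. \<epsilon> n * v x" "u n" "uy n" "ut n" "w n" "Vb n" R "M n" A0
      by (rule sol[OF n])
    have t: "0 \<le> real n * \<tau>" using \<tau> by simp
    show "(\<lambda>(\<xi>, x). f n \<xi> x) \<in> borel_measurable (lborel \<Otimes>\<^sub>M mu)"
      using S.mode_joint_meas[OF t] by (simp add: f_def S.mode_def)
    show "integrable lborel A" unfolding A_def by (rule inverse_quadratic_integrable)
    show "norm (f n \<xi> x) \<le> A \<xi>" if "x \<in> space mu" for x \<xi>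
      using S.mode_decay[OF that t] by (simp add: f_def A_def S.mode_def)
    show "integrable lborel (\<lambda>\<xi>. f n \<xi> x)" if "x \<in> space mu" for x
      using S.mode_integrable[OF that t] by (simp add: f_def S.mode_def)
    show "u n y x (real n * \<tau>) = of_real (1 / (2 * pi)) * (\<integral>\<xi>. e \<xi> * f n \<xi> x \<partial>lborel)" if "x \<in> space mu" for x
      using S.u_inversion[OF that t, of y] by (simp add: f_def e_def S.mode_def)
    show "(\<lambda>x. u n y x (real n * \<tau>)) \<in> borel_measurable mu" by (rule S.u_meas[OF t])
    show "norm (u n y x (real n * \<tau>)) \<le> M n" if "x \<in> space mu" for x by (rule S.u_bdd[OF that t])
  qed
  note A_int = facts(2)[OF order_refl]
  have f_sec: "(\<lambda>x. f n \<xi> x) \<in> borel_measurable mu" if "1 \<le> n" for n \<xi>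
  proof -
    have "(\<lambda>x. (\<lambda>(\<xi>, x). f n \<xi> x) (\<xi>, x)) \<in> borel_measurable mu"
      by (rule measurable_compose[OF _ facts(1)[OF that]]) simp
    then show ?thesis by simp
  qed
  have f_int: "integrable mu (\<lambda>x. f n \<xi> x)" if "1 \<le> n" for n \<xi>
    by (rule bounded_integrable[OF f_sec[OF that] facts(3)[OF that]])
  define tot where "tot n \<xi> = (\<integral>x. f n \<xi> x \<partial>mu)" for n \<xi>
  have tot_meas: "tot n \<in> borel_measurable lborel" if "1 \<le> n" for n
    unfolding tot_def[abs_def] using facts(1)[OF that] by (rule borel_measurable_lebesgue_integral)
  have tot_le: "norm (tot n \<xi>) \<le> 2 * A \<xi>" if "1 \<le> n" for n \<xi>
  proof -
    have "norm (tot n \<xi>) \<le> (\<integral>x. A \<xi> \<partial>mu)" unfolding tot_def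
      by (rule norm_integral_le) (use f_int[OF that] facts(3)[OF that] in auto)
    then show ?thesis using mass by simp
  qed
  have modes: "fourier_mode mu lam kap Lam (\<lambda>x. \<xi> * (\<epsilon> n * v x)) (\<lambda>x t. fourier (\<lambda>y. u n y x t) \<xi>)
      (transport_solution.mode_avg (w n) \<xi>) (\<bar>\<xi>\<bar> * Vb n) (real n * \<tau>) (M n * (2 * (R + Vb n * (real n * \<tau>)))) (A \<xi>)"
    if n: "1 \<le> n" for n \<xi>
  proof -
    interpret S: decaying_transport_solution mu lam kap Lam "\<lambda>x. \<epsilon> n * v x" "u n" "uy n" "ut n" "w n" "Vb n" R "M n" A0
      by (rule sol[OF n])
    have "S.mode \<xi> = (\<lambda>x t. fourier (\<lambda>y. u n y x t) \<xi>)" by (intro ext) (simp add: S.mode_def)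
    then show ?thesis using S.mode_fourier_mode[of "real n * \<tau>" \<xi>] \<tau> by (simp add: A_def)
  qed
  have init_tot: "(\<integral>x. fourier (\<lambda>y. u n y x 0) \<xi> \<partial>mu) = (\<integral>x. fourier (\<lambda>y. u0 y x) \<xi> \<partial>mu)" if "1 \<le> n" for n \<xi>
    by (rule Bochner_Integration.integral_cong) (use init[OF that] in auto)
  have c_lim: "(\<lambda>n. \<xi> * (\<epsilon> n * v x)) \<longlonglongrightarrow> 0" for \<xi> x
    using tendsto_mult[OF tendsto_const[of \<xi>] tendsto_mult[OF \<epsilon> tendsto_const[of "v x"]]] by simp
  have tot_lim: "(\<lambda>n. tot n \<xi>) \<longlonglongrightarrow> z \<xi>" for \<xi>
    unfolding tot_def f_def z_def
    by (rule fourier_mode_limit(1)[OF pos \<tau> c_lim modes _ rate init_tot]) auto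
  have var_lim: "(\<lambda>n. \<integral>x. (norm (f n \<xi> x - z \<xi> / 2))\<^sup>2 \<partial>mu) \<longlonglongrightarrow> 0" if "0 < \<tau>" for \<xi>
    unfolding f_def z_def
    by (rule fourier_mode_limit(2)[OF pos \<tau> c_lim modes _ rate init_tot that]) auto
  \<comment> \<open>Nothing is known about \<open>a\<close> as a function of the frequency;
    measurability comes from the approximating total masses.\<close>
  have z_meas [measurable]: "z \<in> borel_measurable lborel"
  proof (rule borel_measurable_LIMSEQ_metric)
    show "(\<lambda>n. tot (Suc n) \<xi>) \<longlonglongrightarrow> z \<xi>" for \<xi> by (rule LIMSEQ_Suc[OF tot_lim])
  qed (rule tot_meas, simp)
  have z_le: "norm (z \<xi>) \<le> 2 * A \<xi>" for \<xi>
    by (rule LIMSEQ_le_const2[OF tendsto_norm[OF tot_lim]]) (use tot_le in blast)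
  have z_int: "integrable lborel z"
    by (rule Bochner_Integration.integrable_bound[OF integrable_mult_right[OF A_int, of 2]])
      (auto intro: order_trans[OF z_le abs_ge_self])
  have ez_int: "integrable lborel (\<lambda>\<xi>. e \<xi> * z \<xi>)"
    by (rule Bochner_Integration.integrable_bound[OF z_int]) (auto simp: norm_mult e_norm)
  have ub: "ub = of_real (1 / (2 * pi)) * (\<integral>\<xi>. e \<xi> * z \<xi> \<partial>lborel)"
    by (simp add: ub_def e_def z_def)
  have A_pair: "integrable (lborel \<Otimes>\<^sub>M mu) (\<lambda>(\<xi>, x). A \<xi>)"
  proof (rule P.Fubini_integrable)
    show "integrable lborel (\<lambda>\<xi>. \<integral>x. norm (case (\<xi>, x) of (\<xi>, x) \<Rightarrow> A \<xi>) \<partial>mu)"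
      using A_int mass by simp
  qed (auto simp: A_def)
  show ?density
  \<comment> \<open>The solutions are given for \<open>n \<ge> 1\<close> only; after the shift every
    term of the sequence qualifies.\<close>
  proof (rule LIMSEQ_imp_Suc)
    have "(\<integral>x. u (Suc n) y x (real (Suc n) * \<tau>) \<partial>mu) = of_real (1 / (2 * pi)) * (\<integral>\<xi>. e \<xi> * tot (Suc n) \<xi> \<partial>lborel)" for n
    proof -
      let ?N = "Suc n"
      have N: "1 \<le> ?N" by simp
      have ef: "integrable (lborel \<Otimes>\<^sub>M mu) (\<lambda>(\<xi>, x). e \<xi> * f ?N \<xi> x)"
      proof (rule Bochner_Integration.integrable_bound[OF A_pair])
        have "(\<lambda>p. e (fst p) * (\<lambda>(\<xi>, x). f ?N \<xi> x) p) \<in> borel_measurable (lborel \<Otimes>\<^sub>M mu)"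
          using facts(1)[OF N] by measurable
        then show "(\<lambda>(\<xi>, x). e \<xi> * f ?N \<xi> x) \<in> borel_measurable (lborel \<Otimes>\<^sub>M mu)"
          by (simp add: case_prod_unfold)
        show "AE p in lborel \<Otimes>\<^sub>M mu. norm (case p of (\<xi>, x) \<Rightarrow> e \<xi> * f ?N \<xi> x) \<le> norm (case p of (\<xi>, x) \<Rightarrow> A \<xi>)"
          by (rule AE_I2) (auto simp: space_pair_measure norm_mult e_norm intro: order_trans[OF facts(3)[OF N] abs_ge_self])
      qed
      have "(\<integral>x. u ?N y x (real ?N * \<tau>) \<partial>mu) = (\<integral>x. of_real (1 / (2 * pi)) * (\<integral>\<xi>. e \<xi> * f ?N \<xi> x \<partial>lborel) \<partial>mu)"
        by (rule Bochner_Integration.integral_cong) (use facts(5)[OF N] in auto)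
      also have "\<dots> = of_real (1 / (2 * pi)) * (\<integral>x. (\<integral>\<xi>. e \<xi> * f ?N \<xi> x \<partial>lborel) \<partial>mu)" by simp
      also have "\<dots> = of_real (1 / (2 * pi)) * (\<integral>\<xi>. (\<integral>x. e \<xi> * f ?N \<xi> x \<partial>mu) \<partial>lborel)"
        using P.Fubini_integral[OF ef] by simp
      finally show ?thesis by (simp add: tot_def)
    qed
    moreover have "(\<lambda>n. \<integral>\<xi>. e \<xi> * tot (Suc n) \<xi> \<partial>lborel) \<longlonglongrightarrow> (\<integral>\<xi>. e \<xi> * z \<xi> \<partial>lborel)"
    proof (rule integral_dominated_convergence[where w = "\<lambda>\<xi>. 2 * A \<xi>"])
      show "AE \<xi> in lborel. (\<lambda>n. e \<xi> * tot (Suc n) \<xi>) \<longlonglongrightarrow> e \<xi> * z \<xi>"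
        using LIMSEQ_Suc[OF tot_lim] by (auto intro!: tendsto_intros)
      show "(\<lambda>\<xi>. e \<xi> * tot (Suc n) \<xi>) \<in> borel_measurable lborel" for n
        using tot_meas[of "Suc n"] by measurable
    qed (use A_int tot_le in \<open>auto simp: norm_mult e_norm\<close>)
    ultimately show "(\<lambda>n. \<integral>x. u (Suc n) y x (real (Suc n) * \<tau>) \<partial>mu) \<longlonglongrightarrow> ub"
      unfolding ub by (auto intro!: tendsto_intros)
  qed
  show ?square if "0 < \<tau>"
  proof (rule LIMSEQ_imp_Suc)
    define h where "h = (\<lambda>n \<xi> x. norm (f (Suc n) \<xi> x - z \<xi> / 2))"
    define K where "K = (\<integral>\<xi>. 2 * A \<xi> \<partial>lborel)"
    have h_le: "h n \<xi> x \<le> 2 * A \<xi>" if "x \<in> space mu" for n \<xi> x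
      using facts(3)[of "Suc n" x \<xi>] that z_le[of \<xi>] norm_triangle_ineq4[of "f (Suc n) \<xi> x" "z \<xi> / 2"]
      by (simp add: h_def norm_divide)
    have h_nonneg: "0 \<le> h n \<xi> x" for n \<xi> x by (simp add: h_def)
    have h_meas: "(\<lambda>(\<xi>, x). h n \<xi> x) \<in> borel_measurable (lborel \<Otimes>\<^sub>M mu)" for n
    proof -
      have "(\<lambda>p. norm ((\<lambda>(\<xi>, x). f (Suc n) \<xi> x) p - z (fst p) / 2)) \<in> borel_measurable (lborel \<Otimes>\<^sub>M mu)"
        using facts(1)[of "Suc n"] by measurable
      then show ?thesis by (simp add: h_def case_prod_unfold)
    qed
    have h_pair: "integrable (lborel \<Otimes>\<^sub>M mu) (\<lambda>(\<xi>, x). h n \<xi> x)" for n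
    proof (rule Bochner_Integration.integrable_bound[OF integrable_mult_right[OF A_pair, of 2] h_meas])
      show "AE p in lborel \<Otimes>\<^sub>M mu. norm (case p of (\<xi>, x) \<Rightarrow> h n \<xi> x) \<le> norm (2 * (case p of (\<xi>, x) \<Rightarrow> A \<xi>))"
        by (rule AE_I2) (auto simp: space_pair_measure h_nonneg intro: order_trans[OF h_le abs_ge_self])
    qed
    have h_\<xi>: "integrable lborel (\<lambda>\<xi>. h n \<xi> x)" if "x \<in> space mu" for n x
      unfolding h_def using facts(4)[of "Suc n" x] that z_int by simp
    have h_x: "(\<lambda>x. h n \<xi> x) \<in> borel_measurable mu" for n \<xi>
      unfolding h_def using f_sec[of "Suc n" \<xi>] by simp
    have h_xint: "integrable mu (\<lambda>x. h n \<xi> x)" "integrable mu (\<lambda>x. (h n \<xi> x)\<^sup>2)" for n \<xi>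
    proof -
      show "integrable mu (\<lambda>x. h n \<xi> x)"
        by (rule bounded_integrable[OF h_x, where B = "2 * A \<xi>"]) (use h_le h_nonneg in simp)
      show "integrable mu (\<lambda>x. (h n \<xi> x)\<^sup>2)"
      proof (rule bounded_integrable[where B = "(2 * A \<xi>)\<^sup>2"])
        show "(\<lambda>x. (h n \<xi> x)\<^sup>2) \<in> borel_measurable mu" using h_x[of n \<xi>] by measurable
        show "norm ((h n \<xi> x)\<^sup>2) \<le> (2 * A \<xi>)\<^sup>2" if "x \<in> space mu" for x
          using power_mono[OF h_le[OF that] h_nonneg, of n \<xi> 2] by simp
      qed
    qed
    define Q where "Q n \<xi> = (\<integral>x. h n \<xi> x \<partial>mu)" for n \<xi>
    have Q_lim: "(\<lambda>n. Q n \<xi>) \<longlonglongrightarrow> 0" for \<xi>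
    proof -
      have "(\<lambda>n. 2 * (\<integral>x. (h n \<xi> x)\<^sup>2 \<partial>mu)) \<longlonglongrightarrow> 2 * 0"
        unfolding h_def using LIMSEQ_Suc[OF var_lim[OF that, of \<xi>]] by (intro tendsto_intros)
      then have lim: "(\<lambda>n. 2 * (\<integral>x. (h n \<xi> x)\<^sup>2 \<partial>mu)) \<longlonglongrightarrow> 0" by simp
      have "(Q n \<xi>)\<^sup>2 \<le> 2 * (\<integral>x. (h n \<xi> x)\<^sup>2 \<partial>mu)" for n
        unfolding Q_def by (rule integral_square_le[OF h_xint])
      then have "(\<lambda>n. (Q n \<xi>)\<^sup>2) \<longlonglongrightarrow> 0"
        by (intro real_tendsto_sandwich[OF always_eventually always_eventually tendsto_const lim]) simp_all
      then show ?thesis by simp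
    qed
    have Q_nonneg: "0 \<le> Q n \<xi>" for n \<xi> unfolding Q_def using h_nonneg by simp
    have Q_le: "Q n \<xi> \<le> 4 * A \<xi>" for n \<xi>
    proof -
      have "Q n \<xi> \<le> (\<integral>x. 2 * A \<xi> \<partial>mu)" unfolding Q_def
        by (rule integral_mono) (use h_xint h_le in auto)
      then show ?thesis using mass by simp
    qed
    have Q_meas: "Q n \<in> borel_measurable lborel" for n
      unfolding Q_def[abs_def] using h_meas by (rule borel_measurable_lebesgue_integral)
    have IQ_lim: "(\<lambda>n. \<integral>\<xi>. Q n \<xi> \<partial>lborel) \<longlonglongrightarrow> (\<integral>\<xi>. 0 \<partial>(lborel :: real measure))"
      by (rule integral_dominated_convergence[where w = "\<lambda>\<xi>. 4 * A \<xi>"])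
        (use A_int Q_le Q_nonneg Q_lim Q_meas in auto)
    \<comment> \<open>The deviation at \<open>y\<close> is at most the integral over \<xi> of the
      deviations of the modes, which never exceeds \<open>K\<close>. Replacing one of the two
      factors of the square by \<open>K\<close> leaves a first moment, to which Fubini
      applies.\<close>
    have bound: "(\<integral>x. (norm (u (Suc n) y x (real (Suc n) * \<tau>) - ub / 2))\<^sup>2 \<partial>mu)
        \<le> K / (2 * pi)\<^sup>2 * (\<integral>\<xi>. Q n \<xi> \<partial>lborel)" for n
    proof -
      let ?N = "Suc n"
      let ?d = "\<lambda>x. norm (u ?N y x (real ?N * \<tau>) - ub / 2)"
      have N: "1 \<le> ?N" by simp
      define Px where "Px = (\<lambda>x. \<integral>\<xi>. h n \<xi> x \<partial>lborel)"
      have d_le: "?d x \<le> Px x / (2 * pi)" and Px_le: "Px x \<le> K" and Px_nonneg: "0 \<le> Px x"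
        if x: "x \<in> space mu" for x
      proof -
        have ef: "integrable lborel (\<lambda>\<xi>. e \<xi> * f ?N \<xi> x)"
          by (rule Bochner_Integration.integrable_bound[OF facts(4)[OF N x]])
            (use facts(4)[OF N x] in \<open>auto simp: norm_mult e_norm\<close>)
        have "u ?N y x (real ?N * \<tau>) - ub / 2 = of_real (1 / (2 * pi)) * ((\<integral>\<xi>. e \<xi> * f ?N \<xi> x \<partial>lborel) - (\<integral>\<xi>. e \<xi> * z \<xi> \<partial>lborel) / 2)"
          unfolding facts(5)[OF N x] ub by (simp add: algebra_simps)
        also have "(\<integral>\<xi>. e \<xi> * f ?N \<xi> x \<partial>lborel) - (\<integral>\<xi>. e \<xi> * z \<xi> \<partial>lborel) / 2 = (\<integral>\<xi>. e \<xi> * (f ?N \<xi> x - z \<xi> / 2) \<partial>lborel)"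
          using ef ez_int by (simp add: right_diff_distrib)
        finally have "?d x = 1 / (2 * pi) * norm (\<integral>\<xi>. e \<xi> * (f ?N \<xi> x - z \<xi> / 2) \<partial>lborel)"
          by (simp add: norm_mult norm_divide)
        also have "\<dots> \<le> 1 / (2 * pi) * (\<integral>\<xi>. norm (e \<xi> * (f ?N \<xi> x - z \<xi> / 2)) \<partial>lborel)"
          by (intro mult_left_mono integral_norm_bound) simp
        also have "\<dots> = Px x / (2 * pi)" by (simp add: Px_def h_def norm_mult e_norm)
        finally show "?d x \<le> Px x / (2 * pi)" .
        show "Px x \<le> K" unfolding Px_def K_def
          by (rule integral_mono) (use h_\<xi>[OF x] A_int h_le[OF x] in auto)
        show "0 \<le> Px x" unfolding Px_def using h_nonneg by simp
      qed
      have Px_int: "integrable mu Px"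
        unfolding Px_def using P.integrable_snd[OF h_pair] by simp
      have "(\<integral>x. (?d x)\<^sup>2 \<partial>mu) \<le> (\<integral>x. K / (2 * pi)\<^sup>2 * Px x \<partial>mu)"
      proof (rule integral_mono)
        show "(?d x)\<^sup>2 \<le> K / (2 * pi)\<^sup>2 * Px x" if x: "x \<in> space mu" for x
        proof -
          have "(?d x)\<^sup>2 \<le> (Px x / (2 * pi))\<^sup>2" using d_le[OF x] by (intro power_mono) auto
          also have "\<dots> = Px x * Px x / (2 * pi)\<^sup>2" by (simp add: power2_eq_square)
          also have "\<dots> \<le> K * Px x / (2 * pi)\<^sup>2"
            using Px_le[OF x] Px_nonneg[OF x] by (intro divide_right_mono mult_right_mono) auto
          finally show ?thesis by simp
        qed
        show "integrable mu (\<lambda>x. (?d x)\<^sup>2)"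
        proof (rule bounded_integrable[where B = "(M ?N + norm (ub / 2))\<^sup>2"])
          show "(\<lambda>x. (?d x)\<^sup>2) \<in> borel_measurable mu" using facts(6)[OF N] by measurable
          show "norm ((?d x)\<^sup>2) \<le> (M ?N + norm (ub / 2))\<^sup>2" if x: "x \<in> space mu" for x
          proof -
            have "?d x \<le> M ?N + norm (ub / 2)"
              using facts(7)[OF N x] norm_triangle_ineq4[of "u ?N y x (real ?N * \<tau>)" "ub / 2"] by linarith
            then show ?thesis using power_mono[of "?d x" _ 2] by simp
          qed
        qed
      qed (use Px_int in auto)
      also have "\<dots> = K / (2 * pi)\<^sup>2 * (\<integral>x. Px x \<partial>mu)" by simp
      also have "(\<integral>x. Px x \<partial>mu) = (\<integral>\<xi>. Q n \<xi> \<partial>lborel)"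
        unfolding Px_def Q_def using P.Fubini_integral[OF h_pair] by simp
      finally show ?thesis .
    qed
    have lim: "(\<lambda>n. K / (2 * pi)\<^sup>2 * (\<integral>\<xi>. Q n \<xi> \<partial>lborel)) \<longlonglongrightarrow> 0"
      using tendsto_mult[OF tendsto_const IQ_lim] by simp
    show "(\<lambda>n. \<integral>x. (norm (u (Suc n) y x (real (Suc n) * \<tau>) - ub / 2))\<^sup>2 \<partial>mu) \<longlonglongrightarrow> 0"
      by (rule real_tendsto_sandwich[OF always_eventually always_eventually tendsto_const lim])
        (use bound in simp_all)
  qed
qed

section \<open>Decay of the data and the effective rate\<close>

text \<open>The product of \<open>exp (- \<i> * \<xi> * y)\<close> with
  \<open>g' + \<i> * \<xi> * g\<close> is a primitive of the same exponential times
  \<open>g'' + \<xi>\<^sup>2 * g\<close>, which performs both integrations by parts at once. The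
  transform and \<open>\<xi>\<^sup>2\<close> times it are each bounded by
  \<open>2 * K * (R + 1)\<close>.\<close>

lemma fourier_C2_decay:
  fixes g :: "real \<Rightarrow> complex"
  assumes d1: "\<And>y. (g has_vector_derivative g' y) (at y)"
    and d2: "\<And>y. (g' has_vector_derivative g'' y) (at y)"
    and cont: "continuous_on UNIV g''"
    and supp: "\<And>y. R < \<bar>y\<bar> \<Longrightarrow> g y = 0" and R: "0 \<le> R"
    and K: "\<And>y. \<bar>y\<bar> \<le> R + 1 \<Longrightarrow> norm (g y) \<le> K" "\<And>y. \<bar>y\<bar> \<le> R + 1 \<Longrightarrow> norm (g'' y) \<le> K"
  shows "norm (fourier g \<xi>) \<le> 4 * K * (R + 1) / (1 + \<xi>\<^sup>2)"
proof -
  define r where "r = R + 1"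
  have r: "0 < r" using R by (simp add: r_def)
  let ?I = "indicator {- r..r} :: real \<Rightarrow> real"
  define e where "e = (\<lambda>y. exp (- \<i> * complex_of_real (\<xi> * y)))"
  have e_norm: "norm (e y) = 1" for y by (simp add: e_def)
  have e_cont: "continuous_on S e" for S unfolding e_def by (intro continuous_intros)
  have e_der: "(e has_vector_derivative (- \<i> * of_real \<xi> * e y)) (at y within S)" for y S
  proof -
    have "((\<lambda>y. exp (- \<i> * (complex_of_real \<xi> * of_real y))) has_vector_derivative
      (exp (- \<i> * (complex_of_real \<xi> * of_real y)) * (- \<i> * of_real \<xi>))) (at y within S)"
      by (rule has_vector_derivative_real_field) (auto intro!: derivative_eq_intros)
    then show ?thesis by (simp add: e_def mult_ac)
  qed
  have g_cont: "continuous_on S g" and g'_cont: "continuous_on S g'" for S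
    using d1 d2 by (meson continuous_on_vector_derivative has_vector_derivative_at_within)+
  have g'0: "g' y = 0" if "R < \<bar>y\<bar>" for y
  proof -
    have "(g has_vector_derivative 0) (at y)"
    proof (rule has_vector_derivative_transform_within_open[where f = "\<lambda>y. 0" and S = "{y. R < \<bar>y\<bar>}"])
      show "open {y::real. R < \<bar>y\<bar>}" by (intro open_Collect_less continuous_intros)
    qed (use that supp in auto)
    then show ?thesis using d1 vector_derivative_unique_at by blast
  qed
  have cg: "continuous_on {- r..r} (\<lambda>y. e y * g y)" and cg2: "continuous_on {- r..r} (\<lambda>y. e y * g'' y)"
    by (intro continuous_on_mult e_cont g_cont continuous_on_subset[OF cont] subset_UNIV)+
  have ig: "integrable lborel (\<lambda>y. ?I y *\<^sub>R (e y * g y))" and ig2: "integrable lborel (\<lambda>y. ?I y *\<^sub>R (e y * g'' y))"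
    using borel_integrable_compact[OF compact_Icc cg] borel_integrable_compact[OF compact_Icc cg2]
    by (simp_all add: indicator_scaleR_eq_if)
  have Ig: "(\<integral>y. ?I y *\<^sub>R (e y * g y) \<partial>lborel) = fourier g \<xi>"
    unfolding fourier_def
    by (rule Bochner_Integration.integral_cong) (use supp in \<open>auto simp: indicator_def e_def r_def\<close>)
  have "(\<integral>y. ?I y *\<^sub>R (e y * g'' y + of_real (\<xi>\<^sup>2) * (e y * g y)) \<partial>lborel)
      = e r * (g' r + \<i> * of_real \<xi> * g r) - e (- r) * (g' (- r) + \<i> * of_real \<xi> * g (- r))"
  proof (rule integral_FTC_Icc[where F = "\<lambda>y. e y * (g' y + \<i> * of_real \<xi> * g y)"])
    show "((\<lambda>y. e y * (g' y + \<i> * of_real \<xi> * g y)) has_vector_derivative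
        e y * g'' y + of_real (\<xi>\<^sup>2) * (e y * g y)) (at y within {- r..r})" for y
    proof -
      have "((\<lambda>y. g' y + \<i> * of_real \<xi> * g y) has_vector_derivative g'' y + \<i> * of_real \<xi> * g' y) (at y within {- r..r})"
        by (intro has_vector_derivative_add has_vector_derivative_mult_right
            has_vector_derivative_at_within[OF d1] has_vector_derivative_at_within[OF d2])
      from has_vector_derivative_mult[OF e_der this] show ?thesis
        by (simp add: algebra_simps power2_eq_square)
    qed
  qed (use r cg cg2 in \<open>auto intro!: continuous_intros\<close>)
  also have "\<dots> = 0" using supp[of r] supp[of "- r"] g'0[of r] g'0[of "- r"] R by (simp add: r_def)
  finally have zero: "(\<integral>y. ?I y *\<^sub>R (e y * g'' y + of_real (\<xi>\<^sup>2) * (e y * g y)) \<partial>lborel) = 0" .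
  have "(\<integral>y. ?I y *\<^sub>R (e y * g'' y + of_real (\<xi>\<^sup>2) * (e y * g y)) \<partial>lborel)
      = (\<integral>y. ?I y *\<^sub>R (e y * g'' y) + of_real (\<xi>\<^sup>2) * (?I y *\<^sub>R (e y * g y)) \<partial>lborel)"
    by (intro Bochner_Integration.integral_cong) (auto simp: algebra_simps)
  also have "\<dots> = (\<integral>y. ?I y *\<^sub>R (e y * g'' y) \<partial>lborel) + of_real (\<xi>\<^sup>2) * fourier g \<xi>"
    using ig ig2 by (simp only: Ig Bochner_Integration.integral_add integrable_mult_right integral_mult_right_zero)
  finally have two: "of_real (\<xi>\<^sup>2) * fourier g \<xi> = - (\<integral>y. ?I y *\<^sub>R (e y * g'' y) \<partial>lborel)"
    unfolding zero by (simp add: eq_neg_iff_add_eq_0 add.commute)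
  have bnd: "norm (\<integral>y. ?I y *\<^sub>R (e y * h y) \<partial>lborel) \<le> 2 * K * r"
    if "integrable lborel (\<lambda>y. ?I y *\<^sub>R (e y * h y))" "\<And>y. \<bar>y\<bar> \<le> r \<Longrightarrow> norm (h y) \<le> K" for h :: "real \<Rightarrow> complex"
  proof -
    have "norm (\<integral>y. ?I y *\<^sub>R (e y * h y) \<partial>lborel) \<le> (\<integral>y. K * ?I y \<partial>lborel)"
    proof (rule order_trans[OF integral_norm_bound], rule integral_mono)
      show "integrable lborel (\<lambda>y. norm (?I y *\<^sub>R (e y * h y)))" by (rule integrable_norm[OF that(1)])
      show "integrable lborel (\<lambda>y. K * ?I y)"
        by (intro integrable_mult_right integrable_real_indicator) (auto simp: emeasure_lborel_Icc_eq)
    qed (use that(2) in \<open>auto simp: norm_mult e_norm abs_le_iff split: split_indicator\<close>)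
    then show ?thesis using r by (simp add: mult_ac)
  qed
  have "norm (fourier g \<xi>) \<le> 2 * K * r"
    unfolding Ig[symmetric] by (intro bnd ig K) (auto simp: r_def)
  moreover have "norm (of_real (\<xi>\<^sup>2) * fourier g \<xi>) \<le> 2 * K * r"
    unfolding two norm_minus_cancel by (intro bnd ig2 K) (auto simp: r_def)
  moreover have "(1 + \<xi>\<^sup>2) * norm (fourier g \<xi>) = norm (fourier g \<xi>) + norm (of_real (\<xi>\<^sup>2) * fourier g \<xi>)"
    by (simp add: norm_mult algebra_simps norm_power)
  ultimately have "(1 + \<xi>\<^sup>2) * norm (fourier g \<xi>) \<le> 2 * K * r + 2 * K * r" by linarith
  then have "norm (fourier g \<xi>) * (1 + \<xi>\<^sup>2) \<le> 4 * K * (R + 1)" by (simp add: r_def algebra_simps)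
  then show ?thesis by (simp add: pos_le_divide_eq add_pos_nonneg)
qed

text \<open>Iterated derivatives in direction \<open>(1, 0)\<close> are the derivatives in
  \<open>y\<close>; they are continuous in both variables, hence bounded on a compact rectangle.
  This makes the constant uniform in \<open>k\<close>, as the maximum principle at each frequency
  requires.\<close>

lemma test_function_decay:
  assumes "test_function f"
  obtains R A where "0 \<le> R" "\<And>y k. R < \<bar>y\<bar> \<Longrightarrow> f y k = 0"
    "\<And>k \<xi>. \<bar>k\<bar> \<le> 1 / 2 \<Longrightarrow> norm (fourier (\<lambda>y. f y k) \<xi>) \<le> A / (1 + \<xi>\<^sup>2)"
proof -
  define h where "h = (\<lambda>(y, k). f y k)"
  define h1 where "h1 = (\<lambda>p. frechet_derivative h (at p) (1, 0))"
  define h2 where "h2 = (\<lambda>p. frechet_derivative h1 (at p) (1, 0))"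
  have "times_differentiable 2 h" "times_differentiable 0 h"
    using assms unfolding test_function_def smooth_def h_def by auto
  then have diff: "h differentiable at p" "h1 differentiable at p"
    and cont: "continuous_on UNIV h" "continuous_on UNIV h2" for p
    unfolding h1_def h2_def by (simp_all only: numeral_2_eq_2 times_differentiable.simps)
  have slice: "((\<lambda>y. H (y, k)) has_vector_derivative frechet_derivative H (at (y, k)) (1, 0)) (at y)"
    if "H differentiable at (y, k)" for H :: "real \<times> real \<Rightarrow> complex" and y k
  proof -
    have "(H has_derivative frechet_derivative H (at (y, k))) (at (y, k))"
      using that by (simp add: frechet_derivative_works)
    moreover have "((\<lambda>y. (y, k)) has_derivative (\<lambda>d. (d, 0))) (at y)"
      by (auto intro!: derivative_eq_intros)
    ultimately have D: "((\<lambda>y. H (y, k)) has_derivative (\<lambda>d. frechet_derivative H (at (y, k)) (d, 0))) (at y)"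
      using has_derivative_compose[of "\<lambda>y. (y, k)" "\<lambda>d. (d, 0)" y UNIV H "frechet_derivative H (at (y, k))"] by simp
    have "linear (frechet_derivative H (at (y, k)))" by (rule linear_frechet_derivative[OF that])
    then have "(\<lambda>d. frechet_derivative H (at (y, k)) (d, 0)) = (\<lambda>d. d *\<^sub>R frechet_derivative H (at (y, k)) (1, 0))"
    proof (intro ext)
      fix d :: real
      have "(d, 0) = d *\<^sub>R (1 :: real, 0 :: real)" by simp
      then show "frechet_derivative H (at (y, k)) (d, 0) = d *\<^sub>R frechet_derivative H (at (y, k)) (1, 0)"
        using linear_scale[OF \<open>linear _\<close>, of d "(1, 0)"] by (simp only:)
    qed
    with D show ?thesis by (simp only: has_vector_derivative_def)
  qed
  have "bounded {y. \<exists>k. f y k \<noteq> 0}" using assms by (simp add: test_function_def)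
  then obtain R0 where R0: "\<And>y k. f y k \<noteq> 0 \<Longrightarrow> \<bar>y\<bar> \<le> R0" by (auto simp: bounded_iff)
  define R where "R = max R0 0"
  have R: "0 \<le> R" "R < \<bar>y\<bar> \<Longrightarrow> f y k = 0" for y k using R0[of y k] by (auto simp: R_def)
  define S where "S = {- (R + 1)..R + 1} \<times> {- (1 / 2)..1 / 2 :: real}"
  have S: "compact S" by (simp add: S_def compact_Times)
  have "bounded (h ` S)" "bounded (h2 ` S)"
    by (intro compact_imp_bounded compact_continuous_image S continuous_on_subset[OF cont(1)]
        continuous_on_subset[OF cont(2)] subset_UNIV)+
  then obtain K1 K2 where K1: "\<And>p. p \<in> S \<Longrightarrow> norm (h p) \<le> K1" and K2: "\<And>p. p \<in> S \<Longrightarrow> norm (h2 p) \<le> K2"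
    by (auto simp: bounded_iff)
  define K where "K = max K1 K2"
  show ?thesis
  proof (rule that[of R "4 * K * (R + 1)"])
    fix k \<xi> :: real assume "\<bar>k\<bar> \<le> 1 / 2"
    then have k: "- (1 / 2) \<le> k" "k \<le> 1 / 2" by linarith+
    show "norm (fourier (\<lambda>y. f y k) \<xi>) \<le> 4 * K * (R + 1) / (1 + \<xi>\<^sup>2)"
    proof (rule fourier_C2_decay[where g' = "\<lambda>y. h1 (y, k)" and g'' = "\<lambda>y. h2 (y, k)"])
      show "((\<lambda>y. f y k) has_vector_derivative h1 (y, k)) (at y)" for y
        using slice[OF diff(1)] by (simp add: h1_def h_def)
      show "((\<lambda>y. h1 (y, k)) has_vector_derivative h2 (y, k)) (at y)" for y
        using slice[OF diff(2)] by (simp add: h2_def)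
      show "continuous_on UNIV (\<lambda>y. h2 (y, k))"
        by (rule continuous_on_compose2[OF cont(2)]) (auto intro!: continuous_intros)
      show "norm (f y k) \<le> K" if "\<bar>y\<bar> \<le> R + 1" for y
        using K1[of "(y, k)"] that k
        by (intro order_trans[OF _ max.cobounded1[of K1 K2, folded K_def]]) (auto simp: S_def h_def abs_le_iff)
      show "norm (h2 (y, k)) \<le> K" if "\<bar>y\<bar> \<le> R + 1" for y
        using K2[of "(y, k)"] that k
        by (intro order_trans[OF _ max.cobounded2[of K2 K1, folded K_def]]) (auto simp: S_def abs_le_iff)
    qed (use R in auto)
  qed (use R in auto)
qed

section \<open>Scattering rates near wave number zero\<close>

text \<open>Jordan's inequality: a concave function lies above its chord.\<close>

lemma jordan_sin: assumes "\<bar>k\<bar> \<le> 1 / 2" shows "2 * \<bar>k\<bar> \<le> \<bar>sin (pi * k)\<bar>"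
proof -
  have conc: "concave_on {0..1/2} (\<lambda>k. sin (pi * k))"
  proof (rule f''_le0_imp_concave)
    show "((\<lambda>k. sin (pi * k)) has_real_derivative pi * cos (pi * k)) (at k)" for k
      by (auto intro!: derivative_eq_intros)
    show "((\<lambda>k. pi * cos (pi * k)) has_real_derivative - (pi\<^sup>2 * sin (pi * k))) (at k)" for k
      by (auto intro!: derivative_eq_intros simp: power2_eq_square)
    show "- (pi\<^sup>2 * sin (pi * k)) \<le> 0" if "k \<in> {0..1/2}" for k
      using that by (auto intro!: mult_nonneg_nonneg sin_ge_zero simp: mult_le_cancel_left1)
  qed auto
  have pos: "2 * k \<le> sin (pi * k)" if "0 \<le> k" "k \<le> 1 / 2" for k
    using concave_onD[OF conc, of "2 * k" 0 "1/2"] that by simp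
  show ?thesis using pos[of "\<bar>k\<bar>"] assms by (cases "0 \<le> k") auto
qed

text \<open>With \<open>S\<close> for the square root, this is \<open>8 * \<gamma>\<close> times the
  squared sine times \<open>(S - b) / (2 * S)\<close>. Writing \<open>S - b\<close> as four squared
  sines over \<open>S + b\<close> exposes the fourth power; in \<open>fast_rate\<close> the factor
  is \<open>S + b\<close> and the sine stays squared.\<close>

definition slow_rate :: "real \<Rightarrow> real \<Rightarrow> real \<Rightarrow> real" where
  "slow_rate \<gamma> b k = 16 * \<gamma> * sin (pi * k) ^ 4 /
     (sqrt (4 * (sin (pi * k))\<^sup>2 + b\<^sup>2) * (sqrt (4 * (sin (pi * k))\<^sup>2 + b\<^sup>2) + b))"

definition fast_rate :: "real \<Rightarrow> real \<Rightarrow> real \<Rightarrow> real" where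
  "fast_rate \<gamma> b k = 4 * \<gamma> * (sin (pi * k))\<^sup>2 *
     (sqrt (4 * (sin (pi * k))\<^sup>2 + b\<^sup>2) + b) / sqrt (4 * (sin (pi * k))\<^sup>2 + b\<^sup>2)"

text \<open>With \<open>b = \<bar>B\<bar> / 2\<close> this is the derivative of the dispersion
  relation divided by \<open>2 * pi\<close>.\<close>

definition velocity :: "real \<Rightarrow> real \<Rightarrow> real" where
  "velocity b k = sin (2 * pi * k) / sqrt (4 * (sin (pi * k))\<^sup>2 + b\<^sup>2)"

definition limit_integral :: real where
  "limit_integral = (\<integral>s. s ^ 4 / (1 + s ^ 6) \<partial>lborel)"

text \<open>The leading coefficient of \<open>slow_rate\<close> in \<open>k^4\<close> at 0, namely
  \<open>16 * \<gamma> * pi ^ 4\<close> over \<open>b * (b + b)\<close>.\<close>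

definition slow_coeff :: "real \<Rightarrow> real \<Rightarrow> real" where
  "slow_coeff \<gamma> b = 8 * \<gamma> * pi ^ 4 / b\<^sup>2"

text \<open>Produces an integrable majorant from one bound that is good near \<open>q = 0\<close>
  and one that is good at infinity.\<close>

lemma inverse_quadratic_bound:
  fixes q X Y :: real
  assumes "0 \<le> X" "0 \<le> Y" "r \<le> X * q ^ 4" "r * q\<^sup>2 \<le> Y"
  shows "r \<le> 2 * (X + Y) / (1 + q\<^sup>2)"
proof (cases "q\<^sup>2 \<le> 1")
  case True
  have "r * (1 + q\<^sup>2) \<le> 2 * (X + Y)"
  proof -
    have "q ^ 4 \<le> 1" using power_mono[OF True, of 2] by (simp flip: power_mult)
    then have "X * q ^ 4 \<le> X * 1" using assms by (intro mult_left_mono) auto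
    then have "r \<le> X" using assms by simp
    then show ?thesis using assms by (simp add: algebra_simps)
  qed
  then show ?thesis by (simp add: pos_le_divide_eq add_pos_nonneg)
next
  case False
  have "r * (1 + q\<^sup>2) \<le> 2 * (X + Y)"
  proof (cases "0 \<le> r")
    case True
    have "r * 1 \<le> r * q\<^sup>2" using True False by (intro mult_left_mono) auto
    then show ?thesis using assms by (simp add: algebra_simps)
  next
    case neg: False
    have "r * (1 + q\<^sup>2) \<le> 0" using neg by (intro mult_nonpos_nonneg) auto
    also have "0 \<le> 2 * (X + Y)" using assms by simp
    finally show ?thesis .
  qed
  then show ?thesis by (simp add: pos_le_divide_eq add_pos_nonneg)
qed

lemma limit_integrand_integrable: "integrable lborel (\<lambda>s::real. s ^ 4 / (1 + s ^ 6))"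
proof (rule Bochner_Integration.integrable_bound[OF inverse_quadratic_integrable[of 4]])
  have "s ^ 4 / (1 + s ^ 6) \<le> 2 * (1 + 1) / (1 + s\<^sup>2)" for s :: real
  proof (rule inverse_quadratic_bound)
    have p: "0 < 1 + s ^ 6" by (intro add_pos_nonneg) auto
    have "s ^ 4 * 1 \<le> s ^ 4 * (1 + s ^ 6)" by (intro mult_left_mono) auto
    then show "s ^ 4 / (1 + s ^ 6) \<le> 1 * s ^ 4" using p by (simp add: pos_divide_le_eq)
    show "s ^ 4 / (1 + s ^ 6) * s\<^sup>2 \<le> 1" using p by (simp add: pos_divide_le_eq flip: power_add)
  qed auto
  then show "AE s in lborel. norm (s ^ 4 / (1 + s ^ 6)) \<le> norm (4 / (1 + s\<^sup>2 :: real))"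
    by (intro AE_I2) simp
qed auto

text \<open>The integrand is nonnegative and vanishes only at 0, so a zero integral would make
  Lebesgue measure trivial.\<close>

lemma limit_integral_pos: "0 < limit_integral"
proof -
  have "limit_integral \<noteq> 0"
  proof
    assume "limit_integral = 0"
    then have "AE s in lborel. (s::real) ^ 4 / (1 + s ^ 6) = 0"
      unfolding limit_integral_def
      using integral_nonneg_eq_0_iff_AE[OF limit_integrand_integrable] by simp
    moreover have "(s::real) ^ 4 / (1 + s ^ 6) = 0 \<longleftrightarrow> s = 0" for s
      using zero_le_even_power[of 6 s] by (auto simp: add_nonneg_eq_0_iff)
    ultimately have "AE s in lborel. (s::real) = 0" by simp
    with AE_lborel_singleton[of "0::real"] have "AE s in (lborel :: real measure). False"
      by eventually_elim simp
    then have "ae_filter (lborel :: real measure) = bot" by (simp add: trivial_limit_def)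
    then show False by (simp add: ae_filter_eq_bot_iff)
  qed
  moreover have "0 \<le> limit_integral" unfolding limit_integral_def by simp
  ultimately show ?thesis by simp
qed

text \<open>Substituting \<open>q = m * s\<close> with
  \<open>m ^ 3 = \<bar>\<xi>\<bar> * V / L\<close> balances the two terms of the denominator. What
  comes out is \<open>m ^ 5 * L\<close>, and this fixes all three exponents.\<close>

lemma scaled_limit_integral:
  assumes L: "0 < L" and V: "0 < V"
  shows "(\<integral>q. q ^ 4 * L * (\<xi> * V)\<^sup>2 / (q ^ 6 * L\<^sup>2 + (\<xi> * V)\<^sup>2) \<partial>lborel)
    = limit_integral * (V powr (5/3) * L powr (-2/3)) * \<bar>\<xi>\<bar> powr (5/3)"
proof (cases "\<xi> = 0")
  case False
  define m where "m = (\<bar>\<xi>\<bar> * V / L) powr (1/3)"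
  have m: "0 < m" using False L V by (simp add: m_def)
  have m3: "m ^ 3 = \<bar>\<xi>\<bar> * V / L"
    using False L V by (simp add: m_def powr_powr flip: powr_realpow)
  have W: "(\<xi> * V)\<^sup>2 = m ^ 6 * L\<^sup>2"
  proof -
    have "m ^ 6 = (m ^ 3)\<^sup>2" by (simp flip: power_mult)
    then show ?thesis using m3 L by (simp add: power_mult_distrib power_divide)
  qed
  have "(\<integral>q. q ^ 4 * L * (\<xi> * V)\<^sup>2 / (q ^ 6 * L\<^sup>2 + (\<xi> * V)\<^sup>2) \<partial>lborel)
      = m * (\<integral>s. (0 + m * s) ^ 4 * L * (\<xi> * V)\<^sup>2 / ((0 + m * s) ^ 6 * L\<^sup>2 + (\<xi> * V)\<^sup>2) \<partial>lborel)"
    using m by (subst lborel_integral_real_affine[of m _ 0]) auto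
  also have "\<dots> = m * (\<integral>s. (m ^ 4 * L) * (s ^ 4 / (1 + s ^ 6)) \<partial>lborel)"
  proof -
    have "(0 + m * s) ^ 4 * L * (\<xi> * V)\<^sup>2 / ((0 + m * s) ^ 6 * L\<^sup>2 + (\<xi> * V)\<^sup>2) = (m ^ 4 * L) * (s ^ 4 / (1 + s ^ 6))" for s
    proof -
      have "(0 + m * s) ^ 4 * L * (\<xi> * V)\<^sup>2 = (m ^ 6 * L\<^sup>2) * ((m ^ 4 * L) * s ^ 4)"
        unfolding W by (simp add: power_mult_distrib mult_ac)
      moreover have "(0 + m * s) ^ 6 * L\<^sup>2 + (\<xi> * V)\<^sup>2 = (m ^ 6 * L\<^sup>2) * (1 + s ^ 6)"
        unfolding W by (simp add: power_mult_distrib algebra_simps)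
      moreover have "m ^ 6 * L\<^sup>2 \<noteq> 0" using m L by simp
      ultimately show ?thesis
        by (simp only: mult_divide_mult_cancel_left times_divide_eq_right simp_thms)
    qed
    then show ?thesis by simp
  qed
  also have "(\<integral>s. (m ^ 4 * L) * (s ^ 4 / (1 + s ^ 6)) \<partial>lborel) = m ^ 4 * L * limit_integral"
    unfolding limit_integral_def by (rule integral_mult_right_zero)
  also have "m * \<dots> = m ^ 5 * L * limit_integral"
    by (simp add: power_numeral_reduce mult_ac)
  also have "m ^ 5 = (\<bar>\<xi>\<bar> * V / L) powr (5/3)"
    using False L V by (simp add: m_def powr_powr flip: powr_realpow)
  also have "\<dots> * L = V powr (5/3) * L powr (-2/3) * \<bar>\<xi>\<bar> powr (5/3)"
  proof -
    have "L powr (-5/3) * L powr 1 = L powr (-2/3)" unfolding powr_add[symmetric] by simp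
    then have Lp: "L / L powr (5/3) = L powr (-2/3)" using L by (simp add: powr_minus field_simps)
    have "(\<bar>\<xi>\<bar> * V / L) powr (5/3) * L = \<bar>\<xi>\<bar> powr (5/3) * V powr (5/3) * (L / L powr (5/3))"
      using L V by (simp add: powr_mult powr_divide)
    then show ?thesis unfolding Lp by (simp only: mult_ac)
  qed
  finally show ?thesis by (simp add: mult_ac)
qed simp

text \<open>
  \<open>slow_rate\<close> vanishes like \<open>k\<^sup>4\<close> while \<open>velocity\<close> is linear in \<open>k\<close>; after the substitution
  \<open>k = \<theta> * q\<close> the integrand has a nontrivial limit, and this is where the exponent \<open>5/3\<close>
  comes from. Below, \<open>\<theta>\<close> is \<open>N powr (-1/5)\<close>.
\<close>

lemma slow_rate_limit:
  assumes \<gamma>: "0 < \<gamma>" and b: "0 < b" and \<theta>: "\<theta> \<longlonglongrightarrow> 0" "\<And>n. 0 < \<theta> n"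
  shows "(\<lambda>n. (1 / \<theta> n ^ 5) * (\<integral>k. indicator torus k *
      (slow_rate \<gamma> b k * (\<xi> * (\<theta> n ^ 3 * velocity b k))\<^sup>2 /
        ((slow_rate \<gamma> b k)\<^sup>2 + (\<xi> * (\<theta> n ^ 3 * velocity b k))\<^sup>2)) \<partial>lborel))
    \<longlonglongrightarrow> (\<integral>q. q ^ 4 * slow_coeff \<gamma> b * (\<xi> * (2 * pi / b))\<^sup>2 /
        (q ^ 6 * (slow_coeff \<gamma> b)\<^sup>2 + (\<xi> * (2 * pi / b))\<^sup>2) \<partial>lborel)"
proof -
  \<comment> \<open>The value at 0 makes \<open>sinc\<close> continuous there. Dividing
    \<open>slow_rate\<close> by \<open>k^4\<close> and \<open>velocity\<close> by \<open>k\<close>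
    then leaves \<open>l\<close> and \<nu>, which have positive finite limits at 0.\<close>
  define sinc where "sinc = (\<lambda>k. if k = 0 then pi else sin (pi * k) / k)"
  define S where "S = (\<lambda>k. sqrt (4 * (sin (pi * k))\<^sup>2 + b\<^sup>2))"
  define l where "l = (\<lambda>k. 16 * \<gamma> * sinc k ^ 4 / (S k * (S k + b)))"
  define \<nu> where "\<nu> = (\<lambda>k. 2 * sinc k * cos (pi * k) / S k)"
  \<comment> \<open>At \<open>k = t * q\<close> a common factor \<open>t ^ 8 * q\<^sup>2\<close>
    cancels and the integrand is \<open>t ^ 4 * G q k\<close>; the Jacobian supplies the fifth power
    of \<open>t\<close>.\<close>
  define G where "G = (\<lambda>q k. q ^ 4 * l k * (\<xi> * \<nu> k)\<^sup>2 / (q ^ 6 * (l k)\<^sup>2 + (\<xi> * \<nu> k)\<^sup>2))"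
  have sin_eq: "sin (pi * k) = k * sinc k" for k by (simp add: sinc_def)
  have S_ge: "b \<le> S k" for k unfolding S_def by (rule real_le_rsqrt) simp
  have S_pos: "0 < S k" for k using S_ge[of k] b by linarith
  define S1 where "S1 = sqrt (4 + b\<^sup>2)"
  have S_le: "S k \<le> S1" for k
    unfolding S_def S1_def using abs_sin_le_one[of "pi * k"] by (intro real_sqrt_le_mono) (simp add: abs_square_le_1)
  have slow_l: "slow_rate \<gamma> b k = k ^ 4 * l k" for k
    by (simp add: slow_rate_def l_def S_def sin_eq power_mult_distrib mult_ac)
  have vel_\<nu>: "velocity b k = k * \<nu> k" for k
  proof -
    have "sin (2 * pi * k) = 2 * sin (pi * k) * cos (pi * k)"
      using sin_double[of "pi * k"] by (simp add: mult_ac)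
    then show ?thesis by (simp add: velocity_def \<nu>_def S_def sin_eq mult_ac)
  qed
  have sinc_le: "\<bar>sinc k\<bar> \<le> pi" for k
    using abs_sin_x_le_abs_x[of "pi * k"] by (auto simp: sinc_def abs_mult pos_divide_le_eq)
  have sinc_ge: "2 \<le> \<bar>sinc k\<bar>" if "\<bar>k\<bar> \<le> 1 / 2" for k
    using jordan_sin[OF that] pi_ge_two by (auto simp: sinc_def pos_le_divide_eq)
  have sinc_lim: "sinc \<midarrow>0\<rightarrow> pi"
  proof -
    have "((\<lambda>k. sin (pi * k)) has_real_derivative pi) (at 0)"
      by (auto intro!: derivative_eq_intros)
    then have "(\<lambda>k. sin (pi * k) / k) \<midarrow>0\<rightarrow> pi" by (simp add: DERIV_def)
    then show ?thesis by (rule Lim_transform_eventually) (auto simp: sinc_def eventually_at_filter)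
  qed
  \<comment> \<open>Jordan's inequality gives \<open>\<bar>sinc k\<bar> \<ge> 2\<close> on the
    torus, so 256 is 16 times the fourth power of 2.\<close>
  define l0 where "l0 = 256 * \<gamma> / (S1 * (S1 + b))"
  define l1 where "l1 = 16 * \<gamma> * pi ^ 4 / (b * b)"
  define \<nu>1 where "\<nu>1 = 2 * pi / b"
  have S1_pos: "0 < S1" using S_pos[of 0] S_le[of 0] by linarith
  have l0_pos: "0 < l0" using \<gamma> b S1_pos by (simp add: l0_def)
  have l_ge: "l0 \<le> l k" if "\<bar>k\<bar> \<le> 1 / 2" for k
  proof -
    have "16 \<le> sinc k ^ 4" using power_mono[OF sinc_ge[OF that], of 4] by (simp add: power_even_abs)
    then have "16 * \<gamma> * 16 \<le> 16 * \<gamma> * sinc k ^ 4" using \<gamma> by (intro mult_left_mono) auto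
    moreover have "S k * (S k + b) \<le> S1 * (S1 + b)"
      using S_le[of k] S_pos[of k] b by (intro mult_mono) auto
    ultimately show ?thesis unfolding l0_def l_def using S_pos[of k] b \<gamma>
      by (intro frac_le) (auto intro!: mult_pos_pos)
  qed
  have l_nonneg: "0 \<le> l k" for k unfolding l_def using \<gamma> S_pos[of k] b by (auto intro!: divide_nonneg_nonneg mult_nonneg_nonneg)
  have l_le: "l k \<le> l1" for k
  proof -
    have "sinc k ^ 4 \<le> pi ^ 4" using power_mono[OF sinc_le, of k 4] by (simp add: power_even_abs)
    then have "16 * \<gamma> * sinc k ^ 4 \<le> 16 * \<gamma> * pi ^ 4" using \<gamma> by (intro mult_left_mono) auto
    moreover have "b * b \<le> S k * (S k + b)" using S_ge[of k] b by (intro mult_mono) auto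
    ultimately show ?thesis unfolding l1_def l_def using b \<gamma> by (intro frac_le) auto
  qed
  have \<nu>_le: "(\<nu> k)\<^sup>2 \<le> \<nu>1\<^sup>2" for k
  proof -
    have "\<bar>\<nu> k\<bar> = 2 * \<bar>sinc k\<bar> * \<bar>cos (pi * k)\<bar> / S k" using S_pos[of k] by (simp add: \<nu>_def abs_mult)
    also have "\<dots> \<le> 2 * pi * 1 / b"
      using sinc_le[of k] S_ge[of k] b by (intro frac_le mult_mono) auto
    finally have "\<bar>\<nu> k\<bar> \<le> \<nu>1" by (simp add: \<nu>1_def)
    then show ?thesis using power_mono[of "\<bar>\<nu> k\<bar>" \<nu>1 2] by simp
  qed
  have G_nonneg: "0 \<le> G q k" for q k unfolding G_def using l_nonneg by (auto intro!: divide_nonneg_nonneg mult_nonneg_nonneg)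
  \<comment> \<open>Dropping the first term of the denominator gives growth of order
    \<open>q ^ 4\<close>, dropping the second gives decay of order \<open>1 / q\<^sup>2\<close>. The
    decay needs \<open>l\<close> bounded below, hence the restriction on \<open>k\<close>.\<close>
  have G_le: "G q k \<le> 2 * (l1 + \<xi>\<^sup>2 * \<nu>1\<^sup>2 / l0) / (1 + q\<^sup>2)" if k: "\<bar>k\<bar> \<le> 1 / 2" for q k
  proof (rule inverse_quadratic_bound)
    have l: "0 < l k" using l_ge[OF k] l0_pos by linarith
    let ?D = "q ^ 6 * (l k)\<^sup>2 + (\<xi> * \<nu> k)\<^sup>2"
    have D: "0 \<le> ?D" by simp
    show "0 \<le> l1" using l_nonneg[of 0] l_le[of 0] by linarith
    show "0 \<le> \<xi>\<^sup>2 * \<nu>1\<^sup>2 / l0" using l0_pos by simp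
    have "G q k \<le> q ^ 4 * l k"
    proof -
      have "(q ^ 4 * l k) * (\<xi> * \<nu> k)\<^sup>2 \<le> (q ^ 4 * l k) * ?D" using l by (intro mult_left_mono) auto
      moreover have "?D = 0 \<or> 0 < ?D" using D by (simp only: le_less) auto
      moreover have "0 \<le> q ^ 4 * l k" using l by simp
      ultimately show ?thesis unfolding G_def by (metis div_by_0 pos_divide_le_eq)
    qed
    also have "\<dots> \<le> l1 * q ^ 4" using mult_right_mono[OF l_le[of k], of "q ^ 4"] by (simp add: mult.commute)
    finally show "G q k \<le> l1 * q ^ 4" .
    have "G q k * q\<^sup>2 \<le> (\<xi> * \<nu> k)\<^sup>2 / l k"
    proof (cases "?D = 0")
      case False
      have "q ^ 6 * (l k)\<^sup>2 * (\<xi> * \<nu> k)\<^sup>2 \<le> ?D * (\<xi> * \<nu> k)\<^sup>2" by (intro mult_right_mono) auto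
      moreover have "q ^ 4 * l k * (\<xi> * \<nu> k)\<^sup>2 * q\<^sup>2 * l k = q ^ 6 * (l k)\<^sup>2 * (\<xi> * \<nu> k)\<^sup>2"
        by (simp add: power_numeral_reduce mult_ac)
      moreover have "0 < ?D" using D False by linarith
      ultimately have "q ^ 4 * l k * (\<xi> * \<nu> k)\<^sup>2 * q\<^sup>2 * l k / ?D \<le> (\<xi> * \<nu> k)\<^sup>2"
        by (simp only: pos_divide_le_eq mult.commute)
      then show ?thesis using l by (simp add: G_def pos_le_divide_eq)
    qed (use l in \<open>simp add: G_def\<close>)
    also have "\<dots> \<le> \<xi>\<^sup>2 * \<nu>1\<^sup>2 / l0"
      using l_ge[OF k] l0_pos \<nu>_le[of k] by (auto simp: power_mult_distrib intro!: frac_le mult_left_mono)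
    finally show "G q k * q\<^sup>2 \<le> \<xi>\<^sup>2 * \<nu>1\<^sup>2 / l0" .
  qed
  have scale: "(1 / t ^ 5) * (\<integral>k. indicator torus k *
      (slow_rate \<gamma> b k * (\<xi> * (t ^ 3 * velocity b k))\<^sup>2 /
        ((slow_rate \<gamma> b k)\<^sup>2 + (\<xi> * (t ^ 3 * velocity b k))\<^sup>2)) \<partial>lborel)
      = (\<integral>q. indicator torus (t * q) * G q (t * q) \<partial>lborel)" if t: "0 < t" for t
  proof -
    have pt: "slow_rate \<gamma> b (t * q) * (\<xi> * (t ^ 3 * velocity b (t * q)))\<^sup>2 /
        ((slow_rate \<gamma> b (t * q))\<^sup>2 + (\<xi> * (t ^ 3 * velocity b (t * q)))\<^sup>2) = t ^ 4 * G q (t * q)" for q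
    proof (cases "q = 0")
      case True
      then show ?thesis by (simp add: slow_l G_def)
    next
      case False
      let ?l = "l (t * q)" and ?n = "\<nu> (t * q)"
      have "slow_rate \<gamma> b (t * q) * (\<xi> * (t ^ 3 * velocity b (t * q)))\<^sup>2
          = (t ^ 8 * q\<^sup>2) * (t ^ 4 * (q ^ 4 * ?l * (\<xi> * ?n)\<^sup>2))"
        unfolding slow_l vel_\<nu> by (simp add: power_mult_distrib power_numeral_reduce mult_ac)
      moreover have "(slow_rate \<gamma> b (t * q))\<^sup>2 + (\<xi> * (t ^ 3 * velocity b (t * q)))\<^sup>2
          = (t ^ 8 * q\<^sup>2) * (q ^ 6 * ?l\<^sup>2 + (\<xi> * ?n)\<^sup>2)"
        unfolding slow_l vel_\<nu> by (simp add: power_mult_distrib power_numeral_reduce algebra_simps)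
      moreover have "t ^ 8 * q\<^sup>2 \<noteq> 0" using t False by simp
      ultimately show ?thesis unfolding G_def
        by (simp only: mult_divide_mult_cancel_left times_divide_eq_right simp_thms)
    qed
    have "(1 / t ^ 5) * (\<integral>k. indicator torus k *
        (slow_rate \<gamma> b k * (\<xi> * (t ^ 3 * velocity b k))\<^sup>2 /
        ((slow_rate \<gamma> b k)\<^sup>2 + (\<xi> * (t ^ 3 * velocity b k))\<^sup>2)) \<partial>lborel)
        = (1 / t ^ 5) * (t * (\<integral>q. indicator torus (t * q) * (t ^ 4 * G q (t * q)) \<partial>lborel))"
      by (subst lborel_integral_real_affine[of t _ 0]) (use t in \<open>simp_all add: pt\<close>)
    also have "(\<integral>q. indicator torus (t * q) * (t ^ 4 * G q (t * q)) \<partial>lborel)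
        = t ^ 4 * (\<integral>q. indicator torus (t * q) * G q (t * q) \<partial>lborel)"
      by (subst integral_mult_right_zero[symmetric]) (simp add: mult_ac)
    also have "(1 / t ^ 5) * (t * (t ^ 4 * (\<integral>q. indicator torus (t * q) * G q (t * q) \<partial>lborel)))
        = (\<integral>q. indicator torus (t * q) * G q (t * q) \<partial>lborel)"
      using t by (simp add: power_numeral_reduce)
    finally show ?thesis .
  qed
  have torus_meas [measurable]: "torus \<in> sets borel" by (simp add: torus_def)
  have sinc_meas [measurable]: "sinc \<in> borel_measurable borel" unfolding sinc_def by measurable
  have [measurable]: "S \<in> borel_measurable borel" unfolding S_def by measurable
  have [measurable]: "l \<in> borel_measurable borel" "\<nu> \<in> borel_measurable borel" unfolding l_def \<nu>_def by measurable
  have S0: "S 0 = b" using b by (simp add: S_def)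
  have sinc0: "sinc 0 = pi" by (simp add: sinc_def)
  have "isCont S 0" unfolding S_def by (intro continuous_intros)
  then have S_lim: "(\<lambda>n. S (\<theta> n * q)) \<longlonglongrightarrow> b" for q
    using isCont_tendsto_compose[OF _ tendsto_mult_left_zero[OF \<theta>(1)], of S q] S0 by simp
  have "isCont sinc 0" using sinc_lim sinc0 by (simp add: isCont_def)
  then have s_lim: "(\<lambda>n. sinc (\<theta> n * q)) \<longlonglongrightarrow> pi" for q
    using isCont_tendsto_compose[OF _ tendsto_mult_left_zero[OF \<theta>(1)], of sinc q] sinc0 by simp
  have \<theta>q: "(\<lambda>n. \<theta> n * q) \<longlonglongrightarrow> 0" for q by (rule tendsto_mult_left_zero[OF \<theta>(1)])
  have l_lim: "(\<lambda>n. l (\<theta> n * q)) \<longlonglongrightarrow> slow_coeff \<gamma> b" for q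
  proof -
    have "(\<lambda>n. l (\<theta> n * q)) \<longlonglongrightarrow> 16 * \<gamma> * pi ^ 4 / (b * (b + b))"
      unfolding l_def using b by (intro tendsto_intros S_lim s_lim) auto
    then show ?thesis using b by (simp add: slow_coeff_def field_simps power2_eq_square)
  qed
  have \<nu>_lim: "(\<lambda>n. \<nu> (\<theta> n * q)) \<longlonglongrightarrow> 2 * pi / b" for q
  proof -
    have "(\<lambda>n. \<nu> (\<theta> n * q)) \<longlonglongrightarrow> 2 * pi * cos (pi * 0) / b"
      unfolding \<nu>_def using b by (intro tendsto_intros S_lim s_lim \<theta>q) auto
    then show ?thesis by simp
  qed
  have "(\<lambda>n. \<integral>q. indicator torus (\<theta> n * q) * G q (\<theta> n * q) \<partial>lborel)
    \<longlonglongrightarrow> (\<integral>q. q ^ 4 * slow_coeff \<gamma> b * (\<xi> * (2 * pi / b))\<^sup>2 /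
        (q ^ 6 * (slow_coeff \<gamma> b)\<^sup>2 + (\<xi> * (2 * pi / b))\<^sup>2) \<partial>lborel)"
  proof (rule integral_dominated_convergence[where w = "\<lambda>q. 2 * (l1 + \<xi>\<^sup>2 * \<nu>1\<^sup>2 / l0) / (1 + q\<^sup>2)"])
    show "integrable lborel (\<lambda>q. 2 * (l1 + \<xi>\<^sup>2 * \<nu>1\<^sup>2 / l0) / (1 + q\<^sup>2))"
      by (rule inverse_quadratic_integrable)
    have coeff_pos: "0 < slow_coeff \<gamma> b" using \<gamma> b by (simp add: slow_coeff_def)
    show "AE q in lborel. (\<lambda>n. indicator torus (\<theta> n * q) * G q (\<theta> n * q)) \<longlonglongrightarrow>
        q ^ 4 * slow_coeff \<gamma> b * (\<xi> * (2 * pi / b))\<^sup>2 / (q ^ 6 * (slow_coeff \<gamma> b)\<^sup>2 + (\<xi> * (2 * pi / b))\<^sup>2)"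
      \<comment> \<open>For \<open>\<xi> = 0\<close> the limiting denominator vanishes at
        \<open>q = 0\<close>, so this point is discarded.\<close>
      using AE_lborel_singleton[of "0::real"]
    proof eventually_elim
      case (elim q)
      have ev: "\<forall>\<^sub>F n in sequentially. indicator torus (\<theta> n * q) = (1::real)"
        using order_tendstoD(1)[OF \<theta>q, of "-1/2" q] order_tendstoD(2)[OF \<theta>q, of "1/2" q]
        by (auto simp: torus_def elim: eventually_elim2)
      have "0 < q ^ 6" using elim by (simp add: zero_less_power_eq)
      then have "q ^ 6 * (slow_coeff \<gamma> b)\<^sup>2 + (\<xi> * (2 * pi / b))\<^sup>2 \<noteq> 0"
        using coeff_pos by (intro less_imp_neq[symmetric] add_pos_nonneg mult_pos_pos) auto
      then have "(\<lambda>n. G q (\<theta> n * q)) \<longlonglongrightarrow>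
          q ^ 4 * slow_coeff \<gamma> b * (\<xi> * (2 * pi / b))\<^sup>2 / (q ^ 6 * (slow_coeff \<gamma> b)\<^sup>2 + (\<xi> * (2 * pi / b))\<^sup>2)"
        unfolding G_def by (intro tendsto_intros l_lim \<nu>_lim)
      then show ?case
        by (rule Lim_transform_eventually) (use ev in \<open>auto elim: eventually_mono\<close>)
    qed
    show "AE q in lborel. norm (indicator torus (\<theta> n * q) * G q (\<theta> n * q)) \<le> 2 * (l1 + \<xi>\<^sup>2 * \<nu>1\<^sup>2 / l0) / (1 + q\<^sup>2)" for n
    proof (rule AE_I2)
      fix q
      have nn: "0 \<le> 2 * (l1 + \<xi>\<^sup>2 * \<nu>1\<^sup>2 / l0) / (1 + q\<^sup>2)"
        using G_nonneg[of q 0] G_le[of 0 q] by linarith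
      show "norm (indicator torus (\<theta> n * q) * G q (\<theta> n * q)) \<le> 2 * (l1 + \<xi>\<^sup>2 * \<nu>1\<^sup>2 / l0) / (1 + q\<^sup>2)"
      proof (cases "\<theta> n * q \<in> torus")
        case True
        then have "\<bar>\<theta> n * q\<bar> \<le> 1 / 2" by (auto simp: torus_def)
        then show ?thesis using True G_le[of "\<theta> n * q" q] G_nonneg by simp
      qed (use nn in simp)
    qed
    show "(\<lambda>q. indicator torus (\<theta> n * q) * G q (\<theta> n * q)) \<in> borel_measurable lborel" for n
      unfolding G_def by measurable
  qed measurable
  then show ?thesis unfolding scale[OF \<theta>(2)] .
qed

text \<open>Rate and squared velocity both vanish quadratically at \<open>k = 0\<close>, so the
  quotient of squared transport by rate is at most
  \<open>\<xi>\<^sup>2 * t ^ 6 / (\<gamma> * b\<^sup>2)\<close> uniformly in \<open>k\<close>.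
  Against the factor \<open>1 / t ^ 5\<close> one power of \<open>t\<close> is left over: this band
  is too diffusive to be seen on the present scale.\<close>

lemma fast_rate_limit:
  assumes \<gamma>: "0 < \<gamma>" and b: "0 < b" and \<theta>: "\<theta> \<longlonglongrightarrow> 0" "\<And>n. 0 < \<theta> n"
  shows "(\<lambda>n. (1 / \<theta> n ^ 5) * (\<integral>k. indicator torus k *
      (fast_rate \<gamma> b k * (\<xi> * (\<theta> n ^ 3 * velocity b k))\<^sup>2 /
        ((fast_rate \<gamma> b k)\<^sup>2 + (\<xi> * (\<theta> n ^ 3 * velocity b k))\<^sup>2)) \<partial>lborel))
    \<longlonglongrightarrow> 0"
proof (rule real_tendsto_sandwich)
  define S where "S = (\<lambda>k. sqrt (4 * (sin (pi * k))\<^sup>2 + b\<^sup>2))"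
  have S_ge: "b \<le> S k" for k unfolding S_def by (rule real_le_rsqrt) simp
  have S_pos: "0 < S k" for k using S_ge[of k] b by linarith
  have fast_ge: "4 * \<gamma> * (sin (pi * k))\<^sup>2 \<le> fast_rate \<gamma> b k" for k
  proof -
    have "4 * \<gamma> * (sin (pi * k))\<^sup>2 * S k \<le> 4 * \<gamma> * (sin (pi * k))\<^sup>2 * (S k + b)"
      using \<gamma> b by (intro mult_left_mono) auto
    then have "4 * \<gamma> * (sin (pi * k))\<^sup>2 \<le> 4 * \<gamma> * (sin (pi * k))\<^sup>2 * (S k + b) / S k"
      using S_pos[of k] by (simp only: pos_le_divide_eq)
    then show ?thesis by (simp only: fast_rate_def S_def)
  qed
  have vel_le: "(velocity b k)\<^sup>2 \<le> 4 * (sin (pi * k))\<^sup>2 / b\<^sup>2" for k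
  proof -
    have "sin (2 * pi * k) = 2 * sin (pi * k) * cos (pi * k)"
      using sin_double[of "pi * k"] by (simp add: mult_ac)
    then have "(velocity b k)\<^sup>2 = 4 * (sin (pi * k))\<^sup>2 * (cos (pi * k))\<^sup>2 / (S k)\<^sup>2"
      by (simp add: velocity_def S_def power_mult_distrib power_divide)
    also have "\<dots> \<le> 4 * (sin (pi * k))\<^sup>2 * 1 / b\<^sup>2"
      using S_ge[of k] b abs_cos_le_one[of "pi * k"]
      by (intro frac_le mult_left_mono power_mono) (auto simp: abs_square_le_1)
    finally show ?thesis by simp
  qed
  have pt: "fast_rate \<gamma> b k * (\<xi> * (t ^ 3 * velocity b k))\<^sup>2 /
        ((fast_rate \<gamma> b k)\<^sup>2 + (\<xi> * (t ^ 3 * velocity b k))\<^sup>2) \<le> \<xi>\<^sup>2 * t ^ 6 / (\<gamma> * b\<^sup>2)"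
     "0 \<le> fast_rate \<gamma> b k * (\<xi> * (t ^ 3 * velocity b k))\<^sup>2 /
        ((fast_rate \<gamma> b k)\<^sup>2 + (\<xi> * (t ^ 3 * velocity b k))\<^sup>2)" for k t
  proof -
    have f0: "0 \<le> fast_rate \<gamma> b k" using fast_ge[of k] \<gamma> by (smt (verit) mult_nonneg_nonneg zero_le_power2)
    then show "0 \<le> fast_rate \<gamma> b k * (\<xi> * (t ^ 3 * velocity b k))\<^sup>2 /
        ((fast_rate \<gamma> b k)\<^sup>2 + (\<xi> * (t ^ 3 * velocity b k))\<^sup>2)" by simp
    show "fast_rate \<gamma> b k * (\<xi> * (t ^ 3 * velocity b k))\<^sup>2 /
        ((fast_rate \<gamma> b k)\<^sup>2 + (\<xi> * (t ^ 3 * velocity b k))\<^sup>2) \<le> \<xi>\<^sup>2 * t ^ 6 / (\<gamma> * b\<^sup>2)" (is "?f * ?c / (?f\<^sup>2 + ?c) \<le> _")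
    proof (cases "?f = 0")
      case False
      then have f: "0 < ?f" using f0 by simp
      have "?f * ?c / (?f\<^sup>2 + ?c) \<le> ?f * ?c / ?f\<^sup>2"
        using f by (intro divide_left_mono) (auto intro!: mult_pos_pos add_pos_nonneg)
      also have "\<dots> = ?c / ?f" using f by (simp add: power2_eq_square)
      also have "\<dots> \<le> \<xi>\<^sup>2 * t ^ 6 / (\<gamma> * b\<^sup>2)"
      proof -
        have "?c = \<xi>\<^sup>2 * t ^ 6 * (velocity b k)\<^sup>2" by (simp add: power_mult_distrib flip: power_mult)
        also have "\<dots> \<le> \<xi>\<^sup>2 * t ^ 6 * (4 * (sin (pi * k))\<^sup>2 / b\<^sup>2)"
          by (intro mult_left_mono vel_le) auto
        also have "\<dots> = \<xi>\<^sup>2 * t ^ 6 / (\<gamma> * b\<^sup>2) * (4 * \<gamma> * (sin (pi * k))\<^sup>2)"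
          using \<gamma> by simp
        also have "\<dots> \<le> \<xi>\<^sup>2 * t ^ 6 / (\<gamma> * b\<^sup>2) * ?f"
          using fast_ge[of k] \<gamma> by (intro mult_left_mono) auto
        finally show ?thesis using f by (simp add: pos_divide_le_eq)
      qed
      finally show ?thesis .
    qed (use \<gamma> in simp)
  qed
  have torus_meas [measurable]: "torus \<in> sets borel" by (simp add: torus_def)
  let ?J = "\<lambda>n. (1 / \<theta> n ^ 5) * (\<integral>k. indicator torus k *
      (fast_rate \<gamma> b k * (\<xi> * (\<theta> n ^ 3 * velocity b k))\<^sup>2 /
        ((fast_rate \<gamma> b k)\<^sup>2 + (\<xi> * (\<theta> n ^ 3 * velocity b k))\<^sup>2)) \<partial>lborel)"
  show "\<forall>\<^sub>F n in sequentially. 0 \<le> ?J n"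
    using \<theta>(2) pt(2) by (intro always_eventually allI mult_nonneg_nonneg Bochner_Integration.integral_nonneg)
      (auto simp: less_imp_le)
  show "\<forall>\<^sub>F n in sequentially. ?J n \<le> \<theta> n * (\<xi>\<^sup>2 / (\<gamma> * b\<^sup>2))"
  proof (intro always_eventually allI)
    fix n
    let ?t = "\<theta> n"
    have int_t: "integrable lborel (\<lambda>k. indicator torus k * c :: real)" for c
      unfolding torus_def by (intro integrable_mult_left integrable_real_indicator) auto
    have "(\<integral>k. indicator torus k *
      (fast_rate \<gamma> b k * (\<xi> * (?t ^ 3 * velocity b k))\<^sup>2 /
        ((fast_rate \<gamma> b k)\<^sup>2 + (\<xi> * (?t ^ 3 * velocity b k))\<^sup>2)) \<partial>lborel)
      \<le> (\<integral>k. indicator torus k * (\<xi>\<^sup>2 * ?t ^ 6 / (\<gamma> * b\<^sup>2)) \<partial>lborel)"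
    proof (rule integral_mono)
      show "integrable lborel (\<lambda>k. indicator torus k *
      (fast_rate \<gamma> b k * (\<xi> * (?t ^ 3 * velocity b k))\<^sup>2 /
        ((fast_rate \<gamma> b k)\<^sup>2 + (\<xi> * (?t ^ 3 * velocity b k))\<^sup>2)))"
      proof (rule Bochner_Integration.integrable_bound[OF int_t[of "\<xi>\<^sup>2 * ?t ^ 6 / (\<gamma> * b\<^sup>2)"]])
        show "(\<lambda>k. indicator torus k *
      (fast_rate \<gamma> b k * (\<xi> * (?t ^ 3 * velocity b k))\<^sup>2 /
        ((fast_rate \<gamma> b k)\<^sup>2 + (\<xi> * (?t ^ 3 * velocity b k))\<^sup>2))) \<in> borel_measurable lborel"
          unfolding fast_rate_def velocity_def by measurable
        show "AE k in lborel. norm (indicator torus k *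
      (fast_rate \<gamma> b k * (\<xi> * (?t ^ 3 * velocity b k))\<^sup>2 /
        ((fast_rate \<gamma> b k)\<^sup>2 + (\<xi> * (?t ^ 3 * velocity b k))\<^sup>2)))
          \<le> norm (indicator torus k * (\<xi>\<^sup>2 * ?t ^ 6 / (\<gamma> * b\<^sup>2)))"
          unfolding real_norm_def abs_mult abs_indicator using pt \<gamma>
          by (intro AE_I2 mult_left_mono) (simp_all only: abs_of_nonneg order_trans[OF pt(2) pt(1)] indicator_pos_le)
      qed
    qed (use pt int_t in \<open>auto intro!: mult_left_mono simp del: times_divide_eq_right\<close>)
    also have "\<dots> = \<xi>\<^sup>2 * ?t ^ 6 / (\<gamma> * b\<^sup>2)" by (simp add: torus_def)
    finally have "?J n \<le> (1 / ?t ^ 5) * (\<xi>\<^sup>2 * ?t ^ 6 / (\<gamma> * b\<^sup>2))"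
      using \<theta>(2)[of n] by (intro mult_left_mono) auto
    also have "\<dots> = ?t * (\<xi>\<^sup>2 / (\<gamma> * b\<^sup>2))"
      using \<theta>(2)[of n] by (simp add: power_numeral_reduce field_simps)
    finally show "?J n \<le> ?t * (\<xi>\<^sup>2 / (\<gamma> * b\<^sup>2))" .
  qed
  show "(\<lambda>n. \<theta> n * (\<xi>\<^sup>2 / (\<gamma> * b\<^sup>2))) \<longlonglongrightarrow> 0" by (rule tendsto_mult_left_zero[OF \<theta>(1)])
qed simp

section \<open>The two-band Boltzmann equation\<close>

lemma alpha_hat_sin: "alpha_hat k = 4 * (sin (pi * k))\<^sup>2"
  using cos_double_sin[of "pi * k"] by (simp add: alpha_hat_eq mult.assoc)

lemma deriv_deriv_alpha_hat: "deriv (deriv alpha_hat) 0 = 8 * pi\<^sup>2"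
proof -
  have "deriv alpha_hat = (\<lambda>k. 4 * pi * sin (2 * pi * k))"
    unfolding alpha_hat_eq[abs_def]
    by (intro ext DERIV_imp_deriv) (auto intro!: derivative_eq_intros)
  moreover have "((\<lambda>k. 4 * pi * sin (2 * pi * k)) has_real_derivative 8 * pi\<^sup>2) (at 0)"
    by (auto intro!: derivative_eq_intros simp: power2_eq_square)
  ultimately show ?thesis by (simp add: DERIV_imp_deriv)
qed

text \<open>Reversing the sign of \<open>B\<close> exchanges the slow and the fast band; this is why
  only \<open>\<bar>B\<bar>\<close> enters the limit.\<close>

definition collision_rate :: "real \<Rightarrow> real \<Rightarrow> nat \<Rightarrow> real \<Rightarrow> real" where
  "collision_rate B \<gamma> i k =
     (if (i = 1) = (B > 0) then fast_rate \<gamma> (\<bar>B\<bar> / 2) k else slow_rate \<gamma> (\<bar>B\<bar> / 2) k)"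

context
  fixes B :: real
  assumes B: "B \<noteq> 0"
begin

definition disp :: "real \<Rightarrow> real" where "disp k = sqrt (4 * (sin (pi * k))\<^sup>2 + (\<bar>B\<bar> / 2)\<^sup>2)"

lemma disp_ge: "\<bar>B\<bar> / 2 \<le> disp k"
  unfolding disp_def by (rule real_le_rsqrt) simp

lemma disp_pos: "0 < disp k"
  using disp_ge[of k] B by (smt (verit) divide_pos_pos zero_less_abs_iff)

lemma omega_disp: "omega B i k = disp k + (if i = 1 then B / 2 else - (B / 2))"
  by (simp add: omega_def alpha_hat_sin disp_def power_divide)

lemma theta_square: "(theta B i k)\<^sup>2 = (disp k + (if i = 1 then B / 2 else - (B / 2))) / (2 * disp k)"
proof -
  have "0 \<le> (disp k + (if i = 1 then B / 2 else - (B / 2))) / (2 * disp k)"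
    using disp_ge[of k] disp_pos[of k] by (intro divide_nonneg_nonneg) (auto simp: abs_if split: if_splits)
  then show ?thesis by (simp add: theta_def omega_disp)
qed

text \<open>The left side is the loss rate of \<gamma> times the collision operator: the squared
  thetas of the two bands add up to 1, and the factor 16 of the kernel meets the integral 1/2 of the
  squared sine.\<close>

lemma theta_rate: "8 * \<gamma> * (sin (pi * k))\<^sup>2 * (theta B i k)\<^sup>2 = collision_rate B \<gamma> i k"
proof -
  define s where "s = (sin (pi * k))\<^sup>2"
  define b where "b = \<bar>B\<bar> / 2"
  have S: "0 < disp k" "0 < b" "0 < disp k + b" using disp_pos[of k] B by (auto simp: b_def add_pos_pos)
  have "(disp k)\<^sup>2 = 4 * s + b\<^sup>2" by (simp add: disp_def s_def b_def)
  then have sq: "(disp k - b) * (disp k + b) = 4 * s" by (simp add: algebra_simps power2_eq_square)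
  have fast: "fast_rate \<gamma> b k = 8 * \<gamma> * s * ((disp k + b) / (2 * disp k))"
    by (simp add: fast_rate_def s_def b_def disp_def)
  have "slow_rate \<gamma> b k = 16 * \<gamma> * (s * s) / (disp k * (disp k + b))"
    by (simp add: slow_rate_def s_def b_def disp_def flip: power_add)
  also have "\<dots> = 4 * \<gamma> * s * ((disp k - b) * (disp k + b)) / (disp k * (disp k + b))"
    by (simp add: sq)
  also have "\<dots> = 8 * \<gamma> * s * ((disp k - b) / (2 * disp k))"
  proof -
    have "4 * \<gamma> * s * ((disp k - b) * (disp k + b)) / (disp k * (disp k + b))
        = (4 * \<gamma> * s * (disp k - b)) * (disp k + b) / (disp k * (disp k + b))"
      by (simp only: mult.assoc)
    also have "\<dots> = 4 * \<gamma> * s * (disp k - b) / disp k"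
      using S(3) by (subst mult_divide_mult_cancel_right) auto
    finally show ?thesis by simp
  qed
  finally have slow: "slow_rate \<gamma> b k = 8 * \<gamma> * s * ((disp k - b) / (2 * disp k))" .
  show ?thesis
    unfolding theta_square collision_rate_def b_def[symmetric] s_def[symmetric] fast slow
    using B by (auto simp: b_def abs_if)
qed

lemma theta_sum: "(theta B 1 k)\<^sup>2 + (theta B 2 k)\<^sup>2 = 1"
  unfolding theta_square using disp_pos[of k] by (simp add: field_simps)

lemma omega_deriv_velocity: "omega_deriv B k = 2 * pi * velocity (\<bar>B\<bar> / 2) k"
proof -
  have "(disp has_real_derivative (8 * sin (pi * k) * (cos (pi * k) * pi)) / (2 * disp k)) (at k)"
  proof -
    have "((\<lambda>k. 4 * (sin (pi * k))\<^sup>2 + (\<bar>B\<bar> / 2)\<^sup>2) has_real_derivative 8 * sin (pi * k) * (cos (pi * k) * pi)) (at k)"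
      by (auto intro!: derivative_eq_intros)
    moreover have "0 < 4 * (sin (pi * k))\<^sup>2 + (\<bar>B\<bar> / 2)\<^sup>2" using B by (intro add_nonneg_pos) auto
    ultimately show ?thesis
      unfolding disp_def[abs_def] by (auto intro!: derivative_eq_intros simp: field_simps)
  qed
  then have "((\<lambda>k. disp k + B / 2) has_real_derivative (8 * sin (pi * k) * (cos (pi * k) * pi)) / (2 * disp k)) (at k)"
    by (auto intro!: derivative_eq_intros)
  then have "omega_deriv B k = (8 * sin (pi * k) * (cos (pi * k) * pi)) / (2 * disp k)"
    unfolding omega_deriv_def by (simp add: omega_disp[abs_def] DERIV_imp_deriv)
  moreover have "sin (2 * pi * k) = 2 * sin (pi * k) * cos (pi * k)"
    using sin_double[of "pi * k"] by (simp add: mult_ac)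
  ultimately show ?thesis by (simp add: velocity_def disp_def mult_ac)
qed

end

lemma velocity_le: "0 < b \<Longrightarrow> \<bar>velocity b k\<bar> \<le> 1 / b"
proof -
  assume b: "0 < b"
  have "b \<le> sqrt (4 * (sin (pi * k))\<^sup>2 + b\<^sup>2)" by (rule real_le_rsqrt) simp
  then show ?thesis unfolding velocity_def abs_divide using b by (intro frac_le) auto
qed

section \<open>The phase space of band and wave number\<close>

text \<open>One measure for the sum over bands and the integral over the torus, so that the scalar
  theory above applies to the two-band system.\<close>

definition mode_measure :: "(nat \<times> real) measure" where
  "mode_measure = count_space {1, 2} \<Otimes>\<^sub>M restrict_space lborel torus"

lemma torus_borel [measurable]: "torus \<in> sets borel" by (simp add: torus_def)

lemma emeasure_torus: "emeasure (restrict_space lborel torus) torus = 1"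
  by (subst emeasure_restrict_space) (auto simp: torus_def)

lemma space_torus: "space (restrict_space lborel torus) = torus"
  by (simp add: space_restrict_space)

lemma torus_finite: "finite_measure (restrict_space lborel torus)"
  by (rule finite_measureI) (simp add: space_torus emeasure_torus)

lemma space_mode_measure: "space mode_measure = {1, 2} \<times> torus"
  by (simp add: mode_measure_def space_pair_measure space_torus)

lemma mode_measure_pair: "pair_sigma_finite (count_space {1, 2 :: nat}) (restrict_space lborel torus)"
proof -
  interpret finite_measure "restrict_space lborel torus" by (rule torus_finite)
  show ?thesis by (intro pair_sigma_finite.intro sigma_finite_measure_count_space_finite sigma_finite_measure_axioms) auto
qed

lemma emeasure_mode_measure: "emeasure mode_measure (space mode_measure) = 2"
proof -
  interpret finite_measure "restrict_space lborel torus" by (rule torus_finite)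
  have "torus \<in> sets (restrict_space lborel torus)" by (metis space_torus sets.top)
  then show ?thesis
    unfolding space_mode_measure unfolding mode_measure_def
    by (subst emeasure_pair_measure_Times) (auto simp: emeasure_torus)
qed

lemma finite_mode_measure: "finite_measure mode_measure"
  by (rule finite_measureI) (simp add: emeasure_mode_measure)

lemma measurable_mode_measure:
  assumes "\<And>i. i \<in> {1, 2} \<Longrightarrow> (\<lambda>k. g (i, k)) \<in> borel_measurable (restrict_space lborel torus)"
  shows "g \<in> borel_measurable mode_measure"
  unfolding mode_measure_def
  by (rule measurable_pair_measure_countable1) (use assms in auto)

lemma integral_mode_measure:
  fixes g :: "nat \<times> real \<Rightarrow> 'b::{banach, second_countable_topology}"
  assumes "integrable mode_measure g"
  shows "(\<integral>x. g x \<partial>mode_measure) = (\<Sum>i\<in>{1, 2}. LINT k:torus|lborel. g (i, k))"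
proof -
  interpret pair_sigma_finite "count_space {1, 2 :: nat}" "restrict_space lborel torus"
    by (rule mode_measure_pair)
  have "(\<integral>x. g x \<partial>mode_measure) = (\<integral>i. (\<integral>k. g (i, k) \<partial>restrict_space lborel torus) \<partial>count_space {1, 2})"
    using integral_fst'[of g] assms by (simp add: mode_measure_def)
  also have "\<dots> = (\<Sum>i\<in>{1, 2}. \<integral>k. g (i, k) \<partial>restrict_space lborel torus)"
    by (rule lebesgue_integral_count_space_finite) simp
  finally show ?thesis
    by (simp add: integral_restrict_space set_lebesgue_integral_def)
qed

lemma collision_rate_meas [measurable]: "collision_rate B \<gamma> i \<in> borel_measurable borel"
  unfolding collision_rate_def fast_rate_def slow_rate_def by measurable

lemma velocity_meas [measurable]: "velocity b \<in> borel_measurable borel"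
  unfolding velocity_def by measurable

lemma restrict_lborel_measurable:
  "g \<in> borel_measurable borel \<Longrightarrow> g \<in> borel_measurable (restrict_space lborel torus)"
  by (rule measurable_restrict_space1) simp

lemma integral_sin_square: "(LINT k:torus|lborel. (sin (pi * k))\<^sup>2) = 1 / 2"
proof -
  define F where "F = (\<lambda>k. k / 2 - sin (2 * (pi * k)) / (4 * pi))"
  have "(\<integral>k. indicator {-1/2..1/2} k *\<^sub>R (sin (pi * k))\<^sup>2 \<partial>lborel) = F (1/2) - F (-1/2)"
  proof (rule integral_FTC_Icc)
    show "(F has_vector_derivative (sin (pi * k))\<^sup>2) (at k within {-1/2..1/2})" for k
    proof -
      have "(F has_real_derivative 1 / 2 - cos (2 * (pi * k)) * (2 * pi) / (4 * pi)) (at k within {-1/2..1/2})"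
        unfolding F_def by (auto intro!: derivative_eq_intros)
      also have "1 / 2 - cos (2 * (pi * k)) * (2 * pi) / (4 * pi) = (sin (pi * k))\<^sup>2"
        unfolding cos_double_sin by (simp add: field_simps)
      finally show ?thesis by (simp add: has_real_derivative_iff_has_vector_derivative)
    qed
  qed (auto intro!: continuous_intros)
  also have "\<dots> = 1 / 2" by (simp add: F_def)
  also have "(\<integral>k. indicator {-1/2..1/2} k *\<^sub>R (sin (pi * k))\<^sup>2 \<partial>lborel) = (LINT k:torus|lborel. (sin (pi * k))\<^sup>2)"
    unfolding set_lebesgue_integral_def
  proof (rule integral_cong_AE)
    show "AE k in lborel. indicator {-1/2..1/2} k *\<^sub>R (sin (pi * k))\<^sup>2 = indicator torus k *\<^sub>R (sin (pi * k))\<^sup>2"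
      using AE_lborel_singleton[of "1/2 :: real"] by eventually_elim (auto simp: torus_def indicator_def)
  qed measurable
  finally show ?thesis .
qed

lemma collision_rate_bounds:
  assumes "B \<noteq> 0" "0 < \<gamma>"
  shows "0 \<le> collision_rate B \<gamma> i k" "collision_rate B \<gamma> i k \<le> 8 * \<gamma>"
proof -
  show "0 \<le> collision_rate B \<gamma> i k"
    using assms by (simp add: theta_rate[OF assms(1), symmetric])
  have "(theta B i k)\<^sup>2 \<le> 1"
    using theta_sum[OF assms(1), of k] theta_square[OF assms(1), of i k] theta_square[OF assms(1), of 2 k]
    by (cases "i = 1") (auto, (smt (verit) zero_le_power2)+)
  moreover have "(sin (pi * k))\<^sup>2 \<le> 1" by (simp add: abs_square_le_1)
  ultimately have "8 * \<gamma> * (sin (pi * k))\<^sup>2 * (theta B i k)\<^sup>2 \<le> 8 * \<gamma> * 1 * 1"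
    using assms by (intro mult_mono) auto
  then show "collision_rate B \<gamma> i k \<le> 8 * \<gamma>" by (simp add: theta_rate[OF assms(1)])
qed

text \<open>The rates of the two bands add up to \<open>8 * \<gamma>\<close> times the squared sine,
  whose integral is \<open>4 * \<gamma>\<close>; hence \<open>kap\<close>.\<close>

lemma mode_kernel:
  assumes "B \<noteq> 0" "0 < \<gamma>"
  shows "relaxation_kernel mode_measure (\<lambda>x. collision_rate B \<gamma> (fst x) (snd x)) (1 / (4 * \<gamma>)) (8 * \<gamma>)"
proof -
  interpret finite_measure mode_measure by (rule finite_mode_measure)
  have meas: "(\<lambda>x. collision_rate B \<gamma> (fst x) (snd x)) \<in> borel_measurable mode_measure"
    by (rule measurable_mode_measure) (simp add: restrict_lborel_measurable)
  have "integrable mode_measure (\<lambda>x. collision_rate B \<gamma> (fst x) (snd x))"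
    by (rule integrable_const_bound[where B = "8 * \<gamma>"])
      (use meas collision_rate_bounds[OF assms] in auto)
  then have "(\<integral>x. collision_rate B \<gamma> (fst x) (snd x) \<partial>mode_measure)
      = (LINT k:torus|lborel. collision_rate B \<gamma> 1 k) + (LINT k:torus|lborel. collision_rate B \<gamma> 2 k)"
    by (simp add: integral_mode_measure)
  also have "\<dots> = (LINT k:torus|lborel. collision_rate B \<gamma> 1 k + collision_rate B \<gamma> 2 k)"
  proof -
    have "set_integrable lborel torus (collision_rate B \<gamma> i)" for i
      unfolding set_integrable_def
    proof (rule Bochner_Integration.integrable_bound[where f = "\<lambda>k. 8 * \<gamma> * indicator torus k :: real"])
      show "integrable lborel (\<lambda>k. 8 * \<gamma> * indicator torus k :: real)"
        unfolding torus_def by (intro integrable_mult_right integrable_real_indicator) auto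
    qed (use collision_rate_bounds[OF assms] assms in \<open>auto simp: indicator_def abs_le_iff\<close>)
    then show ?thesis by (intro set_integral_add(2)[symmetric])
  qed
  also have "\<dots> = (LINT k:torus|lborel. 8 * \<gamma> * (sin (pi * k))\<^sup>2)"
  proof -
    have "collision_rate B \<gamma> 1 k + collision_rate B \<gamma> 2 k = 8 * \<gamma> * (sin (pi * k))\<^sup>2" for k
      unfolding theta_rate[OF assms(1), symmetric] using theta_sum[OF assms(1), of k]
      by (simp flip: distrib_left)
    then show ?thesis by simp
  qed
  also have "\<dots> = 4 * \<gamma>" using integral_sin_square by simp
  finally have "(\<integral>x. collision_rate B \<gamma> (fst x) (snd x) \<partial>mode_measure) = 4 * \<gamma>" .
  then show ?thesis
    by unfold_locales
      (use meas assms collision_rate_bounds[OF assms] emeasure_mode_measure in \<open>auto simp: measure_def\<close>)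
qed

text \<open>The kernel is a product of a function of \<open>(k, i)\<close> and one of
  \<open>(k', j)\<close>, so the gain depends on the solution only through one weighted mean.
  Boundedness and measurability allow gain and loss to be integrated separately.\<close>

lemma collision_relaxation:
  assumes B: "B \<noteq> 0" and \<gamma>: "0 < \<gamma>" and i: "i \<in> {1, 2}"
    and meas: "\<And>j. j \<in> {1, 2} \<Longrightarrow> set_borel_measurable lborel torus (\<lambda>k. f k j)"
    and bdd: "\<And>k j. k \<in> torus \<Longrightarrow> j \<in> {1, 2} \<Longrightarrow> norm (f k j) \<le> M"
  shows "of_real \<gamma> * collision B f k i = of_real (collision_rate B \<gamma> i k) *
    (of_real (1 / (4 * \<gamma>)) * (\<integral>x. of_real (collision_rate B \<gamma> (fst x) (snd x)) * f (snd x) (fst x) \<partial>mode_measure) - f k i)"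
proof -
  interpret K: relaxation_kernel mode_measure "\<lambda>x. collision_rate B \<gamma> (fst x) (snd x)" "1 / (4 * \<gamma>)" "8 * \<gamma>"
    by (rule mode_kernel[OF B \<gamma>])
  have f_meas: "(\<lambda>x. f (snd x) (fst x)) \<in> borel_measurable mode_measure"
  proof (rule measurable_mode_measure)
    fix j :: nat assume "j \<in> {1, 2}"
    from meas[OF this] show "(\<lambda>k. f (snd (j, k)) (fst (j, k))) \<in> borel_measurable (restrict_space lborel torus)"
      by (simp add: borel_measurable_restrict_space_iff set_borel_measurable_def)
  qed
  have int: "integrable mode_measure (\<lambda>x. of_real (collision_rate B \<gamma> (fst x) (snd x)) * f (snd x) (fst x))"
    by (rule K.bounded_integrable[where B = "8 * \<gamma> * M"])
      (use f_meas bdd \<gamma> collision_rate_bounds[OF B \<gamma>] in \<open>auto simp: norm_mult space_mode_measure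
        intro!: mult_mono borel_measurable_times K.lam_meas\<close>)
  have int_lam: "integrable mode_measure (\<lambda>x. complex_of_real (collision_rate B \<gamma> (fst x) (snd x)) * f k i)"
    using K.lam_integrable by (intro integrable_mult_left) auto
  define X where "X = (\<integral>x. of_real (collision_rate B \<gamma> (fst x) (snd x)) * f (snd x) (fst x) \<partial>mode_measure)"
  \<comment> \<open>The 16 of the kernel divided by the \<open>8 * \<gamma>\<close> contained in the
    rate of \<open>(k', j)\<close>.\<close>
  define c where "c = 2 / \<gamma> * ((theta B i k)\<^sup>2 * (sin (pi * k))\<^sup>2)"
  have pt: "of_real ((theta B i k)\<^sup>2 * scattering_kernel k k' * (theta B j k')\<^sup>2) * (f k' j - f k i)
      = of_real c * (of_real (collision_rate B \<gamma> j k') * f k' j - of_real (collision_rate B \<gamma> j k') * f k i)" for k' j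
    unfolding c_def scattering_kernel_def theta_rate[OF B, symmetric] using \<gamma> by (simp add: algebra_simps)
  have "collision B f k i = (\<Sum>j\<in>{1, 2}. LINT k':torus|lborel.
      of_real c * (of_real (collision_rate B \<gamma> j k') * f k' j - of_real (collision_rate B \<gamma> j k') * f k i))"
    unfolding collision_def pt ..
  also have "\<dots> = (\<integral>x. of_real c * (of_real (collision_rate B \<gamma> (fst x) (snd x)) * f (snd x) (fst x)
      - of_real (collision_rate B \<gamma> (fst x) (snd x)) * f k i) \<partial>mode_measure)"
    by (subst integral_mode_measure) (use int int_lam in auto)
  also have "\<dots> = of_real c * (X - of_real (4 * \<gamma>) * f k i)"
    using int int_lam K.integral_lam by (simp add: X_def)
  finally have "of_real \<gamma> * collision B f k i = of_real \<gamma> * (of_real c * (X - of_real (4 * \<gamma>) * f k i))"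
    by simp
  also have "\<dots> = of_real (\<gamma> * c * (4 * \<gamma>)) * (of_real (1 / (4 * \<gamma>)) * X - f k i)"
    using \<gamma> by (simp add: field_simps)
  also have "\<gamma> * c * (4 * \<gamma>) = collision_rate B \<gamma> i k"
    unfolding c_def theta_rate[OF B, symmetric] using \<gamma> by (simp add: field_simps)
  finally show ?thesis by (simp add: X_def)
qed

lemma velocity_odd_integral:
  assumes B: "B \<noteq> 0" and \<gamma>: "0 < \<gamma>"
  shows "(\<integral>x. (collision_rate B \<gamma> (fst x) (snd x))\<^sup>2 * (s * velocity b (snd x)) /
    ((collision_rate B \<gamma> (fst x) (snd x))\<^sup>2 + (s * velocity b (snd x))\<^sup>2) \<partial>mode_measure) = 0" (is "?L = 0")
proof -
  define g where "g = (\<lambda>i k. (collision_rate B \<gamma> i k)\<^sup>2 * (s * velocity b k) /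
    ((collision_rate B \<gamma> i k)\<^sup>2 + (s * velocity b k)\<^sup>2))"
  have odd: "g i (- k) = - g i k" for i k
    by (simp add: g_def collision_rate_def fast_rate_def slow_rate_def velocity_def)
  \<comment> \<open>The half-open domain is not symmetric under reflection; at the two boundary
    points the identity is saved by the vanishing velocity.\<close>
  have edge: "g i (1/2) = 0" "g i (- (1/2)) = 0" for i
    by (simp_all add: g_def velocity_def)
  have zero: "(LINT k:torus|lborel. g i k) = 0" for i
  proof -
    have "(\<integral>k. indicator torus k * g i k \<partial>lborel) = (\<integral>k. indicator torus (- k) * g i (- k) \<partial>lborel)"
      by (subst lborel_integral_real_affine[of "-1" _ 0]) auto
    also have "\<dots> = (\<integral>k. - (indicator torus k * g i k) \<partial>lborel)"
    proof (rule Bochner_Integration.integral_cong)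
      fix k :: real
      consider "k = 1/2" | "k = - (1/2)" | "k \<noteq> 1/2" "k \<noteq> - (1/2)" by blast
      then show "indicator torus (- k) * g i (- k) = - (indicator torus k * g i k)"
      proof cases
        case 1
        show ?thesis unfolding 1 odd edge by simp
      next
        case 2
        show ?thesis unfolding 2 odd edge by simp
      next
        case 3
        then have "- k \<in> torus \<longleftrightarrow> k \<in> torus" by (auto simp: torus_def)
        then show ?thesis by (simp add: odd indicator_def)
      qed
    qed simp
    finally show ?thesis by (simp add: set_lebesgue_integral_def)
  qed
  show ?thesis
  \<comment> \<open>In the non-integrable case the Bochner integral is 0 by convention, which is the
    claim.\<close>
  proof (cases "integrable mode_measure (\<lambda>x. g (fst x) (snd x))")
    case True
    from integral_mode_measure[OF this] show ?thesis by (simp add: zero flip: g_def) (simp add: g_def)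
  next
    case False
    then show ?thesis using not_integrable_integral_eq[OF False] by (simp add: g_def)
  qed
qed

lemma collision_rate_pos:
  assumes B: "B \<noteq> 0" and \<gamma>: "0 < \<gamma>" and k: "k \<in> torus" "k \<noteq> 0"
  shows "0 < collision_rate B \<gamma> i k"
proof -
  have "\<bar>k\<bar> \<le> 1 / 2" using k by (auto simp: torus_def)
  from jordan_sin[OF this] k have s: "sin (pi * k) \<noteq> 0" by auto
  define S where "S = sqrt (4 * (sin (pi * k))\<^sup>2 + (\<bar>B\<bar> / 2)\<^sup>2)"
  have "0 < S" unfolding S_def using B by (intro real_sqrt_gt_zero add_nonneg_pos) auto
  moreover have "0 < \<bar>B\<bar> / 2" using B by simp
  moreover have "0 < sin (pi * k) ^ 4" using s by (simp add: zero_less_power_eq)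
  ultimately have "0 < slow_rate \<gamma> (\<bar>B\<bar> / 2) k" "0 < fast_rate \<gamma> (\<bar>B\<bar> / 2) k"
    unfolding slow_rate_def fast_rate_def S_def[symmetric] using \<gamma> s
    by (auto intro!: divide_pos_pos mult_pos_pos add_pos_pos)
  then show ?thesis by (simp add: collision_rate_def)
qed

lemma collision_rate_AE_pos:
  assumes B: "B \<noteq> 0" and \<gamma>: "0 < \<gamma>"
  shows "AE x in mode_measure. 0 < collision_rate B \<gamma> (fst x) (snd x)"
proof -
  interpret K: relaxation_kernel mode_measure "\<lambda>x. collision_rate B \<gamma> (fst x) (snd x)" "1 / (4 * \<gamma>)" "8 * \<gamma>"
    by (rule mode_kernel[OF B \<gamma>])
  interpret pair_sigma_finite "count_space {1, 2 :: nat}" "restrict_space lborel torus"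
    by (rule mode_measure_pair)
  have "AE k in restrict_space lborel torus. 0 < collision_rate B \<gamma> i k" for i
  proof -
    have "AE k in lborel. k \<in> torus \<longrightarrow> 0 < collision_rate B \<gamma> i k"
      using AE_lborel_singleton[of "0::real"] by eventually_elim (use collision_rate_pos[OF B \<gamma>] in auto)
    then show ?thesis by (subst AE_restrict_space_iff) auto
  qed
  moreover have "{x \<in> space mode_measure. 0 < collision_rate B \<gamma> (fst x) (snd x)} \<in> sets mode_measure"
    using K.lam_meas by measurable
  ultimately show ?thesis unfolding mode_measure_def by (intro AE_pair_measure) auto
qed

section \<open>The diffusion coefficient and the limit of the rate\<close>

text \<open>The constant of \<open>scaled_limit_integral\<close> for the slope
  \<open>2 * pi / b\<close> of the velocity at 0 and the coefficient of the slow rate, with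
  \<open>b = \<bar>B\<bar> / 2\<close>. The final 2 is the one in \<open>rate\<close>.\<close>

definition diffusivity :: "real \<Rightarrow> real \<Rightarrow> real" where
  "diffusivity B \<gamma> = limit_integral * ((2 * pi / (\<bar>B\<bar> / 2)) powr (5/3) * slow_coeff \<gamma> (\<bar>B\<bar> / 2) powr (-2/3)) / 2"

text \<open>What remains of \<open>diffusivity\<close> after splitting off the powers of
  \<open>\<bar>B\<bar>\<close> and \<gamma>: the velocity slope is
  \<open>4 * pi / \<bar>B\<bar>\<close> and the slow coefficient
  \<open>32 * pi ^ 4 * \<gamma> / \<bar>B\<bar>\<^sup>2\<close>. The denominator is the 2 of
  \<open>diffusivity\<close> times the second derivative \<open>8 * pi\<^sup>2\<close> of
  \<open>alpha_hat\<close> at 0.\<close>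

definition universal_constant :: real where
  "universal_constant = limit_integral * ((4 * pi) powr (5/3) * (32 * pi ^ 4) powr (-2/3)) / (16 * pi\<^sup>2)"

lemma diffusivity_eq:
  assumes "B \<noteq> 0" "0 < \<gamma>"
  shows "universal_constant * \<bar>B\<bar> powr (-1/3) * \<gamma> powr (-2/3) * deriv (deriv alpha_hat) 0 = diffusivity B \<gamma>"
proof -
  have b: "0 < \<bar>B\<bar>" using assms by simp
  have V: "(2 * pi / (\<bar>B\<bar> / 2)) powr (5/3) = (4 * pi) powr (5/3) * \<bar>B\<bar> powr (-5/3)"
  proof -
    have "2 * pi / (\<bar>B\<bar> / 2) = 4 * pi / \<bar>B\<bar>" by simp
    then have "(2 * pi / (\<bar>B\<bar> / 2)) powr (5/3) = (4 * pi) powr (5/3) / \<bar>B\<bar> powr (5/3)"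
      using b by (simp only: powr_divide)
    also have "\<dots> = (4 * pi) powr (5/3) * \<bar>B\<bar> powr (-(5/3))"
      by (simp only: powr_minus divide_inverse)
    finally show ?thesis by simp
  qed
  have L: "slow_coeff \<gamma> (\<bar>B\<bar> / 2) powr (-2/3) = (32 * pi ^ 4) powr (-2/3) * \<gamma> powr (-2/3) * \<bar>B\<bar> powr (4/3)"
  proof -
    have "slow_coeff \<gamma> (\<bar>B\<bar> / 2) = (32 * pi ^ 4) * \<gamma> / \<bar>B\<bar> powr 2"
      using b by (simp add: slow_coeff_def power_divide)
    then have "slow_coeff \<gamma> (\<bar>B\<bar> / 2) powr (-2/3)
        = (32 * pi ^ 4) powr (-2/3) * \<gamma> powr (-2/3) / (\<bar>B\<bar> powr 2) powr (-2/3)"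
      using assms by (simp only: powr_divide powr_mult)
    also have "(\<bar>B\<bar> powr 2) powr (-2/3) = inverse (\<bar>B\<bar> powr (4/3))"
      unfolding powr_powr powr_minus[symmetric] by simp
    finally show ?thesis by (simp only: divide_inverse inverse_inverse_eq)
  qed
  have Bp: "\<bar>B\<bar> powr (-5/3) * \<bar>B\<bar> powr (4/3) = \<bar>B\<bar> powr (-1/3)" unfolding powr_add[symmetric] by simp
  have P: "(2 * pi / (\<bar>B\<bar> / 2)) powr (5/3) * slow_coeff \<gamma> (\<bar>B\<bar> / 2) powr (-2/3)
      = (4 * pi) powr (5/3) * (32 * pi ^ 4) powr (-2/3) * \<gamma> powr (-2/3) * \<bar>B\<bar> powr (-1/3)"
    unfolding V L Bp[symmetric] by (simp only: mult_ac)
  show ?thesis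
    unfolding diffusivity_def P universal_constant_def deriv_deriv_alpha_hat by simp
qed

lemma diffusivity_pos:
  assumes "B \<noteq> 0" "0 < \<gamma>" shows "0 < diffusivity B \<gamma>"
proof -
  have "0 < slow_coeff \<gamma> (\<bar>B\<bar> / 2)" using assms by (simp add: slow_coeff_def)
  then show ?thesis unfolding diffusivity_def using assms limit_integral_pos
    by (intro divide_pos_pos mult_pos_pos) auto
qed

lemma rate_limit:
  assumes B: "B \<noteq> 0" and \<gamma>: "0 < \<gamma>"
  shows "(\<lambda>n. real n * ((\<integral>x. collision_rate B \<gamma> (fst x) (snd x) *
      (\<xi> * (1 / real n powr (3/5) * velocity (\<bar>B\<bar> / 2) (snd x)))\<^sup>2 /
      ((collision_rate B \<gamma> (fst x) (snd x))\<^sup>2 + (\<xi> * (1 / real n powr (3/5) * velocity (\<bar>B\<bar> / 2) (snd x)))\<^sup>2)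
      \<partial>mode_measure) / 2)) \<longlonglongrightarrow> diffusivity B \<gamma> * \<bar>\<xi>\<bar> powr (5/3)"
proof (rule LIMSEQ_imp_Suc)
  interpret K: relaxation_kernel mode_measure "\<lambda>x. collision_rate B \<gamma> (fst x) (snd x)" "1 / (4 * \<gamma>)" "8 * \<gamma>"
    by (rule mode_kernel[OF B \<gamma>])
  define b where "b = \<bar>B\<bar> / 2"
  have b: "0 < b" using B by (simp add: b_def)
  \<comment> \<open>This is the width of the window of wave numbers that matter; the spatial scaling
    is its third power and the time scale the inverse of its fifth power.\<close>
  define \<theta> where "\<theta> n = real (Suc n) powr (-1/5)" for n
  have \<theta>_pos: "0 < \<theta> n" for n by (simp add: \<theta>_def)
  have \<theta>_lim: "\<theta> \<longlonglongrightarrow> 0"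
  proof -
    have "(\<lambda>n. real n powr (-1/5)) \<longlonglongrightarrow> 0"
      by (rule tendsto_neg_powr) (auto simp: filterlim_real_sequentially)
    from LIMSEQ_Suc[OF this] show ?thesis by (simp add: \<theta>_def[abs_def])
  qed
  have \<theta>3: "1 / real (Suc n) powr (3/5) = \<theta> n ^ 3" and \<theta>5: "real (Suc n) = 1 / \<theta> n ^ 5" for n
  proof -
    have "\<theta> n ^ 3 = \<theta> n powr 3" "\<theta> n ^ 5 = \<theta> n powr 5"
      using powr_realpow[OF \<theta>_pos, of n 3] powr_realpow[OF \<theta>_pos, of n 5] by simp_all
    then have "\<theta> n ^ 3 = real (Suc n) powr (-(3/5))" "\<theta> n ^ 5 = real (Suc n) powr (-1)"
      unfolding \<theta>_def powr_powr by simp_all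
    then show "1 / real (Suc n) powr (3/5) = \<theta> n ^ 3" "real (Suc n) = 1 / \<theta> n ^ 5"
      by (simp_all only: powr_minus_divide) (simp del: of_nat_Suc)
  qed
  define Q where "Q t r k = r * (\<xi> * (t ^ 3 * velocity b k))\<^sup>2 / (r\<^sup>2 + (\<xi> * (t ^ 3 * velocity b k))\<^sup>2)" for t r k
  \<comment> \<open>Whatever the sign of \<open>B\<close>, one band is slow and the other fast, so
    the sum over bands takes the same form.\<close>
  have split: "(\<integral>x. Q t (collision_rate B \<gamma> (fst x) (snd x)) (snd x) \<partial>mode_measure)
      = (\<integral>k. indicator torus k * Q t (slow_rate \<gamma> b k) k \<partial>lborel) + (\<integral>k. indicator torus k * Q t (fast_rate \<gamma> b k) k \<partial>lborel)" for t
  proof -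
    have "integrable mode_measure (\<lambda>x. Q t (collision_rate B \<gamma> (fst x) (snd x)) (snd x))"
    proof (rule K.bounded_integrable[where B = "8 * \<gamma>"])
      show "(\<lambda>x. Q t (collision_rate B \<gamma> (fst x) (snd x)) (snd x)) \<in> borel_measurable mode_measure"
      proof (rule measurable_mode_measure)
        fix i :: nat
        have "(\<lambda>k. Q t (collision_rate B \<gamma> i k) k) \<in> borel_measurable borel" unfolding Q_def by measurable
        then show "(\<lambda>k. Q t (collision_rate B \<gamma> (fst (i, k)) (snd (i, k))) (snd (i, k))) \<in> borel_measurable (restrict_space lborel torus)"
          by (simp add: restrict_lborel_measurable)
      qed
      fix x :: "nat \<times> real"
      let ?r = "collision_rate B \<gamma> (fst x) (snd x)" and ?c = "(\<xi> * (t ^ 3 * velocity b (snd x)))\<^sup>2"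
      have r: "0 \<le> ?r" "?r \<le> 8 * \<gamma>" using collision_rate_bounds[OF B \<gamma>] by auto
      have "?r * ?c \<le> ?r * (?r\<^sup>2 + ?c)" using r by (intro mult_left_mono) auto
      moreover have "?r\<^sup>2 + ?c = 0 \<or> 0 < ?r\<^sup>2 + ?c"
        using sum_power2_ge_zero[of ?r "\<xi> * (t ^ 3 * velocity b (snd x))"] by (simp only: le_less) auto
      ultimately have "Q t ?r (snd x) \<le> ?r" unfolding Q_def using r(1) by (metis div_by_0 pos_divide_le_eq)
      moreover have "0 \<le> Q t ?r (snd x)" unfolding Q_def using r by simp
      ultimately show "norm (Q t ?r (snd x)) \<le> 8 * \<gamma>" using r by simp
    qed
    moreover have rate_eq: "collision_rate B \<gamma> i k = (if (i = 1) = (B > 0) then fast_rate \<gamma> b k else slow_rate \<gamma> b k)" for i k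
      by (simp only: collision_rate_def b_def)
    ultimately show ?thesis using integral_mode_measure[of "\<lambda>x. Q t (collision_rate B \<gamma> (fst x) (snd x)) (snd x)"]
      by (cases "B > 0") (simp_all add: rate_eq set_lebesgue_integral_def)
  qed
  have "(\<lambda>n. ((1 / \<theta> n ^ 5) * (\<integral>k. indicator torus k * Q (\<theta> n) (slow_rate \<gamma> b k) k \<partial>lborel)
        + (1 / \<theta> n ^ 5) * (\<integral>k. indicator torus k * Q (\<theta> n) (fast_rate \<gamma> b k) k \<partial>lborel)) / 2)
      \<longlonglongrightarrow> ((\<integral>q. q ^ 4 * slow_coeff \<gamma> b * (\<xi> * (2 * pi / b))\<^sup>2 /
        (q ^ 6 * (slow_coeff \<gamma> b)\<^sup>2 + (\<xi> * (2 * pi / b))\<^sup>2) \<partial>lborel) + 0) / 2"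
    unfolding Q_def
    by (rule tendsto_divide[OF tendsto_add[OF slow_rate_limit[OF \<gamma> b \<theta>_lim \<theta>_pos] fast_rate_limit[OF \<gamma> b \<theta>_lim \<theta>_pos]] tendsto_const]) simp
  also have "(\<integral>q. q ^ 4 * slow_coeff \<gamma> b * (\<xi> * (2 * pi / b))\<^sup>2 /
        (q ^ 6 * (slow_coeff \<gamma> b)\<^sup>2 + (\<xi> * (2 * pi / b))\<^sup>2) \<partial>lborel)
      = limit_integral * ((2 * pi / b) powr (5/3) * slow_coeff \<gamma> b powr (-2/3)) * \<bar>\<xi>\<bar> powr (5/3)"
    using \<gamma> b by (intro scaled_limit_integral) (auto simp: slow_coeff_def)
  finally have lim: "(\<lambda>n. (1 / \<theta> n ^ 5) * ((\<integral>x. Q (\<theta> n) (collision_rate B \<gamma> (fst x) (snd x)) (snd x) \<partial>mode_measure) / 2))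
      \<longlonglongrightarrow> diffusivity B \<gamma> * \<bar>\<xi>\<bar> powr (5/3)"
    by (simp add: split diffusivity_def b_def algebra_simps add_divide_distrib)
  then show "(\<lambda>n. real (Suc n) * ((\<integral>x. collision_rate B \<gamma> (fst x) (snd x) *
      (\<xi> * (1 / real (Suc n) powr (3/5) * velocity (\<bar>B\<bar> / 2) (snd x)))\<^sup>2 /
      ((collision_rate B \<gamma> (fst x) (snd x))\<^sup>2 + (\<xi> * (1 / real (Suc n) powr (3/5) * velocity (\<bar>B\<bar> / 2) (snd x)))\<^sup>2)
      \<partial>mode_measure) / 2)) \<longlonglongrightarrow> diffusivity B \<gamma> * \<bar>\<xi>\<bar> powr (5/3)"
    unfolding \<theta>3 by (simp only: Q_def \<theta>5 flip: b_def)
qed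

section \<open>From the Boltzmann equation to the limit theorem\<close>

text \<open>Packing band and wave number into one point turns a Boltzmann solution into an abstract
  transport solution. The radius \<open>R\<close> and the decay constant \<open>A\<close> are
  inherited from the data and thus common to all \<epsilon>, unlike the existential
  constants.\<close>

lemma boltzmann_transport:
  assumes B: "B \<noteq> 0" and \<gamma>: "0 < \<gamma>" and sol: "boltzmann_solution B \<gamma> \<epsilon> u0 u"
    and supp: "\<And>y k i. i \<in> {1, 2} \<Longrightarrow> R < \<bar>y\<bar> \<Longrightarrow> u0 y k i = 0" and R: "0 \<le> R"
    and decay: "\<And>k i \<xi>. i \<in> {1, 2} \<Longrightarrow> k \<in> torus \<Longrightarrow> norm (fourier (\<lambda>y. u0 y k i) \<xi>) \<le> A / (1 + \<xi>\<^sup>2)"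
  shows "\<exists>uy ut w Vb M. decaying_transport_solution mode_measure (\<lambda>x. collision_rate B \<gamma> (fst x) (snd x))
    (1 / (4 * \<gamma>)) (8 * \<gamma>) (\<lambda>x. \<epsilon> * velocity (\<bar>B\<bar> / 2) (snd x)) (\<lambda>y x t. u y (snd x) (fst x) t) uy ut w Vb R M A"
proof -
  interpret K: relaxation_kernel mode_measure "\<lambda>x. collision_rate B \<gamma> (fst x) (snd x)" "1 / (4 * \<gamma>)" "8 * \<gamma>"
    by (rule mode_kernel[OF B \<gamma>])
  note sol' = sol[unfolded boltzmann_solution_def]
  from conjunct1[OF sol'] obtain M where M': "\<forall>y. \<forall>k\<in>torus. \<forall>i\<in>{1, 2}. \<forall>t\<ge>0. norm (u y k i t) \<le> M" ..
  have M: "norm (u y k i t) \<le> M" if "k \<in> torus" "i \<in> {1, 2}" "0 \<le> t" for y k i t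
    using M'[rule_format, OF that] .
  have meas: "set_borel_measurable lborel torus (\<lambda>k. u y k i t)" if "i \<in> {1, 2}" "0 \<le> t" for y i t
    using conjunct1[OF conjunct2[OF sol'], rule_format, OF that] .
  have init: "u y k i 0 = u0 y k i" if "k \<in> torus" "i \<in> {1, 2}" for y k i
    using conjunct2[OF conjunct2[OF conjunct2[OF sol']], rule_format, OF that] .
  \<comment> \<open>The equation provides derivatives separately at each point of the phase space; a
    named predicate lets them be chosen as functions of that point.\<close>
  define P where "P x uy ut \<longleftrightarrow>
        continuous_on (UNIV \<times> {0..}) (\<lambda>(y, t). uy y t) \<and>
        continuous_on (UNIV \<times> {0..}) (\<lambda>(y, t). ut y t) \<and>
        (\<forall>y. \<forall>t\<ge>0.
           ((\<lambda>y'. u y' (snd x) (fst x) t) has_vector_derivative uy y t) (at y) \<and>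
           ((\<lambda>t'. u y (snd x) (fst x) t') has_vector_derivative ut y t) (at t within {0..}) \<and>
           ut y t + of_real (\<epsilon> * (1 / (2 * pi)) * omega_deriv B (snd x)) * uy y t
             = of_real \<gamma> * collision B (\<lambda>k' j. u y k' j t) (snd x) (fst x))" for x :: "nat \<times> real" and uy ut
  have "\<forall>x\<in>space mode_measure. \<exists>uy ut. P x uy ut"
  proof
    fix x assume "x \<in> space mode_measure"
    then have x: "snd x \<in> torus" "fst x \<in> {1, 2}" by (auto simp: space_mode_measure)
    from bspec[OF bspec[OF conjunct1[OF conjunct2[OF conjunct2[OF sol']]] x(1)] x(2)]
    show "\<exists>uy ut. P x uy ut" unfolding P_def .
  qed
  then obtain uy ut where P: "\<And>x. x \<in> space mode_measure \<Longrightarrow> P x (uy x) (ut x)"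
    by metis
  define w where "w y t = of_real (1 / (4 * \<gamma>)) *
    (\<integral>x. of_real (collision_rate B \<gamma> (fst x) (snd x)) * u y (snd x) (fst x) t \<partial>mode_measure)" for y t
  have vel_meas: "(\<lambda>x. \<epsilon> * velocity (\<bar>B\<bar> / 2) (snd x)) \<in> borel_measurable mode_measure"
    by (rule measurable_mode_measure) (simp add: restrict_lborel_measurable)
  have T: "transport_solution mode_measure (\<lambda>x. collision_rate B \<gamma> (fst x) (snd x))
    (1 / (4 * \<gamma>)) (8 * \<gamma>) (\<lambda>x. \<epsilon> * velocity (\<bar>B\<bar> / 2) (snd x)) (\<lambda>y x t. u y (snd x) (fst x) t) uy ut w
    (\<bar>\<epsilon>\<bar> * (1 / (\<bar>B\<bar> / 2))) R M"
  proof unfold_locales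
    show "\<bar>\<epsilon> * velocity (\<bar>B\<bar> / 2) (snd x)\<bar> \<le> \<bar>\<epsilon>\<bar> * (1 / (\<bar>B\<bar> / 2))" for x :: "nat \<times> real"
      unfolding abs_mult using B by (intro mult_left_mono velocity_le) auto
    show "(\<lambda>x. u y (snd x) (fst x) t) \<in> borel_measurable mode_measure" if "0 \<le> t" for y t
    proof (rule measurable_mode_measure)
      fix j :: nat assume "j \<in> {1, 2}"
      from meas[OF this that] show "(\<lambda>k. u y (snd (j, k)) (fst (j, k)) t) \<in> borel_measurable (restrict_space lborel torus)"
        by (simp add: borel_measurable_restrict_space_iff set_borel_measurable_def)
    qed
    show "ut x y t + of_real (\<epsilon> * velocity (\<bar>B\<bar> / 2) (snd x)) * uy x y t
        = of_real (collision_rate B \<gamma> (fst x) (snd x)) * (w y t - u y (snd x) (fst x) t)"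
      if x: "x \<in> space mode_measure" and t: "0 \<le> t" for x y t
    proof -
      have "\<epsilon> * (1 / (2 * pi)) * omega_deriv B (snd x) = \<epsilon> * velocity (\<bar>B\<bar> / 2) (snd x)"
        by (simp add: omega_deriv_velocity[OF B])
      moreover have "of_real \<gamma> * collision B (\<lambda>k' j. u y k' j t) (snd x) (fst x)
          = of_real (collision_rate B \<gamma> (fst x) (snd x)) * (w y t - u y (snd x) (fst x) t)"
        unfolding w_def
        by (rule collision_relaxation[OF B \<gamma>, where M = M]) (use x t meas M in \<open>auto simp: space_mode_measure\<close>)
      ultimately show ?thesis using P[OF x] t unfolding P_def by metis
    qed
  qed (use P M init supp R vel_meas in \<open>auto simp: P_def w_def space_mode_measure\<close>)
  then interpret T: transport_solution mode_measure "\<lambda>x. collision_rate B \<gamma> (fst x) (snd x)"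
    "1 / (4 * \<gamma>)" "8 * \<gamma>" "\<lambda>x. \<epsilon> * velocity (\<bar>B\<bar> / 2) (snd x)" "\<lambda>y x t. u y (snd x) (fst x) t" uy ut w
    "\<bar>\<epsilon>\<bar> * (1 / (\<bar>B\<bar> / 2))" R M .
  have "decaying_transport_solution mode_measure (\<lambda>x. collision_rate B \<gamma> (fst x) (snd x))
    (1 / (4 * \<gamma>)) (8 * \<gamma>) (\<lambda>x. \<epsilon> * velocity (\<bar>B\<bar> / 2) (snd x)) (\<lambda>y x t. u y (snd x) (fst x) t) uy ut w
    (\<bar>\<epsilon>\<bar> * (1 / (\<bar>B\<bar> / 2))) R M A"
  proof unfold_locales
    show "(\<integral>x. (collision_rate B \<gamma> (fst x) (snd x))\<^sup>2 * (s * (\<epsilon> * velocity (\<bar>B\<bar> / 2) (snd x))) /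
        ((collision_rate B \<gamma> (fst x) (snd x))\<^sup>2 + (s * (\<epsilon> * velocity (\<bar>B\<bar> / 2) (snd x)))\<^sup>2) \<partial>mode_measure) = 0" for s
      using velocity_odd_integral[OF B \<gamma>, of "s * \<epsilon>" "\<bar>B\<bar> / 2"] by (simp add: mult.assoc)
    show "norm (T.mode \<xi> x 0) \<le> A / (1 + \<xi>\<^sup>2)" if "x \<in> space mode_measure" for x \<xi>
      using that decay[of "fst x" "snd x" \<xi>] init[of "snd x" "fst x"] by (auto simp: T.mode_def space_mode_measure)
  qed
  then show ?thesis by blast
qed

text \<open>The mean-square statement is restricted to \<open>t > 0\<close>: at \<open>t = 0\<close>
  the sequence is constant, and data that differ from half their density give a nonzero value. The
  density statement includes \<open>t = 0\<close>. The family \<open>u\<close> is arbitrary, so the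
  limit holds for every choice of solutions.\<close>

theorem theorem2:
  shows "\<exists>C::real. \<forall>B \<gamma> :: real. B \<noteq> 0 \<longrightarrow> \<gamma> > 0 \<longrightarrow>
    (let D = C * \<bar>B\<bar> powr (-1/3) * \<gamma> powr (-2/3) * deriv (deriv alpha_hat) 0
     in D > 0 \<and>
       (\<forall>(u0 :: real \<Rightarrow> real \<Rightarrow> nat \<Rightarrow> complex)
         (u :: nat \<Rightarrow> real \<Rightarrow> real \<Rightarrow> nat \<Rightarrow> real \<Rightarrow> complex).
          (\<forall>i\<in>{1, 2}. test_function (\<lambda>y k. u0 y k i)) \<longrightarrow>
          (\<forall>N\<ge>1. boltzmann_solution B \<gamma> (1 / real N powr (3/5)) u0 (u N)) \<longrightarrow>
          (let ubar = (\<lambda>y t. fractional_heat D (5/6) t (local_density u0) y)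
           in (\<forall>y. \<forall>t>0.
                (\<lambda>N. \<Sum>i\<in>{1, 2}. LINT k:torus|lborel.
                   (norm (u N y k i (real N * t) - 1/2 * ubar y t))\<^sup>2) \<longlonglongrightarrow> 0) \<and>
              (\<forall>y. \<forall>t\<ge>0.
                (\<lambda>N. (norm ((\<Sum>i\<in>{1, 2}. LINT k:torus|lborel. u N y k i (real N * t))
                   - ubar y t))\<^sup>2) \<longlonglongrightarrow> 0))))"
proof (intro exI[of _ universal_constant] allI impI)
  fix B \<gamma> :: real
  assume B: "B \<noteq> 0" and \<gamma>: "\<gamma> > 0"
  interpret K: relaxation_kernel mode_measure "\<lambda>x. collision_rate B \<gamma> (fst x) (snd x)" "1 / (4 * \<gamma>)" "8 * \<gamma>"
    by (rule mode_kernel[OF B \<gamma>])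
  define D where "D = diffusivity B \<gamma>"
  have main: "(0 < t \<longrightarrow> (\<lambda>N. \<Sum>i\<in>{1, 2}. LINT k:torus|lborel.
        (norm (u N y k i (real N * t) - 1/2 * fractional_heat D (5/6) t (local_density u0) y))\<^sup>2) \<longlonglongrightarrow> 0) \<and>
      (\<lambda>N. (norm ((\<Sum>i\<in>{1, 2}. LINT k:torus|lborel. u N y k i (real N * t))
        - fractional_heat D (5/6) t (local_density u0) y))\<^sup>2) \<longlonglongrightarrow> 0"
    if test: "\<forall>i\<in>{1, 2}. test_function (\<lambda>y k. u0 y k i)"
      and sol: "\<forall>N\<ge>1. boltzmann_solution B \<gamma> (1 / real N powr (3/5)) u0 (u N)" and t: "0 \<le> t"
    for u0 :: "real \<Rightarrow> real \<Rightarrow> nat \<Rightarrow> complex" and u :: "nat \<Rightarrow> real \<Rightarrow> real \<Rightarrow> nat \<Rightarrow> real \<Rightarrow> complex" and y t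
  proof -
    have "\<exists>R A. 0 \<le> R \<and> (\<forall>y k. R < \<bar>y\<bar> \<longrightarrow> u0 y k i = 0) \<and>
        (\<forall>k \<xi>. \<bar>k\<bar> \<le> 1 / 2 \<longrightarrow> norm (fourier (\<lambda>y. u0 y k i) \<xi>) \<le> A / (1 + \<xi>\<^sup>2))" if "i \<in> {1, 2}" for i
      using test_function_decay[of "\<lambda>y k. u0 y k i"] test that by metis
    then obtain R A where RA: "\<And>i. i \<in> {1, 2} \<Longrightarrow> 0 \<le> R i"
        "\<And>i y k. i \<in> {1, 2} \<Longrightarrow> R i < \<bar>y\<bar> \<Longrightarrow> u0 y k i = 0"
        "\<And>i k \<xi>. i \<in> {1, 2} \<Longrightarrow> \<bar>k\<bar> \<le> 1 / 2 \<Longrightarrow> norm (fourier (\<lambda>y. u0 y k i) \<xi>) \<le> A i / (1 + \<xi>\<^sup>2)"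
      by metis
    define R0 where "R0 = max (R 1) (R 2)"
    define A0 where "A0 = max (A 1) (A 2)"
    have supp: "u0 y k i = 0" if "i \<in> {1, 2}" "R0 < \<bar>y\<bar>" for y k i
      using RA(2)[OF that(1), of y k] that by (auto simp: R0_def)
    have R0: "0 \<le> R0" using RA(1)[of 1] by (simp add: R0_def)
    have decay: "norm (fourier (\<lambda>y. u0 y k i) \<xi>) \<le> A0 / (1 + \<xi>\<^sup>2)" if "i \<in> {1, 2}" "k \<in> torus" for k i \<xi>
    proof -
      have "\<bar>k\<bar> \<le> 1 / 2" using that by (auto simp: torus_def)
      from RA(3)[OF that(1) this, of \<xi>] have "norm (fourier (\<lambda>y. u0 y k i) \<xi>) \<le> A i / (1 + \<xi>\<^sup>2)" .
      also have "\<dots> \<le> A0 / (1 + \<xi>\<^sup>2)" using that(1) by (intro divide_right_mono) (auto simp: A0_def)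
      finally show ?thesis .
    qed
    define U where "U N y x t = u N y (snd x) (fst x) t" for N y t and x :: "nat \<times> real"
    define U0 where "U0 y x = u0 y (snd x) (fst x)" for y and x :: "nat \<times> real"
    define Tr where "Tr N = decaying_transport_solution mode_measure (\<lambda>x. collision_rate B \<gamma> (fst x) (snd x))
      (1 / (4 * \<gamma>)) (8 * \<gamma>) (\<lambda>x. 1 / real N powr (3/5) * velocity (\<bar>B\<bar> / 2) (snd x)) (U N)" for N
    have "\<exists>uy ut w Vb M. Tr N uy ut w Vb R0 M A0" if "1 \<le> N" for N
    proof -
      have "boltzmann_solution B \<gamma> (1 / real N powr (3/5)) u0 (u N)" using sol that by blast
      from boltzmann_transport[OF B \<gamma> this supp R0 decay] show ?thesis
        by (simp only: Tr_def U_def[abs_def])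
    qed
    then have "\<forall>N. \<exists>uy ut w Vb M. 1 \<le> N \<longrightarrow> Tr N uy ut w Vb R0 M A0" by blast
    then obtain uy ut w Vb M where Tr: "\<forall>N. 1 \<le> N \<longrightarrow> Tr N (uy N) (ut N) (w N) (Vb N) R0 (M N) A0"
      unfolding choice_iff by blast
    have T: "decaying_transport_solution mode_measure (\<lambda>x. collision_rate B \<gamma> (fst x) (snd x))
      (1 / (4 * \<gamma>)) (8 * \<gamma>) (\<lambda>x. 1 / real N powr (3/5) * velocity (\<bar>B\<bar> / 2) (snd x)) (U N) (uy N) (ut N) (w N) (Vb N) R0 (M N) A0"
      if "1 \<le> N" for N
      using Tr that by (simp only: Tr_def simp_thms)
    have init: "U N y x 0 = U0 y x" if "1 \<le> N" "x \<in> space mode_measure" for N y x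
      using sol that unfolding boltzmann_solution_def U_def U0_def space_mode_measure by auto
    have eps: "(\<lambda>N. 1 / real N powr (3/5)) \<longlonglongrightarrow> 0"
    proof -
      have "(\<lambda>N. real N powr (-(3/5))) \<longlonglongrightarrow> 0"
        by (rule tendsto_neg_powr) (auto simp: filterlim_real_sequentially)
      then show ?thesis by (simp only: powr_minus_divide)
    qed
    have vel: "(\<lambda>x. velocity (\<bar>B\<bar> / 2) (snd x)) \<in> borel_measurable mode_measure"
      by (rule measurable_mode_measure) (simp add: restrict_lborel_measurable)
    have U_meas: "(\<lambda>x. U N y x (real N * t)) \<in> borel_measurable mode_measure"
      and U_bdd: "\<And>x. x \<in> space mode_measure \<Longrightarrow> norm (U N y x (real N * t)) \<le> M N" if N: "1 \<le> N" for N
    proof -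
      interpret S: decaying_transport_solution mode_measure "\<lambda>x. collision_rate B \<gamma> (fst x) (snd x)"
        "1 / (4 * \<gamma>)" "8 * \<gamma>" "\<lambda>x. 1 / real N powr (3/5) * velocity (\<bar>B\<bar> / 2) (snd x)" "U N" "uy N" "ut N" "w N" "Vb N" R0 "M N" A0
        by (rule T[OF N])
      show "(\<lambda>x. U N y x (real N * t)) \<in> borel_measurable mode_measure" using t by (intro S.u_meas) simp
      show "norm (U N y x (real N * t)) \<le> M N" if "x \<in> space mode_measure" for x
        using t that by (intro S.u_bdd) simp_all
    qed
    \<comment> \<open>All solutions share the data, so the solution for \<open>N = 1\<close> at time
      0 provides what the exchange of integrals needs. The identity shows that only the total
      density of the data enters the limit.\<close>
    have dens: "(\<integral>x. fourier (\<lambda>y. U0 y x) \<xi> \<partial>mode_measure) = fourier (local_density u0) \<xi>" for \<xi>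
    proof -
      interpret S: decaying_transport_solution mode_measure "\<lambda>x. collision_rate B \<gamma> (fst x) (snd x)"
        "1 / (4 * \<gamma>)" "8 * \<gamma>" "\<lambda>x. 1 / real 1 powr (3/5) * velocity (\<bar>B\<bar> / 2) (snd x)" "U 1" "uy 1" "ut 1" "w 1" "Vb 1" R0 "M 1" A0
        by (rule T) simp
      have "(\<integral>x. fourier (\<lambda>y. U0 y x) \<xi> \<partial>mode_measure) = (\<integral>x. S.mode \<xi> x 0 \<partial>mode_measure)"
        by (rule Bochner_Integration.integral_cong) (simp_all only: S.mode_def init[OF order_refl])
      also have "\<dots> = fourier (\<lambda>y. \<integral>x. U 1 y x 0 \<partial>mode_measure) \<xi>" by (rule S.density_mode) simp
      also have "(\<lambda>y. \<integral>x. U 1 y x 0 \<partial>mode_measure) = local_density u0"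
      proof
        fix y
        have "integrable mode_measure (\<lambda>x. U 1 y x 0)"
          by (rule K.bounded_integrable[where B = "M 1"]) (intro S.u_meas S.u_bdd order_refl, assumption?)+
        then have "(\<integral>x. U 1 y x 0 \<partial>mode_measure) = (\<Sum>i\<in>{1, 2}. LINT k:torus|lborel. U 1 y (i, k) 0)"
          by (rule integral_mode_measure)
        also have "\<dots> = local_density u0 y"
          unfolding local_density_def
          by (intro sum.cong set_lebesgue_integral_cong) (use init[of 1] in \<open>auto simp: space_mode_measure U0_def\<close>)
        finally show "(\<integral>x. U 1 y x 0 \<partial>mode_measure) = local_density u0 y" .
      qed
      finally show ?thesis .
    qed
    define ub where "ub = fractional_heat D (5/6) t (local_density u0) y"
    have ub_eq: "of_real (1 / (2 * pi)) * (\<integral>\<xi>. exp (\<i> * of_real (\<xi> * y)) *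
      (of_real (exp (- (D * \<bar>\<xi>\<bar> powr (5/3)) * t)) * (\<integral>x. fourier (\<lambda>y. U0 y x) \<xi> \<partial>mode_measure)) \<partial>lborel) = ub"
      unfolding ub_def fractional_heat_def fourier_multiplier_def dens by (simp add: mult_ac)
    note lim = K.transport_limit[OF collision_rate_AE_pos[OF B \<gamma>] t eps vel T init rate_limit[OF B \<gamma>, folded D_def],
        where y = y, unfolded ub_eq]
    have lim1: "(\<lambda>N. \<integral>x. U N y x (real N * t) \<partial>mode_measure) \<longlonglongrightarrow> ub"
      by (rule lim(1))
    have lim2: "(\<lambda>N. \<integral>x. (norm (U N y x (real N * t) - ub / 2))\<^sup>2 \<partial>mode_measure) \<longlonglongrightarrow> 0" if "0 < t"
      by (rule lim(2)[OF _ _ _ that])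
    have ev: "\<forall>\<^sub>F N in sequentially. 1 \<le> N" by (rule eventually_ge_at_top)
    have "(\<lambda>N. (norm ((\<integral>x. U N y x (real N * t) \<partial>mode_measure) - ub))\<^sup>2) \<longlonglongrightarrow> (norm (ub - ub))\<^sup>2"
      by (intro tendsto_intros lim1)
    then have "(\<lambda>N. (norm ((\<integral>x. U N y x (real N * t) \<partial>mode_measure) - ub))\<^sup>2) \<longlonglongrightarrow> 0" by simp
    then have "(\<lambda>N. (norm ((\<Sum>i\<in>{1, 2}. LINT k:torus|lborel. u N y k i (real N * t)) - ub))\<^sup>2) \<longlonglongrightarrow> 0"
    proof (rule Lim_transform_eventually)
      show "\<forall>\<^sub>F N in sequentially. (norm ((\<integral>x. U N y x (real N * t) \<partial>mode_measure) - ub))\<^sup>2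
          = (norm ((\<Sum>i\<in>{1, 2}. LINT k:torus|lborel. u N y k i (real N * t)) - ub))\<^sup>2"
        using ev
      proof eventually_elim
        case (elim N)
        from integral_mode_measure[OF K.bounded_integrable[OF U_meas[OF elim] U_bdd[OF elim]]]
        show ?case by (simp add: U_def)
      qed
    qed
    moreover have "(\<lambda>N. \<Sum>i\<in>{1, 2}. LINT k:torus|lborel. (norm (u N y k i (real N * t) - 1/2 * ub))\<^sup>2) \<longlonglongrightarrow> 0"
      if "0 < t"
    proof (rule Lim_transform_eventually[OF lim2[OF that]])
      show "\<forall>\<^sub>F N in sequentially. (\<integral>x. (norm (U N y x (real N * t) - ub / 2))\<^sup>2 \<partial>mode_measure)
          = (\<Sum>i\<in>{1, 2}. LINT k:torus|lborel. (norm (u N y k i (real N * t) - 1/2 * ub))\<^sup>2)"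
        using ev
      proof eventually_elim
        case (elim N)
        have "integrable mode_measure (\<lambda>x. (norm (U N y x (real N * t) - ub / 2))\<^sup>2)"
        proof (rule K.bounded_integrable[where B = "(M N + norm (ub / 2))\<^sup>2"])
          show "(\<lambda>x. (norm (U N y x (real N * t) - ub / 2))\<^sup>2) \<in> borel_measurable mode_measure"
            using U_meas[OF elim] by measurable
          fix x assume x: "x \<in> space mode_measure"
          have "norm (U N y x (real N * t) - ub / 2) \<le> M N + norm (ub / 2)"
            using U_bdd[OF elim x] norm_triangle_ineq4[of "U N y x (real N * t)" "ub / 2"] by linarith
          from power_mono[OF this norm_ge_zero, of 2]
          show "norm ((norm (U N y x (real N * t) - ub / 2))\<^sup>2) \<le> (M N + norm (ub / 2))\<^sup>2" by simp
        qed
        from integral_mode_measure[OF this] show ?case by (simp add: U_def)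
      qed
    qed
    ultimately show ?thesis unfolding ub_def by blast
  qed
  show "let D = universal_constant * \<bar>B\<bar> powr (-1/3) * \<gamma> powr (-2/3) * deriv (deriv alpha_hat) 0
     in D > 0 \<and>
       (\<forall>(u0 :: real \<Rightarrow> real \<Rightarrow> nat \<Rightarrow> complex)
         (u :: nat \<Rightarrow> real \<Rightarrow> real \<Rightarrow> nat \<Rightarrow> real \<Rightarrow> complex).
          (\<forall>i\<in>{1, 2}. test_function (\<lambda>y k. u0 y k i)) \<longrightarrow>
          (\<forall>N\<ge>1. boltzmann_solution B \<gamma> (1 / real N powr (3/5)) u0 (u N)) \<longrightarrow>
          (let ubar = (\<lambda>y t. fractional_heat D (5/6) t (local_density u0) y)
           in (\<forall>y. \<forall>t>0.
                (\<lambda>N. \<Sum>i\<in>{1, 2}. LINT k:torus|lborel.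
                   (norm (u N y k i (real N * t) - 1/2 * ubar y t))\<^sup>2) \<longlonglongrightarrow> 0) \<and>
              (\<forall>y. \<forall>t\<ge>0.
                (\<lambda>N. (norm ((\<Sum>i\<in>{1, 2}. LINT k:torus|lborel. u N y k i (real N * t))
                   - ubar y t))\<^sup>2) \<longlonglongrightarrow> 0)))"
    unfolding diffusivity_eq[OF B \<gamma>] Let_def D_def[symmetric]
  proof (intro conjI allI impI)
    show "0 < D" unfolding D_def by (rule diffusivity_pos[OF B \<gamma>])
  next
    fix u0 u y and t :: real
    assume test: "\<forall>i\<in>{1, 2}. test_function (\<lambda>y k. u0 y k i)"
      and sol: "\<forall>N\<ge>1. boltzmann_solution B \<gamma> (1 / real N powr (3/5)) u0 (u N)" and t: "0 < t"
    show "(\<lambda>N. \<Sum>i\<in>{1, 2}. LINT k:torus|lborel.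
        (norm (u N y k i (real N * t) - 1/2 * fractional_heat D (5/6) t (local_density u0) y))\<^sup>2) \<longlonglongrightarrow> 0"
      by (rule mp[OF conjunct1[OF main[OF test sol less_imp_le[OF t]]] t])
  next
    fix u0 u y and t :: real
    assume test: "\<forall>i\<in>{1, 2}. test_function (\<lambda>y k. u0 y k i)"
      and sol: "\<forall>N\<ge>1. boltzmann_solution B \<gamma> (1 / real N powr (3/5)) u0 (u N)" and t: "0 \<le> t"
    show "(\<lambda>N. (norm ((\<Sum>i\<in>{1, 2}. LINT k:torus|lborel. u N y k i (real N * t))
        - fractional_heat D (5/6) t (local_density u0) y))\<^sup>2) \<longlonglongrightarrow> 0"
      by (rule conjunct2[OF main[OF test sol t]])
  qed
qed

end
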